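(* Let $d\ge2$, let $\Omega\subset\mathbb R^d$ be a bounded region with smooth boundary, let $A,V,\sigma$ satisfy the standing assumptions in the context, and suppose $\sigma>0$ on $\partial\Omega$. Let $\lambda_j^{\mathscr R_+}$ be the $j$-th eigenvalue of the magnetic Schrödinger operator $H_{A,V}^{\mathscr R}$ with Robin boundary condition. Then for any $k\in\mathbb N$, $$\sum_{j=1}^k\lambda_j^{\mathscr R_+}\le \mathcal C_{d,k}(\Omega)+k^2\frac{\mathrm{Ar}(\Omega)}{\mathrm{Vol}(\Omega)}\|\sigma\|_{L^\infty(\partial\Omega)}+k^2\frac{\|A\|_{L^2(\Omega)}^2}{\mathrm{Vol}(\Omega)}+k\frac{\|V\|_{L^1(\Omega)}}{\mathrm{Vol}(\Omega)}.$$
   Context: $\mathbb N=\{1,2,3,\dots\}$. $H_{A,V}^{\mathscr R}=(D_x-A)^2+V$, $D_x=\frac1i\nabla_x$, is the operator on $L^2(\Omega)$ with Robin boundary condition $(\nabla-iA)u\cdot\mathbf n=-\sigma u$ on $\partial\Omega$ ($\mathbf n$ the outer normal), defined by closing the quadratic form $$q[u]=\|(\nabla-iA)u\|_{L^2(\Omega)}^2+\langle Vu,u\rangle_{L^2(\Omega)}+\int_{\partial\Omega}\sigma(x)|u(x)|^2\,dS$$ on $\{u\in L^2(\Omega):(\nabla-iA)u\in L^2(\Omega)^d,\ V^{1/2}u\in L^2(\Omega)\}$, $dS$ the surface measure. Standing assumptions: $A:\Omega\to\mathbb R^d$ is in $L^2_{\rm loc}(\Omega)^d$; $V:\Omega\to\mathbb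 R$, $0\le V\in L^1_{\rm loc}(\Omega)$; $\sigma\in L^\infty(\partial\Omega)$ is real valued; $(H_{A,V}^{\mathscr R}+1)^{-1}$ is compact on $L^2(\Omega)$; all eigenvalues of $H_{A,V}^{\mathscr R}$ are positive. The eigenvalues are enumerated in nondecreasing order, repeated according to multiplicity. $\mathrm{Ar}(\Omega)$ is the surface area of $\Omega$ (the surface measure of $\partial\Omega$), $\omega_d$ the volume of the unit ball of $\mathbb R^d$, and $$\mathcal C_{d,k}(\Omega)=\frac{d}{d+2}(2\pi)^2\left(\omega_d\,\mathrm{Vol}(\Omega)\right)^{-2/d}k^{1+2/d}.$$ Norms may take the value $+\infty$. *)

theory Defs
  imports
    "HOL-Analysis.Analysis"
    "HOL-Probability.Essential_Supremum"
    "HOL-Library.Extended_Nat"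
begin

section \<open>Regions with smooth boundary\<close>

text \<open>On an open set \<open>U\<close> of a finite-dimensional space, \<open>Ck_on n f U\<close> says that \<open>f\<close> is of class
  \<open>C\<^sup>n\<close>: all directional derivatives up to order \<open>n\<close> exist and are continuous.\<close>

fun Ck_on :: "nat \<Rightarrow> ('a::real_normed_vector \<Rightarrow> real) \<Rightarrow> 'a set \<Rightarrow> bool" where
  "Ck_on 0 f U \<longleftrightarrow> continuous_on U f"
| "Ck_on (Suc n) f U \<longleftrightarrow>
     (\<forall>x\<in>U. f differentiable (at x)) \<and>
     (\<forall>v. Ck_on n (\<lambda>x. frechet_derivative f (at x) v) U)"

definition smooth_on :: "('a::real_normed_vector \<Rightarrow> real) \<Rightarrow> 'a set \<Rightarrow> bool" where
  "smooth_on f U \<longleftrightarrow> (\<forall>n. Ck_on n f U)"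

text \<open>The region lies locally on one side of its boundary: near each boundary point it is the
  sublevel set of a smooth function with nowhere vanishing derivative.\<close>

definition smooth_boundary :: "(real^'n) set \<Rightarrow> bool" where
  "smooth_boundary \<Omega> \<longleftrightarrow>
     (\<forall>p\<in>frontier \<Omega>. \<exists>U \<rho>. open U \<and> p \<in> U \<and> smooth_on \<rho> U \<and>
        (\<forall>x\<in>U. frechet_derivative \<rho> (at x) \<noteq> (\<lambda>_. 0)) \<and>
        \<Omega> \<inter> U = {x\<in>U. \<rho> x < 0})"

definition bounded_smooth_region :: "(real^'n) set \<Rightarrow> bool" where
  "bounded_smooth_region \<Omega> \<longleftrightarrow>
     \<Omega> \<noteq> {} \<and> open \<Omega> \<and> connected \<Omega> \<and> bounded \<Omega> \<and> smooth_boundary \<Omega>"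


section \<open>Surface measure\<close>

text \<open>The surface measure is the Hausdorff measure of codimension one, normalised so that it
  agrees with Lebesgue measure on hyperplanes. (In dimension 1 the convention \<open>0 ^ 0 = 1\<close> makes
  empty covering sets count; only dimension at least 2 is used.)\<close>

definition hausdorff_pre :: "real \<Rightarrow> (real^'n) set \<Rightarrow> ennreal" where
  "hausdorff_pre \<delta> E =
     Inf {(\<Sum>i. ennreal (unit_ball_vol (real (CARD('n) - 1)) * (diameter (C i) / 2) ^ (CARD('n) - 1)))
          | C :: nat \<Rightarrow> (real^'n) set.
            E \<subseteq> (\<Union>i. C i) \<and> (\<forall>i. bounded (C i) \<and> diameter (C i) \<le> \<delta>)}"

definition hausdorff_codim1 :: "(real^'n) set \<Rightarrow> ennreal" where
  "hausdorff_codim1 E = (SUP \<delta>\<in>{0<..}. hausdorff_pre \<delta> E)"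

definition surface_measure :: "(real^'n) set \<Rightarrow> (real^'n) measure" where
  "surface_measure \<Omega> = restrict_space (measure_of UNIV (sets borel) hausdorff_codim1) (frontier \<Omega>)"

definition Ar :: "(real^'n) set \<Rightarrow> ennreal" where
  "Ar \<Omega> = emeasure (surface_measure \<Omega>) (frontier \<Omega>)"


section \<open>Square-integrable functions\<close>

text \<open>Elements of \<open>L\<^sup>2\<close> are represented by functions; functions equal almost everywhere are
  identified by hand where this matters (uniqueness, linear independence).\<close>

definition L2 :: "'a measure \<Rightarrow> ('a \<Rightarrow> complex) set" where
  "L2 M = {u. u \<in> borel_measurable M \<and> integrable M (\<lambda>x. (cmod (u x))\<^sup>2)}"

definition L2_inner :: "'a measure \<Rightarrow> ('a \<Rightarrow> complex) \<Rightarrow> ('a \<Rightarrow> complex) \<Rightarrow> complex" where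
  "L2_inner M u v = (\<integral>x. u x * cnj (v x) \<partial>M)"

definition L2_sqnorm :: "'a measure \<Rightarrow> ('a \<Rightarrow> complex) \<Rightarrow> real" where
  "L2_sqnorm M u = (\<integral>x. (cmod (u x))\<^sup>2 \<partial>M)"

definition L2_converges :: "'a measure \<Rightarrow> (nat \<Rightarrow> 'a \<Rightarrow> complex) \<Rightarrow> ('a \<Rightarrow> complex) \<Rightarrow> bool" where
  "L2_converges M s u \<longleftrightarrow> (\<lambda>n. L2_sqnorm M (\<lambda>x. s n x - u x)) \<longlonglongrightarrow> 0"


section \<open>Operators associated with quadratic forms\<close>

text \<open>A form is given by its domain \<open>D\<close> and the associated sesquilinear form \<open>q\<close>, so that the
  quadratic form is \<open>q u u\<close>. The domain of the closure of the form consists of the \<open>u\<close>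
  admitting an approximating sequence.\<close>

definition form_approx ::
  "'a measure \<Rightarrow> ('a \<Rightarrow> complex) set \<Rightarrow> (('a \<Rightarrow> complex) \<Rightarrow> ('a \<Rightarrow> complex) \<Rightarrow> complex)
     \<Rightarrow> (nat \<Rightarrow> 'a \<Rightarrow> complex) \<Rightarrow> ('a \<Rightarrow> complex) \<Rightarrow> bool" where
  "form_approx M D q s u \<longleftrightarrow>
     u \<in> L2 M \<and> (\<forall>n. s n \<in> D) \<and> L2_converges M s u \<and>
     (\<forall>\<epsilon>>0. \<exists>N. \<forall>m\<ge>N. \<forall>n\<ge>N. cmod (q (\<lambda>x. s m x - s n x) (\<lambda>x. s m x - s n x)) < \<epsilon>)"

text \<open>The self-adjoint operator \<open>H\<close> of the closure of the form, as a graph: \<open>H u = f\<close> iff \<open>u\<close>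
  is in the domain of the closure and the closure takes the value \<open>\<langle>f, v\<rangle>\<close> at \<open>(u, v)\<close>
  for each \<open>v\<close> in its domain. The value of the closure is the limit of \<open>q\<close> along approximating
  sequences.\<close>

definition form_operator ::
  "'a measure \<Rightarrow> ('a \<Rightarrow> complex) set \<Rightarrow> (('a \<Rightarrow> complex) \<Rightarrow> ('a \<Rightarrow> complex) \<Rightarrow> complex)
     \<Rightarrow> (('a \<Rightarrow> complex) \<times> ('a \<Rightarrow> complex)) set" where
  "form_operator M D q =
     {(u, f). f \<in> L2 M \<and>
        (\<exists>s. form_approx M D q s u \<and>
           (\<forall>v t. form_approx M D q t v \<longrightarrow> (\<lambda>n. q (s n) (t n)) \<longlonglongrightarrow> L2_inner M f v))}"

text \<open>\<open>(H + 1)\<^sup>-\<^sup>1\<close> as a graph.\<close>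

definition resolvent_graph ::
  "(('a \<Rightarrow> complex) \<times> ('a \<Rightarrow> complex)) set \<Rightarrow> (('a \<Rightarrow> complex) \<times> ('a \<Rightarrow> complex)) set" where
  "resolvent_graph H = {(f, u). (u, \<lambda>x. f x - u x) \<in> H}"

definition compact_resolvent ::
  "'a measure \<Rightarrow> (('a \<Rightarrow> complex) \<times> ('a \<Rightarrow> complex)) set \<Rightarrow> bool" where
  "compact_resolvent M H \<longleftrightarrow>
     (\<forall>f\<in>L2 M. \<exists>u. (f, u) \<in> resolvent_graph H) \<and>
     (\<forall>f u v. (f, u) \<in> resolvent_graph H \<longrightarrow> (f, v) \<in> resolvent_graph H \<longrightarrow> (AE x in M. u x = v x)) \<and>
     (\<forall>f u. (\<forall>n::nat. f n \<in> L2 M \<and> (f n, u n) \<in> resolvent_graph H) \<and> (\<exists>B. \<forall>n. L2_sqnorm M (f n) \<le> B) \<longrightarrow>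
        (\<exists>r w. strict_mono r \<and> w \<in> L2 M \<and> L2_converges M (u \<circ> r) w))"

definition eigenspace ::
  "(('a \<Rightarrow> complex) \<times> ('a \<Rightarrow> complex)) set \<Rightarrow> real \<Rightarrow> ('a \<Rightarrow> complex) set" where
  "eigenspace H t = {u. (u, \<lambda>x. complex_of_real t * u x) \<in> H}"

definition is_eigenvalue ::
  "'a measure \<Rightarrow> (('a \<Rightarrow> complex) \<times> ('a \<Rightarrow> complex)) set \<Rightarrow> real \<Rightarrow> bool" where
  "is_eigenvalue M H t \<longleftrightarrow> (\<exists>u\<in>eigenspace H t. \<not> (AE x in M. u x = 0))"

definition L2_independent :: "'a measure \<Rightarrow> nat \<Rightarrow> (nat \<Rightarrow> 'a \<Rightarrow> complex) \<Rightarrow> bool" where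
  "L2_independent M n u \<longleftrightarrow>
     (\<forall>c. (AE x in M. (\<Sum>i<n. c i * u i x) = 0) \<longrightarrow> (\<forall>i<n. c i = (0::complex)))"

definition multiplicity_of ::
  "'a measure \<Rightarrow> (('a \<Rightarrow> complex) \<times> ('a \<Rightarrow> complex)) set \<Rightarrow> real \<Rightarrow> enat" where
  "multiplicity_of M H t =
     Sup {enat n | n. \<exists>u. (\<forall>i<n. u i \<in> eigenspace H t) \<and> L2_independent M n u}"

text \<open>The index of \<open>lam\<close> starts at 1; the value \<open>lam 0\<close> is irrelevant.\<close>

definition eigenvalue_enumeration ::
  "'a measure \<Rightarrow> (('a \<Rightarrow> complex) \<times> ('a \<Rightarrow> complex)) set \<Rightarrow> (nat \<Rightarrow> real) \<Rightarrow> bool" where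
  "eigenvalue_enumeration M H lam \<longleftrightarrow>
     mono_on {1..} lam \<and>
     (\<forall>t. finite {j. 1 \<le> j \<and> lam j = t} \<and>
          enat (card {j. 1 \<le> j \<and> lam j = t}) = multiplicity_of M H t)"


section \<open>The magnetic gradient\<close>

definition test_function :: "(real^'n) set \<Rightarrow> (real^'n \<Rightarrow> real) \<Rightarrow> bool" where
  "test_function \<Omega> \<phi> \<longleftrightarrow>
     smooth_on \<phi> UNIV \<and> (\<exists>K. compact K \<and> K \<subseteq> \<Omega> \<and> (\<forall>x. x \<notin> K \<longrightarrow> \<phi> x = 0))"

text \<open>\<open>G\<close> is square-integrable and equals \<open>(\<nabla> - i A) u\<close> in the sense of distributions.\<close>

definition is_magnetic_gradient ::
  "(real^'n) set \<Rightarrow> (real^'n \<Rightarrow> real^'n) \<Rightarrow> (real^'n \<Rightarrow> complex) \<Rightarrow> (real^'n \<Rightarrow> complex^'n) \<Rightarrow> bool" where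
  "is_magnetic_gradient \<Omega> A u G \<longleftrightarrow>
     (\<forall>i. (\<lambda>x. G x $ i) \<in> L2 (lebesgue_on \<Omega>)) \<and>
     (\<forall>\<phi> i. test_function \<Omega> \<phi> \<longrightarrow>
        (\<integral>x. u x * complex_of_real (frechet_derivative \<phi> (at x) (axis i 1)) \<partial>lebesgue_on \<Omega>) =
        - (\<integral>x. (G x $ i + \<i> * complex_of_real (A x $ i) * u x) * complex_of_real (\<phi> x) \<partial>lebesgue_on \<Omega>))"

definition magnetic_gradient ::
  "(real^'n) set \<Rightarrow> (real^'n \<Rightarrow> real^'n) \<Rightarrow> (real^'n \<Rightarrow> complex) \<Rightarrow> (real^'n \<Rightarrow> complex^'n)" where
  "magnetic_gradient \<Omega> A u = (SOME G. is_magnetic_gradient \<Omega> A u G)"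


section \<open>Boundary values\<close>

text \<open>The trace of a Sobolev (or BV) function on a regular boundary, as the limit of its mean
  values: for almost every boundary point \<open>x\<close>, the mean of \<open>\<bar>w - z\<bar>\<close> over
  \<open>ball x r \<inter> \<Omega>\<close> tends to 0 for exactly one \<open>z\<close>, the value of the trace at \<open>x\<close>.\<close>

definition has_boundary_value :: "(real^'n) set \<Rightarrow> (real^'n \<Rightarrow> complex) \<Rightarrow> real^'n \<Rightarrow> complex \<Rightarrow> bool" where
  "has_boundary_value \<Omega> w x z \<longleftrightarrow>
     ((\<lambda>r. (\<integral>y. cmod (w y - z) \<partial>lebesgue_on (ball x r \<inter> \<Omega>)) / measure lebesgue (ball x r \<inter> \<Omega>))
        \<longlongrightarrow> 0) (at_right 0)"

definition boundary_value :: "(real^'n) set \<Rightarrow> (real^'n \<Rightarrow> complex) \<Rightarrow> real^'n \<Rightarrow> complex" where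
  "boundary_value \<Omega> w x = (THE z. has_boundary_value \<Omega> w x z)"

definition has_L2_trace :: "(real^'n) set \<Rightarrow> (real^'n \<Rightarrow> complex) \<Rightarrow> bool" where
  "has_L2_trace \<Omega> w \<longleftrightarrow>
     (AE x in surface_measure \<Omega>. \<exists>z. has_boundary_value \<Omega> w x z) \<and>
     boundary_value \<Omega> w \<in> L2 (surface_measure \<Omega>)"

text \<open>If \<open>A \<in> L\<^sup>2(\<Omega>)\<close> and \<open>u\<close>, \<open>(\<nabla> - i A) u\<close> are in \<open>L\<^sup>2(\<Omega>)\<close>, then \<open>u \<in> W\<^sup>1\<^sup>,\<^sup>1(\<Omega>)\<close> and
  \<open>\<bar>u\<bar> \<in> H\<^sup>1(\<Omega>)\<close>, so \<open>u\<close> has a trace and this trace is in \<open>L\<^sup>2(\<partial>\<Omega>)\<close>. If \<open>A\<close> is only locally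
  square-integrable, \<open>\<bar>u\<bar>\<close> and the products \<open>u * cnj v\<close> still have traces, but \<open>u\<close> need not,
  since its phase may oscillate at the boundary. A fixed phase factor \<open>\<theta>\<close> removes the
  oscillation for all \<open>u\<close> at once; one can take
  \<open>\<theta> = exp (- i \<integral> A \<cdot> dl)\<close> near the boundary, the integral being along the normals from a
  fixed parallel surface. The products (trace of \<open>\<theta> u\<close>) * cnj (trace of \<open>\<theta> v\<close>), in
  particular the boundary values of \<open>\<bar>u\<bar>\<^sup>2\<close>, do not depend on the choice of \<open>\<theta>\<close>.\<close>

definition boundary_phase :: "(real^'n) set \<Rightarrow> (real^'n \<Rightarrow> real^'n) \<Rightarrow> real^'n \<Rightarrow> complex" where
  "boundary_phase \<Omega> A =
     (if integrable (lebesgue_on \<Omega>) (\<lambda>x. (norm (A x))\<^sup>2) then (\<lambda>_. 1)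
      else (SOME \<theta>. \<theta> \<in> borel_measurable (lebesgue_on \<Omega>) \<and> (\<forall>x. cmod (\<theta> x) = 1) \<and>
              (\<forall>u G. u \<in> L2 (lebesgue_on \<Omega>) \<and> is_magnetic_gradient \<Omega> A u G \<longrightarrow>
                 has_L2_trace \<Omega> (\<lambda>x. \<theta> x * u x))))"

definition boundary_trace :: "(real^'n) set \<Rightarrow> (real^'n \<Rightarrow> real^'n) \<Rightarrow> (real^'n \<Rightarrow> complex) \<Rightarrow> real^'n \<Rightarrow> complex" where
  "boundary_trace \<Omega> A u = boundary_value \<Omega> (\<lambda>x. boundary_phase \<Omega> A x * u x)"


section \<open>The Robin form and its operator\<close>

text \<open>The last condition makes the boundary term meaningful; by the preceding remark it is
  implied by the others when the boundary is smooth.\<close>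

definition robin_form_domain ::
  "(real^'n) set \<Rightarrow> (real^'n \<Rightarrow> real^'n) \<Rightarrow> (real^'n \<Rightarrow> real) \<Rightarrow> (real^'n \<Rightarrow> complex) set" where
  "robin_form_domain \<Omega> A V =
     {u \<in> L2 (lebesgue_on \<Omega>).
        (\<exists>G. is_magnetic_gradient \<Omega> A u G) \<and>
        (\<lambda>x. complex_of_real (sqrt (V x)) * u x) \<in> L2 (lebesgue_on \<Omega>) \<and>
        has_L2_trace \<Omega> (\<lambda>x. boundary_phase \<Omega> A x * u x)}"

definition robin_form ::
  "(real^'n) set \<Rightarrow> (real^'n \<Rightarrow> real^'n) \<Rightarrow> (real^'n \<Rightarrow> real) \<Rightarrow> (real^'n \<Rightarrow> real)
     \<Rightarrow> (real^'n \<Rightarrow> complex) \<Rightarrow> (real^'n \<Rightarrow> complex) \<Rightarrow> complex" where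
  "robin_form \<Omega> A V \<sigma> u v =
     (\<integral>x. (\<Sum>i\<in>UNIV. magnetic_gradient \<Omega> A u x $ i * cnj (magnetic_gradient \<Omega> A v x $ i)) \<partial>lebesgue_on \<Omega>)
     + (\<integral>x. complex_of_real (V x) * u x * cnj (v x) \<partial>lebesgue_on \<Omega>)
     + (\<integral>x. complex_of_real (\<sigma> x) * boundary_trace \<Omega> A u x * cnj (boundary_trace \<Omega> A v x) \<partial>surface_measure \<Omega>)"

definition robin_operator ::
  "(real^'n) set \<Rightarrow> (real^'n \<Rightarrow> real^'n) \<Rightarrow> (real^'n \<Rightarrow> real) \<Rightarrow> (real^'n \<Rightarrow> real)
     \<Rightarrow> ((real^'n \<Rightarrow> complex) \<times> (real^'n \<Rightarrow> complex)) set" where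
  "robin_operator \<Omega> A V \<sigma> =
     form_operator (lebesgue_on \<Omega>) (robin_form_domain \<Omega> A V) (robin_form \<Omega> A V \<sigma>)"


section \<open>Norms and standing assumptions\<close>

definition L1_norm :: "'a measure \<Rightarrow> ('a \<Rightarrow> 'b::real_normed_vector) \<Rightarrow> ennreal" where
  "L1_norm M f = (\<integral>\<^sup>+x. ennreal (norm (f x)) \<partial>M)"

definition L2_norm_squared :: "'a measure \<Rightarrow> ('a \<Rightarrow> 'b::real_normed_vector) \<Rightarrow> ennreal" where
  "L2_norm_squared M f = (\<integral>\<^sup>+x. ennreal ((norm (f x))\<^sup>2) \<partial>M)"

definition Linf_norm :: "'a measure \<Rightarrow> ('a \<Rightarrow> 'b::real_normed_vector) \<Rightarrow> ennreal" where
  "Linf_norm M f = esssup M (\<lambda>x. ennreal (norm (f x)))"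

definition standing_assumptions ::
  "(real^'n) set \<Rightarrow> (real^'n \<Rightarrow> real^'n) \<Rightarrow> (real^'n \<Rightarrow> real) \<Rightarrow> (real^'n \<Rightarrow> real) \<Rightarrow> bool" where
  "standing_assumptions \<Omega> A V \<sigma> \<longleftrightarrow>
     A \<in> borel_measurable (lebesgue_on \<Omega>) \<and>
     (\<forall>K. compact K \<and> K \<subseteq> \<Omega> \<longrightarrow> integrable (lebesgue_on K) (\<lambda>x. (norm (A x))\<^sup>2)) \<and>
     V \<in> borel_measurable (lebesgue_on \<Omega>) \<and>
     (AE x in lebesgue_on \<Omega>. 0 \<le> V x) \<and>
     (\<forall>K. compact K \<and> K \<subseteq> \<Omega> \<longrightarrow> integrable (lebesgue_on K) V) \<and>
     \<sigma> \<in> borel_measurable (surface_measure \<Omega>) \<and> Linf_norm (surface_measure \<Omega>) \<sigma> < \<infinity> \<and>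
     compact_resolvent (lebesgue_on \<Omega>) (robin_operator \<Omega> A V \<sigma>) \<and>
     (\<forall>t. is_eigenvalue (lebesgue_on \<Omega>) (robin_operator \<Omega> A V \<sigma>) t \<longrightarrow> 0 < t)"

definition Vol :: "(real^'n) set \<Rightarrow> real" where
  "Vol \<Omega> = measure lebesgue \<Omega>"

definition weyl_term :: "(real^'n) set \<Rightarrow> nat \<Rightarrow> real" where
  "weyl_term \<Omega> k =
     (let d = real CARD('n) in
      d / (d + 2) * (2 * pi)\<^sup>2 * (unit_ball_vol d * Vol \<Omega>) powr (- 2 / d) * real k powr (1 + 2 / d))"

end

theory Submission
  imports Defs
begin

text \<open>
  The inequality follows from Kroeger's method, in which plane waves serve as trial functions. Let
  \<open>u\<^sub>1, \<dots>, u\<^sub>k\<close> be orthonormal eigenfunctions for \<open>\<lambda>\<^sub>1, \<dots>, \<lambda>\<^sub>k\<close>, let \<open>q\<close> be the Robin form, and let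
  \<open>h\<^sub>\<xi>(x) = exp (i \<xi> \<bullet> x)\<close>. The part of \<open>h\<^sub>\<xi>\<close> in the span of the \<open>u\<^sub>j\<close> contributes
  \<open>\<Sum>j. \<lambda>\<^sub>j \<bar>\<langle>h\<^sub>\<xi>, u\<^sub>j\<rangle>\<bar>\<^sup>2\<close> to the form, and on the remaining part the form is at least \<open>\<lambda>\<^bsub>k+1\<^esub>\<close> times
  the square norm (\<open>form_bounds_eigenvalue_means\<close>):
  \<open>\<Sum>j. \<lambda>\<^sub>j \<bar>\<langle>h\<^sub>\<xi>, u\<^sub>j\<rangle>\<bar>\<^sup>2 + \<lambda>\<^bsub>k+1\<^esub> (Vol(\<Omega>) - \<Sum>j. \<bar>\<langle>h\<^sub>\<xi>, u\<^sub>j\<rangle>\<bar>\<^sup>2) \<le> q(h\<^sub>\<xi>, h\<^sub>\<xi>)\<close>.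
  Since \<open>h\<^sub>\<xi>\<close> has modulus 1, the right-hand side is
  \<open>\<bar>\<xi>\<bar>\<^sup>2 Vol(\<Omega>) - 2 \<xi> \<bullet> \<integral>A + \<parallel>A\<parallel>\<^sup>2 + \<integral>V + \<integral>\<sigma>\<close> (\<open>q_plane_wave\<close>). Now integrate over a ball of
  frequencies with radius \<open>R\<close>. The linear term vanishes by symmetry, the quadratic one becomes the
  second moment of the ball, and by Plancherel's inequality \<open>\<bar>\<langle>h\<^sub>\<xi>, u\<^sub>j\<rangle>\<bar>\<^sup>2\<close> has integral at most
  \<open>(2 \<pi>)\<^sup>d\<close> (\<open>integral_inner_plane_wave_le\<close>). If \<open>R\<close> is chosen such that \<open>Vol(\<Omega>)\<close> times the volume of the
  ball is \<open>(2 \<pi>)\<^sup>d k\<close>, then \<open>\<lambda>\<^bsub>k+1\<^esub>\<close> drops out because of \<open>\<lambda>\<^sub>j \<le> \<lambda>\<^bsub>k+1\<^esub>\<close>, and what remains is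
  the claim with \<open>k\<close> in place of \<open>k\<^sup>2\<close> (\<open>eigenvalue_sum_le\<close>).

  The spectral part is carried out for \<open>T = (H + 1)\<^sup>-\<^sup>1\<close>, which is defined everywhere, symmetric and
  compact. The supremum of \<open>\<langle>T w, w\<rangle> / \<parallel>w\<parallel>\<^sup>2\<close> over the complement of the first \<open>k\<close> eigenfunctions is, if
  positive, attained at an eigenfunction, so it is at most \<open>1 / (\<lambda>\<^bsub>k+1\<^esub> + 1)\<close>
  (\<open>T_form_le_on_complement\<close>). The transfer to the form uses only
  \<open>2 Re \<langle>f, h\<rangle> - \<langle>T f, f\<rangle> \<le> q(h, h) + \<parallel>h\<parallel>\<^sup>2\<close>, which expresses that \<open>q + 1\<close> is nonnegative at \<open>T f - h\<close>
  and is obtained as a limit along sequences approximating \<open>T f\<close> (\<open>H_form_bound\<close>).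

  The evaluation of \<open>q\<close> at plane waves needs that the magnetic gradient, which is a choice among the
  distributional solutions, is determined almost everywhere
  (\<open>AE_eq_0_if_orthogonal_to_test_functions\<close>, based on bump functions made from \<open>exp (- 1/t)\<close>).
  Plancherel's inequality comes from Bessel's inequality for the exponentials on a cube containing
  \<open>\<Omega>\<close>, averaged over shifts of the lattice of frequencies.\<close>

section \<open>Square-integrable functions as a semi-inner-product space\<close>

lemma L2_measurable [measurable_dest]: "u \<in> L2 M \<Longrightarrow> u \<in> borel_measurable M"
  by (simp add: L2_def)

lemma L2_integrable_sq: "u \<in> L2 M \<Longrightarrow> integrable M (\<lambda>x. (cmod (u x))\<^sup>2)"
  by (simp add: L2_def)

lemma L2_integrable_mult:
  assumes u: "u \<in> L2 M" and v: "v \<in> L2 M"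
  shows "integrable M (\<lambda>x. u x * v x)"
proof (rule Bochner_Integration.integrable_bound)
  show "integrable M (\<lambda>x. (cmod (u x))\<^sup>2 + (cmod (v x))\<^sup>2)"
    using u v by (simp add: L2_integrable_sq)
  show "(\<lambda>x. u x * v x) \<in> borel_measurable M"
    using u v by measurable
  show "AE x in M. norm (u x * v x) \<le> norm ((cmod (u x))\<^sup>2 + (cmod (v x))\<^sup>2)"
  proof (rule AE_I2)
    fix x
    have "2 * (cmod (u x) * cmod (v x)) \<le> (cmod (u x))\<^sup>2 + (cmod (v x))\<^sup>2"
      using sum_squares_bound[of "cmod (u x)" "cmod (v x)"] by (simp add: mult.assoc)
    moreover have "0 \<le> cmod (u x) * cmod (v x)" by simp
    ultimately have "cmod (u x) * cmod (v x) \<le> (cmod (u x))\<^sup>2 + (cmod (v x))\<^sup>2"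
      by linarith
    then show "norm (u x * v x) \<le> norm ((cmod (u x))\<^sup>2 + (cmod (v x))\<^sup>2)"
      by (simp add: norm_mult)
  qed
qed

lemma borel_measurable_cnj [measurable (raw)]:
  "f \<in> borel_measurable M \<Longrightarrow> (\<lambda>x. cnj (f x)) \<in> borel_measurable M"
  by (rule borel_measurable_continuous_on[OF continuous_on_cnj[OF continuous_on_id]])

lemma L2_cnj: "u \<in> L2 M \<Longrightarrow> (\<lambda>x. cnj (u x)) \<in> L2 M"
  by (auto simp: L2_def)

lemma L2_integrable_inner:
  "u \<in> L2 M \<Longrightarrow> v \<in> L2 M \<Longrightarrow> integrable M (\<lambda>x. u x * cnj (v x))"
  by (rule L2_integrable_mult[OF _ L2_cnj])

lemma L2_zero [simp, intro]: "(\<lambda>x. 0) \<in> L2 M"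
  by (simp add: L2_def)

lemma L2_scale [intro]:
  assumes "u \<in> L2 M"
  shows "(\<lambda>x. c * u x) \<in> L2 M"
  using assms by (auto simp: L2_def norm_mult power_mult_distrib)

lemma L2_add [intro]:
  assumes u: "u \<in> L2 M" and v: "v \<in> L2 M"
  shows "(\<lambda>x. u x + v x) \<in> L2 M"
proof -
  have "(cmod (u x + v x))\<^sup>2
      = (cmod (u x))\<^sup>2 + (cmod (v x))\<^sup>2 + 2 * Re (u x * cnj (v x))" for x
    by (simp only: cmod_power2) (simp add: power2_eq_square algebra_simps)
  moreover have "integrable M (\<lambda>x. (cmod (u x))\<^sup>2 + (cmod (v x))\<^sup>2 + 2 * Re (u x * cnj (v x)))"
    using u v by (intro Bochner_Integration.integrable_add integrable_mult_right integrable_Re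
        L2_integrable_inner L2_integrable_sq)
  ultimately show ?thesis
    using u v by (auto simp: L2_def)
qed

lemma L2_diff [intro]:
  assumes "u \<in> L2 M" and "v \<in> L2 M"
  shows "(\<lambda>x. u x - v x) \<in> L2 M"
  using L2_add[OF assms(1) L2_scale[OF assms(2), of "-1"]] by simp

lemma L2_sum [intro]:
  "(\<And>i. i \<in> I \<Longrightarrow> u i \<in> L2 M) \<Longrightarrow> (\<lambda>x. \<Sum>i\<in>I. u i x) \<in> L2 M"
  by (induction I rule: infinite_finite_induct) auto

lemma L2_inner_add_left:
  assumes "u \<in> L2 M" "v \<in> L2 M" "w \<in> L2 M"
  shows "L2_inner M (\<lambda>x. u x + v x) w = L2_inner M u w + L2_inner M v w"
  using assms by (simp add: L2_inner_def distrib_right L2_integrable_inner)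

lemma L2_inner_diff_left:
  assumes "u \<in> L2 M" "v \<in> L2 M" "w \<in> L2 M"
  shows "L2_inner M (\<lambda>x. u x - v x) w = L2_inner M u w - L2_inner M v w"
  using assms by (simp add: L2_inner_def left_diff_distrib L2_integrable_inner)

lemma L2_inner_scale_left: "L2_inner M (\<lambda>x. c * u x) w = c * L2_inner M u w"
  by (simp add: L2_inner_def mult.assoc)

lemma L2_inner_cnj: "L2_inner M v u = cnj (L2_inner M u v)"
proof -
  have "L2_inner M v u = (\<integral>x. cnj (u x * cnj (v x)) \<partial>M)"
    by (simp add: L2_inner_def mult.commute)
  also have "\<dots> = cnj (\<integral>x. u x * cnj (v x) \<partial>M)" by (rule Bochner_Integration.integral_cnj)
  finally show ?thesis by (simp only: L2_inner_def)
qed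

lemma L2_inner_add_right:
  assumes "u \<in> L2 M" "v \<in> L2 M" "w \<in> L2 M"
  shows "L2_inner M w (\<lambda>x. u x + v x) = L2_inner M w u + L2_inner M w v"
  using assms by (simp add: L2_inner_cnj[of M w] L2_inner_add_left)

lemma L2_inner_diff_right:
  assumes "u \<in> L2 M" "v \<in> L2 M" "w \<in> L2 M"
  shows "L2_inner M w (\<lambda>x. u x - v x) = L2_inner M w u - L2_inner M w v"
  using assms by (simp add: L2_inner_cnj[of M w] L2_inner_diff_left)

lemma L2_inner_scale_right: "L2_inner M w (\<lambda>x. c * u x) = cnj c * L2_inner M w u"
  by (simp add: L2_inner_cnj[of M w] L2_inner_scale_left)

lemma L2_inner_zero [simp]: "L2_inner M (\<lambda>x. 0) v = 0" "L2_inner M u (\<lambda>x. 0) = 0"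
  by (simp_all add: L2_inner_def)

lemma L2_inner_sum_left:
  assumes "w \<in> L2 M" "\<And>i. i \<in> I \<Longrightarrow> u i \<in> L2 M"
  shows "L2_inner M (\<lambda>x. \<Sum>i\<in>I. u i x) w = (\<Sum>i\<in>I. L2_inner M (u i) w)"
  using assms by (induction I rule: infinite_finite_induct) (auto simp: L2_inner_add_left L2_sum)

lemma L2_inner_sum_right:
  assumes "w \<in> L2 M" "\<And>i. i \<in> I \<Longrightarrow> u i \<in> L2 M"
  shows "L2_inner M w (\<lambda>x. \<Sum>i\<in>I. u i x) = (\<Sum>i\<in>I. L2_inner M w (u i))"
  using assms by (simp add: L2_inner_cnj[of M w] L2_inner_sum_left)

lemma L2_inner_cong_AE:
  assumes "u \<in> L2 M" "v \<in> L2 M" "w \<in> L2 M" "AE x in M. u x = v x"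
  shows "L2_inner M u w = L2_inner M v w"
  unfolding L2_inner_def
proof (rule integral_cong_AE)
  show "(\<lambda>x. u x * cnj (w x)) \<in> borel_measurable M" "(\<lambda>x. v x * cnj (w x)) \<in> borel_measurable M"
    using assms(1-3) by measurable
qed (use assms(4) in auto)

lemma L2_inner_self: "L2_inner M u u = complex_of_real (L2_sqnorm M u)"
proof -
  have "L2_inner M u u = (\<integral>x. complex_of_real ((cmod (u x))\<^sup>2) \<partial>M)"
    by (simp only: L2_inner_def complex_norm_square)
  also have "\<dots> = complex_of_real (\<integral>x. (cmod (u x))\<^sup>2 \<partial>M)"
    by (rule integral_complex_of_real)
  finally show ?thesis by (simp only: L2_sqnorm_def)
qed

lemma L2_sqnorm_nonneg [simp]: "0 \<le> L2_sqnorm M u"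
  by (simp add: L2_sqnorm_def)

lemma L2_sqnorm_zero [simp]: "L2_sqnorm M (\<lambda>x. 0) = 0"
  by (simp add: L2_sqnorm_def)

lemma L2_sqnorm_eq_0_iff:
  assumes "u \<in> L2 M"
  shows "L2_sqnorm M u = 0 \<longleftrightarrow> (AE x in M. u x = 0)"
  unfolding L2_sqnorm_def
  using assms by (subst integral_nonneg_eq_0_iff_AE) (auto simp: L2_integrable_sq)

lemma L2_sqnorm_scale: "L2_sqnorm M (\<lambda>x. c * u x) = (cmod c)\<^sup>2 * L2_sqnorm M u"
  by (simp add: L2_sqnorm_def norm_mult power_mult_distrib)

lemma L2_sqnorm_diff:
  assumes "u \<in> L2 M" "v \<in> L2 M"
  shows "L2_sqnorm M (\<lambda>x. u x - v x)
    = L2_sqnorm M u - 2 * Re (L2_inner M u v) + L2_sqnorm M v"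
proof -
  have "complex_of_real (L2_sqnorm M (\<lambda>x. u x - v x))
      = L2_inner M u u - L2_inner M u v - cnj (L2_inner M u v) + L2_inner M v v"
    using assms
    by (simp add: L2_inner_self[symmetric] L2_inner_diff_left L2_inner_diff_right L2_diff
        L2_inner_cnj[of M v u])
  from arg_cong[OF this, of Re] show ?thesis by (simp add: L2_inner_self)
qed

text \<open>A triangle inequality without square roots; the factors 2 do no harm where a quantity is only
  shown to tend to 0.\<close>

lemma L2_sqnorm_diff_triangle:
  assumes "u \<in> L2 M" "v \<in> L2 M" "w \<in> L2 M"
  shows "L2_sqnorm M (\<lambda>x. u x - w x)
    \<le> 2 * L2_sqnorm M (\<lambda>x. u x - v x) + 2 * L2_sqnorm M (\<lambda>x. v x - w x)"
proof -
  have "(cmod (u x - w x))\<^sup>2 \<le> 2 * (cmod (u x - v x))\<^sup>2 + 2 * (cmod (v x - w x))\<^sup>2" for x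
  proof -
    have "cmod (u x - w x) \<le> cmod (u x - v x) + cmod (v x - w x)"
      using norm_triangle_ineq[of "u x - v x" "v x - w x"] by simp
    then have "(cmod (u x - w x))\<^sup>2 \<le> (cmod (u x - v x) + cmod (v x - w x))\<^sup>2"
      by (intro power_mono) auto
    also have "\<dots> \<le> 2 * (cmod (u x - v x))\<^sup>2 + 2 * (cmod (v x - w x))\<^sup>2"
      using sum_squares_bound[of "cmod (u x - v x)" "cmod (v x - w x)"]
      by (simp add: power2_sum)
    finally show ?thesis .
  qed
  then have "L2_sqnorm M (\<lambda>x. u x - w x)
      \<le> (\<integral>x. 2 * (cmod (u x - v x))\<^sup>2 + 2 * (cmod (v x - w x))\<^sup>2 \<partial>M)"
    unfolding L2_sqnorm_def
    using assms by (intro integral_mono) (auto intro!: L2_integrable_sq L2_diff)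
  also have "\<dots> = 2 * L2_sqnorm M (\<lambda>x. u x - v x) + 2 * L2_sqnorm M (\<lambda>x. v x - w x)"
    unfolding L2_sqnorm_def using assms
    by (subst Bochner_Integration.integral_add) (auto intro!: L2_integrable_sq L2_diff)
  finally show ?thesis .
qed

text \<open>The Cauchy--Schwarz inequality in the form in which it is used for several Hermitian forms:
  only the nonnegativity of the form on the combinations \<open>u + c v\<close> enters.\<close>

lemma cauchy_schwarz_of_nonneg:
  fixes a d :: real and b :: complex
  assumes nonneg: "\<And>c :: complex. 0 \<le> a + 2 * Re (c * b) + (cmod c)\<^sup>2 * d" and "0 \<le> d"
  shows "(cmod b)\<^sup>2 \<le> a * d"
proof -
  have eq: "cnj b * b = complex_of_real ((cmod b)\<^sup>2)"
    by (simp only: complex_norm_square mult.commute)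
  show ?thesis
  proof (cases "d = 0")
    case True
    \<comment> \<open>Here \<open>b\<close> must vanish: otherwise a large negative multiple of \<open>cnj b\<close> gives a negative value.\<close>
    have "b = 0"
    proof (rule ccontr)
      assume "b \<noteq> 0"
      then have pos: "0 < (cmod b)\<^sup>2" by simp
      define t where "t = (\<bar>a\<bar> + 1) / (cmod b)\<^sup>2"
      have "Re (- complex_of_real t * cnj b * b) = - t * (cmod b)\<^sup>2"
        by (simp only: mult.assoc eq) simp
      then have "0 \<le> a - 2 * (t * (cmod b)\<^sup>2)"
        using nonneg[of "- complex_of_real t * cnj b"] True by simp
      moreover have "t * (cmod b)\<^sup>2 = \<bar>a\<bar> + 1"
        unfolding t_def using pos by (subst times_divide_eq_left) simp
      ultimately show False by linarith
    qed
    then show ?thesis using True by simp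
  next
    case False
    with \<open>0 \<le> d\<close> have d: "0 < d" by simp
    have "0 \<le> a + 2 * Re (- complex_of_real (1 / d) * cnj b * b)
        + (cmod (- complex_of_real (1 / d) * cnj b))\<^sup>2 * d"
      by (rule nonneg)
    also have "Re (- complex_of_real (1 / d) * cnj b * b) = - (1 / d) * (cmod b)\<^sup>2"
      by (simp only: mult.assoc eq) simp
    also have "(cmod (- complex_of_real (1 / d) * cnj b))\<^sup>2 = (1 / d)\<^sup>2 * (cmod b)\<^sup>2"
      using d by (simp add: norm_mult power_mult_distrib norm_divide power_divide)
    finally have "0 \<le> a - (cmod b)\<^sup>2 / d"
      using d by (simp add: power2_eq_square field_simps)
    then show ?thesis using d by (simp add: field_simps)
  qed
qed

lemma L2_cauchy_schwarz:
  assumes "u \<in> L2 M" "v \<in> L2 M"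
  shows "(cmod (L2_inner M u v))\<^sup>2 \<le> L2_sqnorm M u * L2_sqnorm M v"
proof (rule cauchy_schwarz_of_nonneg)
  fix c :: complex
  have "L2_sqnorm M (\<lambda>x. u x - (- cnj c) * v x)
      = L2_sqnorm M u + 2 * Re (c * L2_inner M u v) + (cmod c)\<^sup>2 * L2_sqnorm M v"
    by (simp only: L2_sqnorm_diff[OF assms(1) L2_scale[OF assms(2)]] L2_inner_scale_right
        L2_sqnorm_scale) simp
  then show "0 \<le> L2_sqnorm M u + 2 * Re (c * L2_inner M u v) + (cmod c)\<^sup>2 * L2_sqnorm M v"
    by (metis L2_sqnorm_nonneg)
qed simp

text \<open>The functions have a common square norm \<open>b\<close> instead of being normalised, because the plane
  waves on a cube have the volume of the cube as their square norm.\<close>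

lemma L2_bessel:
  assumes fin: "finite I" and u: "\<And>i. i \<in> I \<Longrightarrow> u i \<in> L2 M"
    and orth: "\<And>i j. i \<in> I \<Longrightarrow> j \<in> I \<Longrightarrow> i \<noteq> j \<Longrightarrow> L2_inner M (u i) (u j) = 0"
    and sq: "\<And>i. i \<in> I \<Longrightarrow> L2_sqnorm M (u i) = b" and b: "0 < b" and h: "h \<in> L2 M"
  shows "(\<Sum>i\<in>I. (cmod (L2_inner M h (u i)))\<^sup>2) \<le> b * L2_sqnorm M h"
proof -
  define p where "p = (\<lambda>x. \<Sum>i\<in>I. L2_inner M h (u i) / complex_of_real b * u i x)"
  define S where "S = (\<Sum>i\<in>I. (cmod (L2_inner M h (u i)))\<^sup>2)"
  have p: "p \<in> L2 M" unfolding p_def using u by (intro L2_sum L2_scale)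
  have ui: "L2_inner M (u i) p = cnj (L2_inner M h (u i))" if i: "i \<in> I" for i
  proof -
    have "L2_inner M (u i) p
        = (\<Sum>j\<in>I. cnj (L2_inner M h (u j) / complex_of_real b) * L2_inner M (u i) (u j))"
      unfolding p_def using u i
      by (simp only: L2_inner_sum_right[OF u[OF i] L2_scale[OF u]] L2_inner_scale_right)
    also have "\<dots> = (\<Sum>j\<in>I. if j = i then cnj (L2_inner M h (u i)) else 0)"
      using i orth sq b by (intro sum.cong) (auto simp: L2_inner_self)
    finally show ?thesis using fin i by simp
  qed
  have hp: "L2_inner M h p = complex_of_real (S / b)"
  proof -
    have "L2_inner M h p = (\<Sum>j\<in>I. cnj (L2_inner M h (u j) / complex_of_real b) * L2_inner M h (u j))"
      unfolding p_def by (simp only: L2_inner_sum_right[OF h L2_scale[OF u]] L2_inner_scale_right)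
    also have "\<dots> = complex_of_real (S / b)"
      by (simp add: S_def sum_divide_distrib complex_norm_square mult.commute del: of_real_power)
    finally show ?thesis .
  qed
  have "L2_inner M p p = (\<Sum>j\<in>I. L2_inner M h (u j) / complex_of_real b * L2_inner M (u j) p)"
    by (subst (1) p_def) (simp only: L2_inner_sum_left[OF p L2_scale[OF u]] L2_inner_scale_left)
  also have "\<dots> = complex_of_real (S / b)"
    using ui by (simp add: S_def sum_divide_distrib complex_norm_square del: of_real_power)
  finally have pp: "L2_sqnorm M p = S / b"
    by (simp only: L2_inner_self of_real_eq_iff)
  have "0 \<le> L2_sqnorm M (\<lambda>x. h x - p x)" by simp
  also have "\<dots> = L2_sqnorm M h - S / b"
    using L2_sqnorm_diff[OF h p] by (simp add: hp pp)
  finally show ?thesis using b by (simp add: S_def field_simps)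
qed

lemma L2_inner_tendsto:
  assumes s: "\<And>n. s n \<in> L2 M" and u: "u \<in> L2 M" and v: "v \<in> L2 M"
    and conv: "L2_converges M s u"
  shows "(\<lambda>n. L2_inner M (s n) v) \<longlonglongrightarrow> L2_inner M u v"
proof -
  have "(\<lambda>n. (cmod (L2_inner M (\<lambda>x. s n x - u x) v))\<^sup>2) \<longlonglongrightarrow> 0"
  proof (rule tendsto_sandwich[OF _ _ tendsto_const])
    show "(\<lambda>n. L2_sqnorm M (\<lambda>x. s n x - u x) * L2_sqnorm M v) \<longlonglongrightarrow> 0"
      using tendsto_mult_left_zero conv unfolding L2_converges_def by blast
    show "\<forall>\<^sub>F n in sequentially. (cmod (L2_inner M (\<lambda>x. s n x - u x) v))\<^sup>2
        \<le> L2_sqnorm M (\<lambda>x. s n x - u x) * L2_sqnorm M v"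
      using s u v by (intro always_eventually allI L2_cauchy_schwarz) auto
  qed auto
  then have "(\<lambda>n. L2_inner M (\<lambda>x. s n x - u x) v) \<longlonglongrightarrow> 0"
    using tendsto_real_sqrt tendsto_norm_zero_iff by fastforce
  then have "(\<lambda>n. L2_inner M (s n) v - L2_inner M u v) \<longlonglongrightarrow> 0"
    using s u v by (simp add: L2_inner_diff_left)
  then show ?thesis by (simp add: LIM_zero_cancel)
qed

section \<open>Orthonormal families\<close>

lemma L2_lincomb: "(\<And>i. i \<in> I \<Longrightarrow> u i \<in> L2 M) \<Longrightarrow> (\<lambda>x. \<Sum>i\<in>I. c i * u i x) \<in> L2 M"
  by (intro L2_sum L2_scale)

lemma L2_inner_lincomb_left:
  assumes "v \<in> L2 M" "\<And>i. i \<in> I \<Longrightarrow> u i \<in> L2 M"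
  shows "L2_inner M (\<lambda>x. \<Sum>i\<in>I. c i * u i x) v = (\<Sum>i\<in>I. c i * L2_inner M (u i) v)"
  using L2_inner_sum_left[of v M I "\<lambda>i x. c i * u i x"] assms by (simp add: L2_scale L2_inner_scale_left)

definition L2_orthonormal :: "'a measure \<Rightarrow> 'i set \<Rightarrow> ('i \<Rightarrow> 'a \<Rightarrow> complex) \<Rightarrow> bool" where
  "L2_orthonormal M I e \<longleftrightarrow> (\<forall>i\<in>I. e i \<in> L2 M) \<and>
     (\<forall>i\<in>I. \<forall>j\<in>I. L2_inner M (e i) (e j) = (if i = j then 1 else 0))"

lemma L2_orthonormal_inner_sum:
  assumes e: "L2_orthonormal M I e" and "finite I" and i: "i \<in> I"
  shows "L2_inner M (\<lambda>x. \<Sum>j\<in>I. c j * e j x) (e i) = c i"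
proof -
  have "L2_inner M (\<lambda>x. \<Sum>j\<in>I. c j * e j x) (e i) = (\<Sum>j\<in>I. c j * L2_inner M (e j) (e i))"
    using e i by (intro L2_inner_lincomb_left) (auto simp: L2_orthonormal_def)
  also have "\<dots> = (\<Sum>j\<in>I. if j = i then c j else 0)"
    using e i by (intro sum.cong) (auto simp: L2_orthonormal_def)
  finally show ?thesis using assms by simp
qed

lemma L2_orthonormal_extend:
  assumes e: "L2_orthonormal M {..<m} e" and w: "w \<in> L2 M"
    and orth: "\<And>i. i < m \<Longrightarrow> L2_inner M w (e i) = 0" and pos: "0 < L2_sqnorm M w"
  shows "L2_orthonormal M {..<Suc m}
    (e(m := \<lambda>x. complex_of_real (1 / sqrt (L2_sqnorm M w)) * w x))"
proof -
  define s where "s = complex_of_real (1 / sqrt (L2_sqnorm M w))"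
  have "(cmod s)\<^sup>2 * L2_sqnorm M w = 1"
    using pos by (simp add: s_def norm_divide power_divide)
  then have new: "L2_inner M (\<lambda>x. s * w x) (\<lambda>x. s * w x) = 1"
    by (simp add: L2_inner_self L2_sqnorm_scale del: of_real_mult)
  have cross: "L2_inner M (\<lambda>x. s * w x) (e i) = 0" "L2_inner M (e i) (\<lambda>x. s * w x) = 0"
    if "i < m" for i
    using orth[OF that] by (simp_all add: L2_inner_scale_left L2_inner_scale_right
        L2_inner_cnj[of M "e i" w])
  have "L2_orthonormal M {..<Suc m} (e(m := \<lambda>x. s * w x))"
    using e new cross w unfolding L2_orthonormal_def by (auto simp: less_Suc_eq L2_scale)
  then show ?thesis by (simp only: s_def)
qed

lemma L2_orthonormal_imp_independent:
  assumes "L2_orthonormal M {..<m} e"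
  shows "L2_independent M m e"
  unfolding L2_independent_def
proof (intro allI impI)
  fix c i assume 0: "AE x in M. (\<Sum>i<m. c i * e i x) = 0" and i: "i < m"
  have L2: "(\<lambda>x. \<Sum>i<m. c i * e i x) \<in> L2 M" "e i \<in> L2 M"
    using assms i by (auto simp: L2_orthonormal_def intro!: L2_lincomb)
  have "c i = L2_inner M (\<lambda>x. \<Sum>i<m. c i * e i x) (e i)"
    using L2_orthonormal_inner_sum[OF assms] i by simp
  also have "\<dots> = L2_inner M (\<lambda>x. 0) (e i)"
    using L2 0 by (intro L2_inner_cong_AE) auto
  finally show "c i = 0" by simp
qed

text \<open>The new functions are linear combinations of the old ones at every point, not only almost
  everywhere, so they inherit every property that is stable under linear combinations.\<close>

lemma gram_schmidt:
  assumes "\<And>i. i < m \<Longrightarrow> v i \<in> L2 M" and "L2_independent M m v"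
  shows "\<exists>e. L2_orthonormal M {..<m} e \<and> (\<forall>i<m. \<exists>c. e i = (\<lambda>x. \<Sum>l<m. c l * v l x))"
  using assms
proof (induction m)
  case 0
  then show ?case by (auto simp: L2_orthonormal_def)
next
  case (Suc m)
  have vL2: "v i \<in> L2 M" if "i < Suc m" for i using Suc.prems(1) that .
  have "L2_independent M m v"
    unfolding L2_independent_def
  proof (intro allI impI)
    fix c i assume "AE x in M. (\<Sum>i<m. c i * v i x) = 0" and i: "i < m"
    then have "AE x in M. (\<Sum>i<Suc m. (c(m := 0)) i * v i x) = 0" by simp
    then have "(c(m := 0)) i = 0"
      using Suc.prems(2) i unfolding L2_independent_def by (meson less_SucI)
    with i show "c i = 0" by simp
  qed
  then obtain e where e: "L2_orthonormal M {..<m} e"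
    and "\<forall>i<m. \<exists>c. e i = (\<lambda>x. \<Sum>l<m. c l * v l x)"
    using Suc.IH vL2 by force
  then obtain C where C: "\<And>i. i < m \<Longrightarrow> e i = (\<lambda>x. \<Sum>l<m. C i l * v l x)" by metis
  have eL2: "e i \<in> L2 M" if "i < m" for i using e that by (auto simp: L2_orthonormal_def)
  define a where "a = (\<lambda>i. L2_inner M (v m) (e i))"
  \<comment> \<open>The part of \<open>v m\<close> orthogonal to the functions found so far. Independence of \<open>v\<close> prevents it from
    vanishing, because \<open>v m\<close> enters it with coefficient 1.\<close>
  define w where "w = (\<lambda>x. v m x - (\<Sum>i<m. a i * e i x))"
  define b where "b = (\<lambda>l. if l = m then 1 else - (\<Sum>i<m. a i * C i l))"
  have w_comb: "w = (\<lambda>x. \<Sum>l<Suc m. b l * v l x)"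
  proof
    fix x
    have "(\<Sum>i<m. a i * e i x) = (\<Sum>i<m. \<Sum>l<m. a i * C i l * v l x)"
      using C by (simp add: sum_distrib_left mult.assoc)
    also have "\<dots> = (\<Sum>l<m. (\<Sum>i<m. a i * C i l) * v l x)"
      by (subst sum.swap) (simp add: sum_distrib_right)
    finally show "w x = (\<Sum>l<Suc m. b l * v l x)"
      by (simp add: w_def b_def sum_negf)
  qed
  have wL2: "w \<in> L2 M" unfolding w_comb using vL2 by (intro L2_sum L2_scale) auto
  have pL2: "(\<lambda>x. \<Sum>i<m. a i * e i x) \<in> L2 M" using eL2 by (intro L2_sum L2_scale) auto
  have w_orth: "L2_inner M w (e i) = 0" if "i < m" for i
    unfolding w_def using that vL2 pL2 eL2 L2_orthonormal_inner_sum[OF e, of i a]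
    by (subst L2_inner_diff_left) (auto simp: a_def)
  have w_pos: "0 < L2_sqnorm M w"
  proof (rule ccontr)
    assume "\<not> 0 < L2_sqnorm M w"
    then have "L2_sqnorm M w = 0" using L2_sqnorm_nonneg[of M w] by linarith
    then have "AE x in M. (\<Sum>l<Suc m. b l * v l x) = 0"
      using L2_sqnorm_eq_0_iff[OF wL2] by (simp add: w_comb)
    then have "b m = 0" using Suc.prems(2) unfolding L2_independent_def by blast
    then show False by (simp add: b_def)
  qed
  define s where "s = complex_of_real (1 / sqrt (L2_sqnorm M w))"
  define e' where "e' = e(m := (\<lambda>x. s * w x))"
  have "L2_orthonormal M {..<Suc m} e'"
    unfolding e'_def s_def using e wL2 w_orth w_pos by (rule L2_orthonormal_extend)
  moreover have "\<exists>c. e' i = (\<lambda>x. \<Sum>l<Suc m. c l * v l x)" if "i < Suc m" for i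
  proof (cases "i = m")
    case True
    have "e' i = (\<lambda>x. \<Sum>l<Suc m. (s * b l) * v l x)"
      by (simp only: True e'_def fun_upd_same w_comb sum_distrib_left mult.assoc)
    then show ?thesis by (rule exI[of _ "\<lambda>l. s * b l"])
  next
    case False
    with that C have "e' i = (\<lambda>x. \<Sum>l<Suc m. ((C i)(m := 0)) l * v l x)"
      by (simp add: e'_def)
    then show ?thesis by blast
  qed
  ultimately show ?case by blast
qed

section \<open>Compact symmetric resolvents\<close>

text \<open>The map \<open>T\<close> stands for \<open>(H + 1)\<^sup>-\<^sup>1\<close>, with some choice of representatives of its values. Its
  linearity, which holds up to null functions, is contained in the symmetry: pairing
  \<open>T (\<Sum>i. c\<^sub>i f\<^sub>i)\<close> with \<open>g\<close> is the same as pairing \<open>\<Sum>i. c\<^sub>i f\<^sub>i\<close> with \<open>T g\<close>. The third condition says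
  that \<open>H\<close> is nonnegative.\<close>

locale compact_resolvent_map =
  fixes M :: "'a measure" and T :: "('a \<Rightarrow> complex) \<Rightarrow> 'a \<Rightarrow> complex"
  assumes T_L2: "f \<in> L2 M \<Longrightarrow> T f \<in> L2 M"
    and T_symmetric: "f \<in> L2 M \<Longrightarrow> g \<in> L2 M \<Longrightarrow> L2_inner M (T f) g = L2_inner M f (T g)"
    and T_sqnorm_le: "f \<in> L2 M \<Longrightarrow> L2_sqnorm M (T f) \<le> Re (L2_inner M (T f) f)"
    and T_compact: "\<lbrakk>\<And>n :: nat. s n \<in> L2 M; \<And>n. L2_sqnorm M (s n) \<le> B\<rbrakk> \<Longrightarrow>
          \<exists>r w. strict_mono (r :: nat \<Rightarrow> nat) \<and> w \<in> L2 M \<and> L2_converges M (\<lambda>n. T (s (r n))) w"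
begin

text \<open>The weak form of \<open>(t + 1) T u = u\<close>, that is of \<open>H u = t u\<close>. Testing against all \<open>g\<close> makes the
  notion independent of the representatives chosen by \<open>T\<close>.\<close>

definition eigenvector :: "real \<Rightarrow> ('a \<Rightarrow> complex) \<Rightarrow> bool" where
  "eigenvector t u \<longleftrightarrow> u \<in> L2 M \<and>
     (\<forall>g\<in>L2 M. complex_of_real (t + 1) * L2_inner M u (T g) = L2_inner M u g)"

lemma eigenvector_L2: "eigenvector t u \<Longrightarrow> u \<in> L2 M"
  by (simp add: eigenvector_def)

lemma eigenvector_sum:
  assumes "\<And>i. i \<in> I \<Longrightarrow> eigenvector t (u i)"
  shows "eigenvector t (\<lambda>x. \<Sum>i\<in>I. c i * u i x)"
  unfolding eigenvector_def
proof (intro conjI ballI)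
  show "(\<lambda>x. \<Sum>i\<in>I. c i * u i x) \<in> L2 M"
    using assms by (intro L2_sum L2_scale) (simp add: eigenvector_def)
  fix g assume g: "g \<in> L2 M"
  have "complex_of_real (t + 1) * (c i * L2_inner M (u i) (T g)) = c i * L2_inner M (u i) g"
    if "i \<in> I" for i
    using assms[OF that] g by (simp add: eigenvector_def mult.left_commute)
  then show "complex_of_real (t + 1) * L2_inner M (\<lambda>x. \<Sum>i\<in>I. c i * u i x) (T g)
      = L2_inner M (\<lambda>x. \<Sum>i\<in>I. c i * u i x) g"
    using L2_inner_lincomb_left[OF g eigenvector_L2[OF assms], of I "\<lambda>i. i" c]
      L2_inner_lincomb_left[OF T_L2[OF g] eigenvector_L2[OF assms], of I "\<lambda>i. i" c]
      sum.cong[OF refl, of I "\<lambda>i. complex_of_real (t + 1) * (c i * L2_inner M (u i) (T g))"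
        "\<lambda>i. c i * L2_inner M (u i) g"]
    by (simp only: sum_distrib_left)
qed

lemma eigenvector_scale: "eigenvector t u \<Longrightarrow> eigenvector t (\<lambda>x. c * u x)"
  using eigenvector_sum[of "{()}" t "\<lambda>_. u" "\<lambda>_. c"] by simp

lemma eigenvectors_orthogonal:
  assumes u: "eigenvector s u" and v: "eigenvector t v" and "s \<noteq> t"
  shows "L2_inner M u v = 0"
proof -
  note L2 = eigenvector_L2[OF u] eigenvector_L2[OF v]
  have "complex_of_real (s + 1) * L2_inner M u (T v) = L2_inner M u v"
    using u L2 by (simp add: eigenvector_def)
  moreover have "complex_of_real (t + 1) * L2_inner M v (T u) = L2_inner M v u"
    using v L2 by (simp add: eigenvector_def)
  then have "complex_of_real (t + 1) * L2_inner M u (T v) = L2_inner M u v"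
    using T_symmetric[OF L2] L2_inner_cnj[of M v u] L2_inner_cnj[of M v "T u"]
    by (metis complex_cnj_complex_of_real complex_cnj_mult complex_cnj_cnj)
  ultimately have "complex_of_real (s + 1) * L2_inner M u (T v)
      = complex_of_real (t + 1) * L2_inner M u (T v)" by simp
  then have "complex_of_real (s - t) * L2_inner M u (T v) = 0"
    by (simp add: algebra_simps)
  then have "L2_inner M u (T v) = 0" using \<open>s \<noteq> t\<close> by simp
  with \<open>complex_of_real (s + 1) * L2_inner M u (T v) = L2_inner M u v\<close> show ?thesis by simp
qed

text \<open>A nonzero eigenvector orthogonal to \<open>m\<close> orthonormal ones would give \<open>m + 1\<close> independent
  eigenvectors.\<close>

lemma orthonormal_basis_of_eigenvectors:
  assumes v: "\<And>i. i < m \<Longrightarrow> eigenvector t (v i)" and indep: "L2_independent M m v"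
    and maximal: "\<And>v'. (\<And>i. i < Suc m \<Longrightarrow> eigenvector t (v' i)) \<Longrightarrow> \<not> L2_independent M (Suc m) v'"
  obtains e where "L2_orthonormal M {..<m} e" "\<And>i. i < m \<Longrightarrow> eigenvector t (e i)"
    "\<And>y. eigenvector t y \<Longrightarrow> (\<And>i. i < m \<Longrightarrow> L2_inner M y (e i) = 0) \<Longrightarrow> AE x in M. y x = 0"
proof -
  obtain e where e: "L2_orthonormal M {..<m} e"
    and comb: "\<And>i. i < m \<Longrightarrow> \<exists>c. e i = (\<lambda>x. \<Sum>l<m. c l * v l x)"
    using gram_schmidt[of m v M] v indep eigenvector_L2 by blast
  have eig: "eigenvector t (e i)" if i: "i < m" for i
  proof -
    obtain c where "e i = (\<lambda>x. \<Sum>l<m. c l * v l x)" using comb[OF i] by blast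
    then show ?thesis using eigenvector_sum[of "{..<m}" t v c] v by simp
  qed
  have "AE x in M. y x = 0"
    if y: "eigenvector t y" and orth: "\<And>i. i < m \<Longrightarrow> L2_inner M y (e i) = 0" for y
  proof (rule ccontr)
    assume "\<not> (AE x in M. y x = 0)"
    then have pos: "0 < L2_sqnorm M y"
      using L2_sqnorm_eq_0_iff[OF eigenvector_L2[OF y]] L2_sqnorm_nonneg[of M y]
      by linarith
    define s where "s = complex_of_real (1 / sqrt (L2_sqnorm M y))"
    have "L2_orthonormal M {..<Suc m} (e(m := \<lambda>x. s * y x))"
      unfolding s_def using e eigenvector_L2[OF y] orth pos by (rule L2_orthonormal_extend)
    from L2_orthonormal_imp_independent[OF this] show False
      using maximal[of "e(m := \<lambda>x. s * y x)"] eig eigenvector_scale[OF y]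
      by (auto simp: less_Suc_eq)
  qed
  with e eig show ?thesis using that by blast
qed

lemma T_cauchy_schwarz:
  assumes f: "f \<in> L2 M" and g: "g \<in> L2 M"
  shows "(cmod (L2_inner M (T f) g))\<^sup>2 \<le> Re (L2_inner M (T f) f) * Re (L2_inner M (T g) g)"
proof (rule cauchy_schwarz_of_nonneg)
  have pos: "0 \<le> Re (L2_inner M (T h) h)" if "h \<in> L2 M" for h
    using T_sqnorm_le[OF that] L2_sqnorm_nonneg order_trans by blast
  show "0 \<le> Re (L2_inner M (T g) g)" using pos g .
  fix c :: complex
  define h where "h = (\<lambda>x. f x + cnj c * g x)"
  have h: "h \<in> L2 M" unfolding h_def using f g by (intro L2_add L2_scale)
  have expand: "L2_inner M k h = L2_inner M k f + c * L2_inner M k g" if "k \<in> L2 M" for k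
    unfolding h_def using that f g
    by (subst L2_inner_add_right) (auto simp: L2_inner_scale_right L2_scale)
  have T_h: "L2_inner M (T h) k = L2_inner M (T f) k + cnj c * L2_inner M (T g) k"
    if "k \<in> L2 M" for k
    unfolding T_symmetric[OF h that] T_symmetric[OF f that] T_symmetric[OF g that]
    unfolding h_def using T_L2[OF that] f g
    by (subst L2_inner_add_left) (auto simp: L2_inner_scale_left L2_scale)
  have gf: "L2_inner M (T g) f = cnj (L2_inner M (T f) g)"
    using T_symmetric[OF g f] L2_inner_cnj[of M g "T f"] by simp
  have "L2_inner M (T h) h = L2_inner M (T f) f + c * L2_inner M (T f) g
      + cnj (c * L2_inner M (T f) g) + (c * cnj c) * L2_inner M (T g) g"
    using expand[OF T_L2[OF f]] expand[OF T_L2[OF g]] by (simp add: T_h[OF h] gf algebra_simps)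
  then have "Re (L2_inner M (T h) h) = Re (L2_inner M (T f) f) + 2 * Re (c * L2_inner M (T f) g)
      + (cmod c)\<^sup>2 * Re (L2_inner M (T g) g)"
    by (simp add: complex_norm_square[symmetric] del: of_real_power)
  with pos[OF h] show "0 \<le> Re (L2_inner M (T f) f) + 2 * Re (c * L2_inner M (T f) g)
      + (cmod c)\<^sup>2 * Re (L2_inner M (T g) g)" by simp
qed

lemma T_form_le: "f \<in> L2 M \<Longrightarrow> Re (L2_inner M (T f) f) \<le> L2_sqnorm M f"
  using L2_sqnorm_diff[OF T_L2, of f f] T_sqnorm_le[of f]
    L2_sqnorm_nonneg[of M "\<lambda>x. T f x - f x"] by linarith

lemma T_form_scale:
  assumes "f \<in> L2 M"
  shows "Re (L2_inner M (T (\<lambda>x. complex_of_real a * f x)) (\<lambda>x. complex_of_real a * f x))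
    = a\<^sup>2 * Re (L2_inner M (T f) f)"
  using T_symmetric[OF L2_scale[OF assms, of "complex_of_real a"] L2_scale[OF assms, of "complex_of_real a"]]
    T_symmetric[OF L2_scale[OF assms, of "complex_of_real a"] assms] T_symmetric[OF assms assms]
  by (simp add: L2_inner_scale_left L2_inner_scale_right power2_eq_square
      T_symmetric[OF assms L2_scale[OF assms], symmetric])

text \<open>The supremum \<open>S\<close> of \<open>\<langle>T w, w\<rangle>\<close> over the unit ball of the orthogonal complement of the \<open>u\<^sub>i\<close> is, if
  it is positive, an eigenvalue of \<open>T\<close> with an eigenvector in the complement, so \<open>1/S - 1\<close> is an
  eigenvalue of \<open>H\<close>. Compactness makes \<open>T w\<^sub>n\<close> converge along a subsequence of a
  maximising sequence; that the limit is an eigenvector follows from \<open>\<parallel>T w\<parallel>\<^sup>2 \<le> S \<langle>T w, w\<rangle>\<close>.\<close>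

lemma T_form_le_on_complement:
  assumes eig: "\<And>i. i \<in> I \<Longrightarrow> eigenvector (l i) (u i)" and l: "\<And>i. i \<in> I \<Longrightarrow> l i + 1 \<noteq> 0"
    and m: "0 < m"
    and bound: "\<And>t y. \<lbrakk>eigenvector t y; 0 < t + 1; \<And>i. i \<in> I \<Longrightarrow> L2_inner M y (u i) = 0;
                  \<not> (AE x in M. y x = 0)\<rbrakk> \<Longrightarrow> 1 / (t + 1) \<le> m"
    and w: "w \<in> L2 M" and w_orth: "\<And>i. i \<in> I \<Longrightarrow> L2_inner M w (u i) = 0"
  shows "Re (L2_inner M (T w) w) \<le> m * L2_sqnorm M w"
proof (rule ccontr)
  assume contr: "\<not> Re (L2_inner M (T w) w) \<le> m * L2_sqnorm M w"
  define Q where "Q = (\<lambda>f. Re (L2_inner M (T f) f))"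
  define W where "W = {f \<in> L2 M. \<forall>i\<in>I. L2_inner M f (u i) = 0}"
  define K where "K = Q ` {f \<in> W. L2_sqnorm M f \<le> 1}"
  define S where "S = Sup K"
  have W_scale: "(\<lambda>x. c * f x) \<in> W" if "f \<in> W" for f c
    using that by (auto simp: W_def L2_inner_scale_left L2_scale)
  have T_W: "T f \<in> W" if f: "f \<in> W" for f
  proof -
    have "L2_inner M (T f) (u i) = 0" if i: "i \<in> I" for i
    proof -
      have f2: "f \<in> L2 M" using f by (simp add: W_def)
      have "complex_of_real (l i + 1) * L2_inner M (u i) (T f) = L2_inner M (u i) f"
        using eig[OF i] f2 by (simp add: eigenvector_def)
      also have "\<dots> = cnj (L2_inner M f (u i))" by (rule L2_inner_cnj)
      also have "\<dots> = 0" using f i by (simp add: W_def)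
      finally have "L2_inner M (u i) (T f) = 0" using l[OF i] by (metis mult_eq_0_iff of_real_eq_0_iff)
      then show ?thesis using L2_inner_cnj[of M "T f" "u i"] by simp
    qed
    with f show ?thesis by (simp add: W_def T_L2)
  qed
  have Q_le: "Q f \<le> L2_sqnorm M f" if "f \<in> W" for f
    using that T_form_le by (simp add: Q_def W_def)
  have Q_nonneg: "0 \<le> Q f" if "f \<in> W" for f
  proof -
    have "f \<in> L2 M" using that by (simp add: W_def)
    from T_sqnorm_le[OF this] show ?thesis
      unfolding Q_def by (rule order_trans[OF L2_sqnorm_nonneg])
  qed
  have bdd: "bdd_above K"
    unfolding K_def by (rule bdd_aboveI[of _ 1]) (use Q_le in force)
  have Q_S: "Q f \<le> S * L2_sqnorm M f" if f: "f \<in> W" for f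
  proof (cases "L2_sqnorm M f = 0")
    case True
    then show ?thesis using Q_le[OF f] by simp
  next
    case False
    define N where "N = L2_sqnorm M f"
    have N: "0 < N" using False by (simp add: N_def order_less_le)
    define g where "g = (\<lambda>x. complex_of_real (1 / sqrt N) * f x)"
    have "L2_sqnorm M g = 1"
      unfolding g_def L2_sqnorm_scale using N by (simp add: N_def[symmetric] norm_divide power_divide)
    then have "Q g \<in> K" unfolding K_def using W_scale[OF f, of "complex_of_real (1 / sqrt N)"] by (intro imageI) (simp add: g_def)
    then have "Q g \<le> S" unfolding S_def using bdd by (rule cSup_upper)
    moreover have "Q g = Q f / N"
      unfolding Q_def g_def using f N by (subst T_form_scale) (auto simp: W_def power_divide)
    ultimately show ?thesis using N by (simp add: N_def[symmetric] field_simps)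
  qed
  have wW: "w \<in> W" using w w_orth by (simp add: W_def)
  have S_gt: "m < S"
  proof (rule ccontr)
    assume "\<not> m < S"
    then have "S * L2_sqnorm M w \<le> m * L2_sqnorm M w" by (intro mult_right_mono) auto
    with Q_S[OF wW] contr show False by (simp add: Q_def)
  qed
  have S: "0 < S" using m S_gt by simp
  \<comment> \<open>Cauchy--Schwarz for the form of \<open>T\<close>, applied to \<open>f\<close> and \<open>T f\<close>, with \<open>Q (T f) \<le> S \<parallel>T f\<parallel>\<^sup>2\<close>.\<close>
  have T_S: "L2_sqnorm M (T f) \<le> S * Q f" if f: "f \<in> W" for f
  proof (cases "L2_sqnorm M (T f) = 0")
    case True
    then show ?thesis using Q_nonneg[OF f] S by simp
  next
    case False
    then have pos: "0 < L2_sqnorm M (T f)" using L2_sqnorm_nonneg[of M "T f"] by linarith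
    have f2: "f \<in> L2 M" using f by (simp add: W_def)
    have "(L2_sqnorm M (T f))\<^sup>2 \<le> Q f * Q (T f)"
      using T_cauchy_schwarz[OF f2 T_L2[OF f2]] by (simp add: Q_def L2_inner_self)
    also have "\<dots> \<le> Q f * (S * L2_sqnorm M (T f))"
      using Q_S[OF T_W[OF f]] Q_nonneg[OF f] by (rule mult_left_mono)
    finally have "L2_sqnorm M (T f) * L2_sqnorm M (T f) \<le> (S * Q f) * L2_sqnorm M (T f)"
      by (simp add: power2_eq_square mult_ac)
    then show ?thesis using pos by simp
  qed
  have "\<exists>f. f \<in> W \<and> L2_sqnorm M f \<le> 1 \<and> S - 1 / real (Suc n) < Q f" for n
  proof -
    have "(\<lambda>x. 0) \<in> W" by (simp add: W_def)
    then have "K \<noteq> {}" unfolding K_def by (auto intro!: exI[of _ "\<lambda>x. 0"])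
    moreover have "S - 1 / real (Suc n) < Sup K" by (simp add: S_def)
    ultimately obtain z where "z \<in> K" "S - 1 / real (Suc n) < z"
      using less_cSup_iff[OF _ bdd] by blast
    then show ?thesis by (auto simp: K_def)
  qed
  then obtain f where fW: "\<And>n. f n \<in> W" and f1: "\<And>n. L2_sqnorm M (f n) \<le> 1"
    and fS: "\<And>n. S - 1 / real (Suc n) < Q (f n)" by metis
  have f2: "f n \<in> L2 M" for n using fW by (simp add: W_def)
  obtain r y where r: "strict_mono (r :: nat \<Rightarrow> nat)" and y: "y \<in> L2 M"
    and conv: "L2_converges M (\<lambda>n. T (f (r n))) y"
    using T_compact[of f 1] f2 f1 by blast
  \<comment> \<open>Along the maximising sequence \<open>T f\<^sub>n - S f\<^sub>n\<close> tends to 0, so the limit of \<open>T f\<^sub>n\<close> is an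
    eigenvector of \<open>T\<close> for the value \<open>S\<close>.\<close>
  have defect: "L2_sqnorm M (\<lambda>x. T (f n) x - complex_of_real S * f n x) \<le> S * (1 / real (Suc n))" for n
  proof -
    have "L2_sqnorm M (\<lambda>x. T (f n) x - complex_of_real S * f n x)
        = L2_sqnorm M (T (f n)) - 2 * S * Q (f n) + S\<^sup>2 * L2_sqnorm M (f n)"
      using L2_sqnorm_diff[OF T_L2[OF f2] L2_scale[OF f2]]
      by (simp add: L2_inner_scale_right L2_sqnorm_scale Q_def)
    also have "\<dots> \<le> S * Q (f n) - 2 * S * Q (f n) + S\<^sup>2 * 1"
      using T_S[OF fW, of n] mult_left_mono[OF f1 zero_le_power2[of S], of n] by linarith
    also have "\<dots> = S * (S - Q (f n))" by (simp add: power2_eq_square algebra_simps)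
    also have "\<dots> \<le> S * (1 / real (Suc n))"
      using fS[of n] S by (intro mult_left_mono) auto
    finally show ?thesis .
  qed
  have "(\<lambda>n. S * inverse (real (Suc n))) \<longlonglongrightarrow> S * 0"
    by (rule tendsto_mult[OF tendsto_const LIMSEQ_inverse_real_of_nat])
  then have "(\<lambda>n. S * (1 / real (Suc n))) \<longlonglongrightarrow> 0"
    by (simp only: inverse_eq_divide mult_zero_right)
  then have "(\<lambda>n. L2_sqnorm M (\<lambda>x. T (f n) x - complex_of_real S * f n x)) \<longlonglongrightarrow> 0"
    by (rule Lim_null_comparison[rotated]) (use defect in \<open>simp add: always_eventually\<close>)
  from LIMSEQ_subseq_LIMSEQ[OF this r]
  have "L2_converges M (\<lambda>n x. T (f (r n)) x - complex_of_real S * f (r n) x) (\<lambda>x. 0)"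
    by (simp add: L2_converges_def o_def)
  from L2_inner_tendsto[OF _ _ _ this] T_L2 f2
  have defect_inner: "(\<lambda>n. L2_inner M (T (f (r n))) g - complex_of_real S * L2_inner M (f (r n)) g) \<longlonglongrightarrow> 0"
    if "g \<in> L2 M" for g
    using that by (force simp: L2_inner_diff_left L2_scale L2_inner_scale_left L2_diff)
  have Ty: "(\<lambda>n. L2_inner M (T (f (r n))) g) \<longlonglongrightarrow> L2_inner M y g" if "g \<in> L2 M" for g
    using T_L2[OF f2] y that conv by (rule L2_inner_tendsto)
  have y_eig: "eigenvector (1 / S - 1) y"
    unfolding eigenvector_def
  proof (intro conjI ballI y)
    fix g assume g: "g \<in> L2 M"
    have "(\<lambda>n. complex_of_real S * L2_inner M (T (f (r n))) g
        + (L2_inner M (T (f (r n))) (T g) - complex_of_real S * L2_inner M (f (r n)) (T g)))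
      \<longlonglongrightarrow> complex_of_real S * L2_inner M y g + 0"
      by (intro tendsto_add tendsto_mult tendsto_const Ty g defect_inner T_L2)
    moreover have "complex_of_real S * L2_inner M (T (f (r n))) g
        + (L2_inner M (T (f (r n))) (T g) - complex_of_real S * L2_inner M (f (r n)) (T g))
      = L2_inner M (T (f (r n))) (T g)" for n
      using T_symmetric[OF f2 g] by simp
    ultimately have "L2_inner M y (T g) = complex_of_real S * L2_inner M y g"
      using LIMSEQ_unique[OF Ty[OF T_L2[OF g]]] by simp
    then show "complex_of_real (1 / S - 1 + 1) * L2_inner M y (T g) = L2_inner M y g"
      using S by simp
  qed
  have y_orth: "L2_inner M y (u i) = 0" if i: "i \<in> I" for i
    using LIMSEQ_unique[OF Ty[OF eigenvector_L2[OF eig[OF i]]]] T_W[OF fW] i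
    by (simp add: W_def)
  \<comment> \<open>If the limit vanished, then \<open>T f\<^sub>n\<close> and hence \<open>Q f\<^sub>n\<close> would tend to 0 along the subsequence, but
    \<open>Q f\<^sub>n\<close> tends to \<open>S > 0\<close>.\<close>
  have "\<not> (AE x in M. y x = 0)"
  proof
    assume "AE x in M. y x = 0"
    then have y0: "L2_sqnorm M y = 0" using L2_sqnorm_eq_0_iff[OF y] by simp
    have Tto0: "(\<lambda>n. 2 * L2_sqnorm M (\<lambda>x. T (f (r n)) x - y x) + 0) \<longlonglongrightarrow> 2 * 0 + 0"
      using conv unfolding L2_converges_def by (intro tendsto_intros)
    have Q_bound: "(Q (f (r n)))\<^sup>2 \<le> 2 * L2_sqnorm M (\<lambda>x. T (f (r n)) x - y x) + 0" for n
    proof -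
      have "(Q (f (r n)))\<^sup>2 \<le> (cmod (L2_inner M (T (f (r n))) (f (r n))))\<^sup>2"
        unfolding Q_def by (metis abs_Re_le_cmod abs_le_square_iff abs_norm_cancel)
      also have "\<dots> \<le> L2_sqnorm M (T (f (r n))) * L2_sqnorm M (f (r n))"
        by (intro L2_cauchy_schwarz T_L2 f2)
      also have "\<dots> \<le> L2_sqnorm M (T (f (r n))) * 1"
        using f1 by (intro mult_left_mono) auto
      also have "\<dots> \<le> 2 * L2_sqnorm M (\<lambda>x. T (f (r n)) x - y x) + 2 * L2_sqnorm M y"
        using L2_sqnorm_diff_triangle[OF T_L2[OF f2] y L2_zero] by simp
      finally show ?thesis using y0 by simp
    qed
    have Q_lower: "S - 1 / real (Suc (r n)) \<le> Q (f (r n))" for n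
      by (rule less_imp_le[OF fS])
    have S_lim: "(\<lambda>n. S - 1 / real (Suc (r n))) \<longlonglongrightarrow> S - 0"
      using LIMSEQ_subseq_LIMSEQ[OF LIMSEQ_inverse_real_of_nat r]
      by (intro tendsto_diff tendsto_const) (simp add: o_def inverse_eq_divide)
    have Q_lim: "(\<lambda>n. Q (f (r n))) \<longlonglongrightarrow> 0"
    proof -
      have "(\<lambda>n. (Q (f (r n)))\<^sup>2) \<longlonglongrightarrow> 0"
      proof (rule Lim_null_comparison)
        show "\<forall>\<^sub>F n in sequentially. norm ((Q (f (r n)))\<^sup>2)
            \<le> 2 * L2_sqnorm M (\<lambda>x. T (f (r n)) x - y x) + 0"
          using Q_bound by (simp add: always_eventually)
        show "(\<lambda>n. 2 * L2_sqnorm M (\<lambda>x. T (f (r n)) x - y x) + 0) \<longlonglongrightarrow> 0"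
          using Tto0 by simp
      qed
      then have "(\<lambda>n. sqrt ((Q (f (r n)))\<^sup>2)) \<longlonglongrightarrow> sqrt 0" by (rule tendsto_real_sqrt)
      then show ?thesis using Q_nonneg[OF fW] by simp
    qed
    have "S - 0 \<le> 0" using LIMSEQ_le[OF S_lim Q_lim] Q_lower by blast
    with S show False by simp
  qed
  with bound[OF y_eig _ y_orth] S have "S \<le> m" by auto
  with S_gt show False by simp
qed

text \<open>Let \<open>p = \<Sum>i. c\<^sub>i u\<^sub>i\<close> be the projection of \<open>h\<close> and \<open>w = h - p\<close>. The hypothesis on \<open>q\<close> is applied to the
  single function \<open>f = \<Sum>i. (l\<^sub>i + 1) c\<^sub>i u\<^sub>i + (L + 1) w\<close>, which would be \<open>(H + 1) h\<close> if \<open>w\<close> were an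
  eigenvector for \<open>L\<close>. Since \<open>T f = p + (L + 1) T w\<close>, everything is then explicit except \<open>\<langle>T w, w\<rangle>\<close>,
  which is at most \<open>\<parallel>w\<parallel>\<^sup>2 / (L + 1)\<close> by the previous lemma.\<close>

lemma eigenvalue_sum_bound:
  assumes fin: "finite I" and e: "L2_orthonormal M I u"
    and eig: "\<And>i. i \<in> I \<Longrightarrow> eigenvector (l i) (u i)" and l: "\<And>i. i \<in> I \<Longrightarrow> l i + 1 \<noteq> 0"
    and L: "0 < L + 1"
    and bound: "\<And>t y. \<lbrakk>eigenvector t y; 0 < t + 1; \<And>i. i \<in> I \<Longrightarrow> L2_inner M y (u i) = 0;
                  \<not> (AE x in M. y x = 0)\<rbrakk> \<Longrightarrow> L \<le> t"
    and h: "h \<in> L2 M"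
    and q: "\<And>f. f \<in> L2 M \<Longrightarrow> 2 * Re (L2_inner M f h) - Re (L2_inner M (T f) f) \<le> q + L2_sqnorm M h"
  shows "(\<Sum>i\<in>I. l i * (cmod (L2_inner M h (u i)))\<^sup>2)
    + L * (L2_sqnorm M h - (\<Sum>i\<in>I. (cmod (L2_inner M h (u i)))\<^sup>2)) \<le> q"
proof -
  define c where "c = (\<lambda>i. L2_inner M h (u i))"
  define a where "a = (\<lambda>x. \<Sum>i\<in>I. complex_of_real (l i + 1) * c i * u i x)"
  define p where "p = (\<lambda>x. \<Sum>i\<in>I. c i * u i x)"
  define w where "w = (\<lambda>x. h x - p x)"
  define f where "f = (\<lambda>x. a x + complex_of_real (L + 1) * w x)"
  define A where "A = (\<Sum>i\<in>I. (l i + 1) * (cmod (c i))\<^sup>2)"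
  define B where "B = (\<Sum>i\<in>I. (cmod (c i))\<^sup>2)"
  have u: "u i \<in> L2 M" if "i \<in> I" for i using e that by (simp add: L2_orthonormal_def)
  have a: "a \<in> L2 M" and p: "p \<in> L2 M" unfolding a_def p_def using u by (auto intro!: L2_sum L2_scale)
  have w: "w \<in> L2 M" unfolding w_def using h p by blast
  have f: "f \<in> L2 M" unfolding f_def using a w by (intro L2_add L2_scale)
  have p_u: "L2_inner M p (u i) = c i" if "i \<in> I" for i
    unfolding p_def by (rule L2_orthonormal_inner_sum[OF e fin that])
  have w_u: "L2_inner M w (u i) = 0" if "i \<in> I" for i
    unfolding w_def using h p u[OF that] p_u[OF that] by (simp add: L2_inner_diff_left c_def)
  have w_comb: "L2_inner M w (\<lambda>x. \<Sum>i\<in>I. b i * u i x) = 0" for b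
    using L2_inner_sum_right[OF w, of I "\<lambda>i x. b i * u i x"] u w_u
    by (simp add: L2_scale L2_inner_scale_right)
  have wp: "L2_inner M w p = 0" unfolding p_def by (rule w_comb)
  have pw: "L2_inner M p w = 0" using L2_inner_cnj[of M p w] wp by simp
  have aw: "L2_inner M a w = 0" using L2_inner_cnj[of M a w] w_comb by (simp add: a_def)
  have inner_comb: "L2_inner M (\<lambda>x. \<Sum>i\<in>I. b i * u i x) v = (\<Sum>i\<in>I. b i * L2_inner M (u i) v)"
    if "v \<in> L2 M" for b v
    using L2_inner_sum_left[OF that, of I "\<lambda>i x. b i * u i x"] u
    by (simp add: L2_scale L2_inner_scale_left)
  have u_h: "L2_inner M (u i) h = cnj (c i)" for i unfolding c_def by (rule L2_inner_cnj)
  have ah: "L2_inner M a h = complex_of_real A"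
    unfolding a_def inner_comb[OF h] A_def u_h
    by (simp add: mult.assoc complex_norm_square[symmetric] del: of_real_add of_real_power)
  have ph: "L2_inner M p h = complex_of_real B"
    unfolding p_def inner_comb[OF h] B_def u_h by (simp add: complex_norm_square del: of_real_power)
  have ap: "L2_inner M a p = complex_of_real A"
  proof -
    have "L2_inner M a h = L2_inner M a (\<lambda>x. w x + p x)" by (simp add: w_def)
    also have "\<dots> = L2_inner M a p" using a w p by (simp add: L2_inner_add_right aw)
    finally show ?thesis using ah by simp
  qed
  have pa: "L2_inner M p a = complex_of_real A" using L2_inner_cnj[of M p a] ap by simp
  have Ta: "L2_inner M a (T g) = L2_inner M p g" if g: "g \<in> L2 M" for g
  proof -
    have "L2_inner M a (T g) = (\<Sum>i\<in>I. complex_of_real (l i + 1) * c i * L2_inner M (u i) (T g))"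
      unfolding a_def by (rule inner_comb[OF T_L2[OF g]])
    also have "\<dots> = (\<Sum>i\<in>I. c i * L2_inner M (u i) g)"
    proof (rule sum.cong)
      fix i assume "i \<in> I"
      then have "complex_of_real (l i + 1) * L2_inner M (u i) (T g) = L2_inner M (u i) g"
        using eig g by (simp add: eigenvector_def)
      then show "complex_of_real (l i + 1) * c i * L2_inner M (u i) (T g) = c i * L2_inner M (u i) g"
        by (metis mult.assoc mult.left_commute)
    qed simp
    finally show ?thesis by (simp add: p_def inner_comb[OF g])
  qed
  have wh: "L2_inner M w h = complex_of_real (L2_sqnorm M h - B)"
    unfolding w_def using h p by (simp add: L2_inner_diff_left L2_inner_self ph)
  have ww: "L2_sqnorm M w = L2_sqnorm M h - B"
  proof -
    have "L2_inner M w h = L2_inner M w (\<lambda>x. w x + p x)" by (simp add: w_def)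
    also have "\<dots> = L2_inner M w w" using w p by (simp add: L2_inner_add_right wp)
    finally show ?thesis unfolding wh L2_inner_self of_real_eq_iff by simp
  qed
  have fh: "Re (L2_inner M f h) = A + (L + 1) * (L2_sqnorm M h - B)"
    unfolding f_def using a w h
    by (subst L2_inner_add_left) (auto simp: L2_scale L2_inner_scale_left ah wh)
  have Tw_a: "L2_inner M w (T a) = 0"
    using T_symmetric[OF w a] L2_inner_cnj[of M "T w" a] Ta[OF w] pw by simp
  have f_g: "L2_inner M f g = L2_inner M a g + complex_of_real (L + 1) * L2_inner M w g"
    if "g \<in> L2 M" for g
    unfolding f_def using a w that by (subst L2_inner_add_left) (auto simp: L2_scale L2_inner_scale_left)
  have g_f: "L2_inner M g f = L2_inner M g a + complex_of_real (L + 1) * L2_inner M g w"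
    if "g \<in> L2 M" for g
    unfolding f_def using a w that by (subst L2_inner_add_right) (auto simp: L2_scale L2_inner_scale_right)
  have "L2_inner M (T f) f = L2_inner M p f + complex_of_real (L + 1) * L2_inner M w (T f)"
    using T_symmetric[OF f f] f_g[OF T_L2[OF f]] Ta[OF f] by simp
  also have "L2_inner M p f = complex_of_real A"
    using g_f[OF p] pa pw by simp
  also have "L2_inner M w (T f) = complex_of_real (L + 1) * L2_inner M (T w) w"
    using T_symmetric[OF w f] g_f[OF T_L2[OF w]] T_symmetric[OF w a] Tw_a by simp
  finally have Tff: "Re (L2_inner M (T f) f) = A + (L + 1) * ((L + 1) * Re (L2_inner M (T w) w))"
    by simp
  have "Re (L2_inner M (T w) w) \<le> 1 / (L + 1) * L2_sqnorm M w"
  proof (rule T_form_le_on_complement[OF eig l _ _ w w_u])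
    fix t y assume "eigenvector t y" and t: "0 < t + 1"
      and "\<And>i. i \<in> I \<Longrightarrow> L2_inner M y (u i) = 0" and "\<not> (AE x in M. y x = 0)"
    then have "L \<le> t" using bound by blast
    then show "1 / (t + 1) \<le> 1 / (L + 1)" using L by (intro divide_left_mono) auto
  qed (use L in auto)
  then have "(L + 1) * ((L + 1) * Re (L2_inner M (T w) w)) \<le> (L + 1) * L2_sqnorm M w"
    using L by (intro mult_left_mono) (auto simp: field_simps)
  then have Y: "(L + 1) * ((L + 1) * Re (L2_inner M (T w) w)) \<le> (L + 1) * (L2_sqnorm M h - B)"
    unfolding ww .
  have Z: "2 * (A + (L + 1) * (L2_sqnorm M h - B))
      - (A + (L + 1) * ((L + 1) * Re (L2_inner M (T w) w))) \<le> q + L2_sqnorm M h"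
    using q[OF f] unfolding fh Tff .
  have arith: "A + X \<le> z" if "Y \<le> X" and "2 * (A + X) - (A + Y) \<le> z" for X Y z :: real
  proof -
    have "A + X \<le> 2 * (A + X) - (A + Y)" using that(1) by simp
    from order_trans[OF this that(2)] show ?thesis .
  qed
  from arith[OF Y Z] have "A + (L + 1) * (L2_sqnorm M h - B) \<le> q + L2_sqnorm M h" .
  moreover have "A = (\<Sum>i\<in>I. l i * (cmod (c i))\<^sup>2) + B"
    by (simp add: A_def B_def sum.distrib[symmetric] algebra_simps)
  ultimately have "(\<Sum>i\<in>I. l i * (cmod (c i))\<^sup>2) + L * (L2_sqnorm M h - B) \<le> q"
    by (simp add: algebra_simps)
  then show ?thesis by (simp only: c_def B_def)
qed

end

section \<open>Operators of nonnegative forms\<close>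

text \<open>For elements \<open>u\<close> and \<open>v\<close> of the domain, nonnegativity is demanded of the expanded value of the form at
  \<open>u - v\<close>. In this shape the condition makes sense for a set \<open>D\<close> that is not known to be closed under
  subtraction.\<close>

locale nonneg_form_compact_resolvent =
  fixes M :: "'a measure" and D :: "('a \<Rightarrow> complex) set"
    and q :: "('a \<Rightarrow> complex) \<Rightarrow> ('a \<Rightarrow> complex) \<Rightarrow> complex"
  assumes D_L2: "D \<subseteq> L2 M"
    and hermitian: "q v u = cnj (q u v)"
    and q_diff_nonneg: "u \<in> D \<Longrightarrow> v \<in> D \<Longrightarrow> 0 \<le> Re (q u u) - 2 * Re (q u v) + Re (q v v)"
    and q_nonneg: "0 \<le> Re (q u u)"
    and q_zero: "q (\<lambda>x. 0) (\<lambda>x. 0) = 0"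
    and compact: "compact_resolvent M (form_operator M D q)"
begin

abbreviation H where "H \<equiv> form_operator M D q"

lemma H_L2: "(u, f) \<in> H \<Longrightarrow> u \<in> L2 M \<and> f \<in> L2 M"
  by (auto simp: form_operator_def form_approx_def)

lemma H_symmetric:
  assumes "(u, f) \<in> H" and "(v, g) \<in> H"
  shows "L2_inner M f v = L2_inner M u g"
proof -
  obtain s where s: "form_approx M D q s u"
    and s_lim: "\<And>v t. form_approx M D q t v \<Longrightarrow> (\<lambda>n. q (s n) (t n)) \<longlonglongrightarrow> L2_inner M f v"
    using assms(1) by (auto simp: form_operator_def)
  obtain t where t: "form_approx M D q t v"
    and t_lim: "\<And>v' t'. form_approx M D q t' v' \<Longrightarrow> (\<lambda>n. q (t n) (t' n)) \<longlonglongrightarrow> L2_inner M g v'"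
    using assms(2) by (auto simp: form_operator_def)
  have "(\<lambda>n. cnj (q (t n) (s n))) \<longlonglongrightarrow> cnj (L2_inner M g u)"
    by (intro tendsto_cnj t_lim s)
  then have "(\<lambda>n. q (s n) (t n)) \<longlonglongrightarrow> L2_inner M u g"
    by (simp add: hermitian[symmetric] L2_inner_cnj[symmetric])
  with s_lim[OF t] show ?thesis by (rule LIMSEQ_unique)
qed

lemma H_nonneg:
  assumes "(u, f) \<in> H"
  shows "0 \<le> Re (L2_inner M f u)"
proof -
  obtain s where s: "form_approx M D q s u"
    and s_lim: "\<And>v t. form_approx M D q t v \<Longrightarrow> (\<lambda>n. q (s n) (t n)) \<longlonglongrightarrow> L2_inner M f v"
    using assms by (auto simp: form_operator_def)
  show ?thesis
    using tendsto_Re[OF s_lim[OF s]] q_nonneg by (intro LIMSEQ_le_const) auto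
qed

text \<open>This is the limit of \<open>0 \<le> q (s\<^sub>n - h) (s\<^sub>n - h)\<close>, expanded, along a sequence \<open>s\<^sub>n\<close> that approximates
  \<open>u\<close>: both \<open>q s\<^sub>n s\<^sub>n\<close> and \<open>q s\<^sub>n h\<close> have limits by the definition of the operator, the latter because
  the constant sequence \<open>h\<close> is admissible.\<close>

lemma H_form_bound:
  assumes "(u, f) \<in> H" and h: "h \<in> D"
  shows "2 * Re (L2_inner M f h) - Re (L2_inner M f u) \<le> Re (q h h)"
proof -
  obtain s where s: "form_approx M D q s u"
    and s_lim: "\<And>v t. form_approx M D q t v \<Longrightarrow> (\<lambda>n. q (s n) (t n)) \<longlonglongrightarrow> L2_inner M f v"
    using assms by (auto simp: form_operator_def)
  have "form_approx M D q (\<lambda>_. h) h"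
    using h D_L2 by (auto simp: form_approx_def L2_converges_def q_zero)
  from s_lim[OF s] s_lim[OF this]
  have "(\<lambda>n. Re (q (s n) (s n)) - 2 * Re (q (s n) h) + Re (q h h))
      \<longlonglongrightarrow> Re (L2_inner M f u) - 2 * Re (L2_inner M f h) + Re (q h h)"
    by (intro tendsto_intros tendsto_Re)
  moreover have "0 \<le> Re (q (s n) (s n)) - 2 * Re (q (s n) h) + Re (q h h)" for n
    using s h by (intro q_diff_nonneg) (auto simp: form_approx_def)
  ultimately have "0 \<le> Re (L2_inner M f u) - 2 * Re (L2_inner M f h) + Re (q h h)"
    by (intro LIMSEQ_le_const) auto
  then show ?thesis by linarith
qed

definition T :: "('a \<Rightarrow> complex) \<Rightarrow> 'a \<Rightarrow> complex" where
  "T f = (SOME u. (f, u) \<in> resolvent_graph H)"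

lemma T_graph: "f \<in> L2 M \<Longrightarrow> (T f, \<lambda>x. f x - T f x) \<in> H"
proof -
  assume "f \<in> L2 M"
  then have "\<exists>u. (f, u) \<in> resolvent_graph H"
    using compact by (simp add: compact_resolvent_def)
  then have "(f, T f) \<in> resolvent_graph H" unfolding T_def by (rule someI_ex)
  then show ?thesis by (simp add: resolvent_graph_def)
qed

sublocale compact_resolvent_map M T
proof
  fix f assume f: "f \<in> L2 M"
  show Tf: "T f \<in> L2 M" using H_L2[OF T_graph[OF f]] by simp
  show "L2_sqnorm M (T f) \<le> Re (L2_inner M (T f) f)"
    using H_nonneg[OF T_graph[OF f]] f Tf L2_inner_cnj[of M "T f" f]
    by (simp add: L2_inner_diff_left L2_inner_self)
next
  fix f g assume f: "f \<in> L2 M" and g: "g \<in> L2 M"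
  have L2: "T f \<in> L2 M" "T g \<in> L2 M"
    using H_L2[OF T_graph] f g by simp_all
  show "L2_inner M (T f) g = L2_inner M f (T g)"
    using H_symmetric[OF T_graph[OF f] T_graph[OF g]] f g L2
    by (simp add: L2_inner_diff_left L2_inner_diff_right)
next
  fix f B assume f: "\<And>n :: nat. f n \<in> L2 M" and B: "\<And>n. L2_sqnorm M (f n) \<le> B"
  have "\<forall>n. f n \<in> L2 M \<and> (f n, T (f n)) \<in> resolvent_graph H"
    using f T_graph by (simp add: resolvent_graph_def)
  then obtain r w where "strict_mono r" "w \<in> L2 M" "L2_converges M ((\<lambda>n. T (f n)) \<circ> r) w"
    using compact B unfolding compact_resolvent_def by (metis (no_types, lifting))
  then show "\<exists>r w. strict_mono r \<and> w \<in> L2 M \<and> L2_converges M (\<lambda>n. T (f (r n))) w"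
    by (auto simp: o_def)
qed

lemma eigenspace_imp_eigenvector:
  assumes "u \<in> eigenspace H t"
  shows "eigenvector t u"
  unfolding eigenvector_def
proof (intro conjI ballI)
  have uH: "(u, \<lambda>x. complex_of_real t * u x) \<in> H" using assms by (simp add: eigenspace_def)
  show u: "u \<in> L2 M" using H_L2[OF uH] by simp
  fix g assume g: "g \<in> L2 M"
  show "complex_of_real (t + 1) * L2_inner M u (T g) = L2_inner M u g"
    using H_symmetric[OF uH T_graph[OF g]] u g T_L2[OF g]
    by (simp add: L2_inner_scale_left L2_inner_diff_right algebra_simps)
qed

text \<open>The function \<open>T ((t + 1) u)\<close> is a representative of \<open>u\<close> that is visibly in the domain of \<open>H\<close>.\<close>

lemma eigenvector_imp_eigenspace:
  assumes u: "eigenvector t u"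
  obtains u' where "u' \<in> eigenspace H t" "AE x in M. u' x = u x"
proof
  have u2: "u \<in> L2 M" using u by (rule eigenvector_L2)
  define f where "f = (\<lambda>x. complex_of_real (t + 1) * u x)"
  have f: "f \<in> L2 M" unfolding f_def using u2 by (rule L2_scale)
  have Tf: "T f \<in> L2 M" using f by (rule T_L2)
  have d: "(\<lambda>x. T f x - u x) \<in> L2 M" using Tf u2 by blast
  have "L2_inner M (T f) g = L2_inner M u g" if "g \<in> L2 M" for g
    using u that T_symmetric[OF f that] unfolding f_def
    by (simp add: eigenvector_def L2_inner_scale_left del: of_real_add)
  then have "L2_inner M (\<lambda>x. T f x - u x) (\<lambda>x. T f x - u x) = 0"
    using L2_inner_diff_left[OF Tf u2 d] d by simp
  then have "L2_sqnorm M (\<lambda>x. T f x - u x) = 0" unfolding L2_inner_self by simp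
  then show eq: "AE x in M. T f x = u x" using L2_sqnorm_eq_0_iff[OF d] by simp
  obtain s where s: "form_approx M D q s (T f)"
    and s_lim: "\<And>v t'. form_approx M D q t' v \<Longrightarrow>
                  (\<lambda>n. q (s n) (t' n)) \<longlonglongrightarrow> L2_inner M (\<lambda>x. f x - T f x) v"
    using T_graph[OF f] by (auto simp: form_operator_def)
  have "L2_inner M (\<lambda>x. f x - T f x) v = L2_inner M (\<lambda>x. complex_of_real t * T f x) v"
    if "v \<in> L2 M" for v
  proof (rule L2_inner_cong_AE[OF L2_diff[OF f Tf] L2_scale[OF Tf] that])
    show "AE x in M. f x - T f x = complex_of_real t * T f x"
      using eq
    proof eventually_elim
      case (elim x)
      have "f x = complex_of_real t * u x + u x" by (simp add: f_def distrib_right)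
      with elim show ?case by simp
    qed
  qed
  moreover have "v \<in> L2 M" if "form_approx M D q t' v" for v t'
    using that by (simp add: form_approx_def)
  ultimately have "(\<lambda>n. q (s n) (t' n)) \<longlonglongrightarrow> L2_inner M (\<lambda>x. complex_of_real t * T f x) v"
    if "form_approx M D q t' v" for v t'
    using that s_lim by metis
  with s show "T f \<in> eigenspace H t"
    using Tf by (auto simp: eigenspace_def form_operator_def L2_scale)
qed

text \<open>A finite supremum of numbers of independent eigenvectors is attained, and \<open>m + 1\<close> independent
  eigenvectors would exceed it.\<close>

lemma multiplicity_basis:
  assumes "multiplicity_of M H t = enat m"
  obtains e where "L2_orthonormal M {..<m} e" "\<And>i. i < m \<Longrightarrow> eigenvector t (e i)"
    "\<And>y. eigenvector t y \<Longrightarrow> (\<And>i. i < m \<Longrightarrow> L2_inner M y (e i) = 0) \<Longrightarrow> AE x in M. y x = 0"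
proof -
  define N where "N = {enat n | n. \<exists>u. (\<forall>i<n. u i \<in> eigenspace H t) \<and> L2_independent M n u}"
  have Sup: "Sup N = enat m" using assms by (simp add: multiplicity_of_def N_def)
  have "enat 0 \<in> N" unfolding N_def by (auto simp: L2_independent_def)
  moreover have "finite N" using Sup by (auto simp: Sup_enat_def split: if_splits)
  ultimately have "enat m \<in> N"
    using Sup Max_in[of N] by (cases "N = {}") (simp_all add: Sup_enat_def)
  then obtain v where v: "\<And>i. i < m \<Longrightarrow> v i \<in> eigenspace H t" "L2_independent M m v"
    by (auto simp: N_def)
  have "\<not> L2_independent M (Suc m) v'" if v': "\<And>i. i < Suc m \<Longrightarrow> eigenvector t (v' i)" for v'
  proof
    assume indep: "L2_independent M (Suc m) v'"
    have "\<forall>i. \<exists>u. i < Suc m \<longrightarrow> u \<in> eigenspace H t \<and> (AE x in M. u x = v' i x)"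
      using v' eigenvector_imp_eigenspace by metis
    then obtain u where u: "\<And>i. i < Suc m \<Longrightarrow> u i \<in> eigenspace H t"
      and ae: "\<And>i. i < Suc m \<Longrightarrow> AE x in M. u i x = v' i x" by metis
    have all_ae: "AE x in M. \<forall>i\<in>{..<Suc m}. u i x = v' i x"
      using ae by (intro AE_finite_allI) auto
    have "L2_independent M (Suc m) u"
      unfolding L2_independent_def
    proof (intro allI impI)
      fix c i assume 0: "AE x in M. (\<Sum>i<Suc m. c i * u i x) = 0" and i: "i < Suc m"
      from all_ae 0 have "AE x in M. (\<Sum>i<Suc m. c i * v' i x) = 0"
      proof eventually_elim
        case (elim x)
        then have "(\<Sum>i<Suc m. c i * v' i x) = (\<Sum>i<Suc m. c i * u i x)"
          by (intro sum.cong) auto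
        with elim show ?case by simp
      qed
      then show "c i = 0" using indep i unfolding L2_independent_def by blast
    qed
    with u have "enat (Suc m) \<in> N" unfolding N_def by blast
    then have "enat (Suc m) \<le> enat m" unfolding Sup[symmetric] by (rule Sup_upper)
    then show False by simp
  qed
  from orthonormal_basis_of_eigenvectors[OF eigenspace_imp_eigenvector[OF v(1)] v(2) this] that
  show ?thesis by blast
qed

text \<open>For each \<open>t\<close>, an orthonormal basis of the eigenspace of \<open>t\<close> is distributed over the indices \<open>j\<close> with
  \<open>lam j = t\<close>, whose number is the multiplicity.\<close>

lemma enumeration_basis:
  assumes "eigenvalue_enumeration M H lam"
  obtains u where "L2_orthonormal M {1..} u" "\<And>j. 1 \<le> j \<Longrightarrow> eigenvector (lam j) (u j)"
    "\<And>t y. \<lbrakk>eigenvector t y; \<And>j. 1 \<le> j \<Longrightarrow> lam j = t \<Longrightarrow> L2_inner M y (u j) = 0\<rbrakk>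
      \<Longrightarrow> AE x in M. y x = 0"
proof -
  define J where "J = (\<lambda>t. {j. 1 \<le> j \<and> lam j = t})"
  have fin: "finite (J t)" and mult: "multiplicity_of M H t = enat (card (J t))" for t
    using assms by (auto simp: eigenvalue_enumeration_def J_def)
  have "\<exists>e. L2_orthonormal M {..<card (J t)} e \<and> (\<forall>i<card (J t). eigenvector t (e i)) \<and>
      (\<forall>y. eigenvector t y \<longrightarrow> (\<forall>i<card (J t). L2_inner M y (e i) = 0) \<longrightarrow> (AE x in M. y x = 0))" for t
    using multiplicity_basis[OF mult] by metis
  then obtain e where e: "\<And>t. L2_orthonormal M {..<card (J t)} (e t)"
    and eig: "\<And>t i. i < card (J t) \<Longrightarrow> eigenvector t (e t i)"
    and max: "\<And>t y. eigenvector t y \<Longrightarrow> (\<And>i. i < card (J t) \<Longrightarrow> L2_inner M y (e t i) = 0)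
                \<Longrightarrow> AE x in M. y x = 0"
    by metis
  have "\<exists>g. bij_betw g (J t) {..<card (J t)}" for t
    using ex_bij_betw_finite_nat[OF fin[of t]] by (simp add: atLeast0LessThan)
  then obtain g where g: "\<And>t. bij_betw (g t) (J t) {..<card (J t)}" by metis
  define u where "u = (\<lambda>j. e (lam j) (g (lam j) j))"
  have g_lt: "g (lam j) j < card (J (lam j))" if "1 \<le> j" for j
    using g[of "lam j"] that by (auto simp: bij_betw_def J_def)
  have u_eig: "eigenvector (lam j) (u j)" if "1 \<le> j" for j
    unfolding u_def using eig g_lt[OF that] .
  have "L2_inner M (u i) (u j) = (if i = j then 1 else 0)" if "1 \<le> i" "1 \<le> j" for i j
  proof (cases "lam i = lam j")
    case True
    have "g (lam i) i = g (lam i) j \<longleftrightarrow> i = j"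
      using g[of "lam i"] that True by (intro inj_on_eq_iff[of _ "J (lam i)"]) (auto simp: bij_betw_def J_def)
    then show ?thesis
      using e[of "lam i"] g_lt[of i] g_lt[of j] that True by (auto simp: L2_orthonormal_def u_def)
  next
    case False
    then show ?thesis using eigenvectors_orthogonal[OF u_eig u_eig] that by auto
  qed
  then have "L2_orthonormal M {1..} u"
    using eigenvector_L2[OF u_eig] by (simp add: L2_orthonormal_def)
  moreover have "AE x in M. y x = 0"
    if y: "eigenvector t y" and orth: "\<And>j. 1 \<le> j \<Longrightarrow> lam j = t \<Longrightarrow> L2_inner M y (u j) = 0" for t y
  proof (rule max[OF y])
    fix i assume "i < card (J t)"
    then have "i \<in> g t ` J t" using g[of t] by (auto simp: bij_betw_def)
    then obtain j where "j \<in> J t" "i = g t j" by blast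
    then show "L2_inner M y (e t i) = 0" using orth[of j] by (auto simp: J_def u_def)
  qed
  ultimately show ?thesis using that u_eig by blast
qed

lemma eigenvector_pos:
  assumes u: "eigenvector t u" and "L2_sqnorm M u \<noteq> 0"
  shows "0 < t + 1"
proof -
  have u2: "u \<in> L2 M" using u by (rule eigenvector_L2)
  have "complex_of_real (t + 1) * L2_inner M u (T u) = complex_of_real (L2_sqnorm M u)"
    using u u2 by (simp add: eigenvector_def L2_inner_self del: of_real_add)
  from arg_cong[OF this, of Re] have "(t + 1) * Re (L2_inner M u (T u)) = L2_sqnorm M u"
    by simp
  moreover have "0 \<le> Re (L2_inner M u (T u))"
    using order_trans[OF L2_sqnorm_nonneg T_sqnorm_le[OF u2]] T_symmetric[OF u2 u2] by simp
  moreover have "0 < L2_sqnorm M u" using assms(2) by (simp add: order_less_le)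
  ultimately show ?thesis by (metis zero_less_mult_pos2 order_less_le mult_zero_right)
qed

text \<open>A nonzero eigenvector that is orthogonal to \<open>u 1, \<dots>, u k\<close> has an eigenvalue \<open>t \<ge> lam (k + 1)\<close>.
  Otherwise all indices \<open>j\<close> with \<open>lam j = t\<close> are at most \<open>k\<close> by monotonicity, so it would be
  orthogonal to a whole basis of the eigenspace of \<open>t\<close>.\<close>

lemma form_bounds_eigenvalue_means:
  assumes lam: "eigenvalue_enumeration M H lam"
  obtains u where "L2_orthonormal M {1..k} u"
    "\<And>h. h \<in> D \<Longrightarrow>
        (\<Sum>j=1..k. lam j * (cmod (L2_inner M h (u j)))\<^sup>2)
        + lam (Suc k) * (L2_sqnorm M h - (\<Sum>j=1..k. (cmod (L2_inner M h (u j)))\<^sup>2))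
      \<le> Re (q h h)"
proof -
  obtain u where u: "L2_orthonormal M {1..} u" and eig: "\<And>j. 1 \<le> j \<Longrightarrow> eigenvector (lam j) (u j)"
    and complete: "\<And>t y. \<lbrakk>eigenvector t y; \<And>j. 1 \<le> j \<Longrightarrow> lam j = t \<Longrightarrow> L2_inner M y (u j) = 0\<rbrakk>
      \<Longrightarrow> AE x in M. y x = 0"
    using enumeration_basis[OF lam] by blast
  have orth: "L2_orthonormal M {1..k} u" using u by (auto simp: L2_orthonormal_def)
  have pos: "0 < lam j + 1" if "1 \<le> j" for j
  proof (rule eigenvector_pos[OF eig[OF that]])
    have "L2_inner M (u j) (u j) = 1" using u that by (simp add: L2_orthonormal_def)
    then show "L2_sqnorm M (u j) \<noteq> 0" unfolding L2_inner_self by auto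
  qed
  have bound: "lam (Suc k) \<le> t"
    if y: "eigenvector t y" and orth: "\<And>i. i \<in> {1..k} \<Longrightarrow> L2_inner M y (u i) = 0"
      and nz: "\<not> (AE x in M. y x = 0)" for t y
  proof (rule ccontr)
    assume "\<not> lam (Suc k) \<le> t"
    then have less: "t < lam (Suc k)" by simp
    have "L2_inner M y (u j) = 0" if j: "1 \<le> j" and "lam j = t" for j
    proof (rule orth)
      have "\<not> Suc k \<le> j"
        using lam less \<open>lam j = t\<close> mono_onD[of "{1..}" lam "Suc k" j]
        unfolding eigenvalue_enumeration_def by force
      with j show "j \<in> {1..k}" by simp
    qed
    with complete[OF y] nz show False by blast
  qed
  show thesis
  proof (rule that[OF orth])
    fix h assume h: "h \<in> D"
    then have h2: "h \<in> L2 M" using D_L2 by blast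
    show "(\<Sum>j=1..k. lam j * (cmod (L2_inner M h (u j)))\<^sup>2)
        + lam (Suc k) * (L2_sqnorm M h - (\<Sum>j=1..k. (cmod (L2_inner M h (u j)))\<^sup>2))
      \<le> Re (q h h)"
    proof (rule eigenvalue_sum_bound[OF _ orth _ _ pos _ h2])
      fix f assume f: "f \<in> L2 M"
      have "2 * Re (L2_inner M (\<lambda>x. f x - T f x) h) - Re (L2_inner M (\<lambda>x. f x - T f x) (T f)) \<le> Re (q h h)"
        by (rule H_form_bound[OF T_graph[OF f] h])
      moreover have "0 \<le> L2_sqnorm M (\<lambda>x. T f x - h x)" by simp
      ultimately show "2 * Re (L2_inner M f h) - Re (L2_inner M (T f) f) \<le> Re (q h h) + L2_sqnorm M h"
        using f h2 T_L2[OF f] T_symmetric[OF f f]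
        by (simp add: L2_inner_diff_left L2_sqnorm_diff L2_inner_self)
    qed (use eig pos bound in \<open>auto simp: less_le\<close>)
  qed
qed

end

section \<open>Smooth bump functions\<close>

lemma Ck_on_UNIV_SucD:
  fixes f :: "'a::real_normed_vector \<Rightarrow> real"
  shows "Ck_on (Suc n) f UNIV \<Longrightarrow> Ck_on n f UNIV"
proof (induction n arbitrary: f)
  case 0
  then show ?case
    by (auto intro!: continuous_at_imp_continuous_on differentiable_imp_continuous_within)
next
  case (Suc n)
  show ?case
    using Suc.prems Suc.IH[of "\<lambda>x. frechet_derivative f (at x) v" for v]
    by (simp only: Ck_on.simps(2)) blast
qed

lemma Ck_on_const: "Ck_on n (\<lambda>x. c) UNIV"
  by (induction n arbitrary: c) auto

lemma Ck_on_add: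
  fixes f g :: "'a::real_normed_vector \<Rightarrow> real"
  assumes "Ck_on n f UNIV" and "Ck_on n g UNIV"
  shows "Ck_on n (\<lambda>x. f x + g x) UNIV"
  using assms
proof (induction n arbitrary: f g)
  case 0
  then show ?case by (simp add: continuous_on_add)
next
  case (Suc n)
  have "frechet_derivative (\<lambda>x. f x + g x) (at x)
      = (\<lambda>v. frechet_derivative f (at x) v + frechet_derivative g (at x) v)" for x
    using Suc.prems
    by (intro frechet_derivative_at[symmetric] has_derivative_add)
      (auto simp: frechet_derivative_works[symmetric])
  then show ?case using Suc by simp
qed

lemma Ck_on_mult:
  fixes f g :: "'a::real_normed_vector \<Rightarrow> real"
  assumes "Ck_on n f UNIV" and "Ck_on n g UNIV"
  shows "Ck_on n (\<lambda>x. f x * g x) UNIV"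
  using assms
proof (induction n arbitrary: f g)
  case 0
  then show ?case by (simp add: continuous_on_mult)
next
  case (Suc n)
  have "frechet_derivative (\<lambda>x. f x * g x) (at x)
      = (\<lambda>v. f x * frechet_derivative g (at x) v + frechet_derivative f (at x) v * g x)" for x
    using Suc.prems
    by (intro frechet_derivative_at[symmetric] has_derivative_mult)
      (auto simp: frechet_derivative_works[symmetric])
  then show ?case
    using Suc.prems Suc.IH Ck_on_UNIV_SucD[OF Suc.prems(1)] Ck_on_UNIV_SucD[OF Suc.prems(2)]
    by (auto intro!: Ck_on_add)
qed

lemma Ck_on_prod:
  fixes f :: "'i \<Rightarrow> 'a::real_normed_vector \<Rightarrow> real"
  assumes "\<And>i. i \<in> I \<Longrightarrow> Ck_on n (f i) UNIV"
  shows "Ck_on n (\<lambda>x. \<Prod>i\<in>I. f i x) UNIV"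
  using assms
  by (induction I rule: infinite_finite_induct) (auto intro!: Ck_on_mult Ck_on_const)

text \<open>The functions \<open>p(1/t) exp (- 1/t)\<close>, extended by 0 to \<open>t \<le> 0\<close>, form a family that is closed
  under differentiation; this is why \<open>exp (- 1/t)\<close> is smooth.\<close>

definition flat_exp :: "real poly \<Rightarrow> real \<Rightarrow> real" where
  "flat_exp p t = (if 0 < t then poly p (1 / t) * exp (- (1 / t)) else 0)"

text \<open>The power of \<open>s\<close> in front makes the statement stable under induction on the polynomial.\<close>

lemma power_poly_exp_tendsto_0: "((\<lambda>s. s ^ n * poly p s * exp (- s)) \<longlongrightarrow> (0::real)) at_top"
proof (induction p arbitrary: n)
  case 0
  then show ?case by simp
next
  case (pCons a p)
  have "((\<lambda>s. a * (s ^ n / exp s) + s ^ Suc n * poly p s * exp (- s)) \<longlongrightarrow> a * 0 + 0) at_top"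
    by (intro tendsto_intros tendsto_power_div_exp_0 pCons.IH)
  then show ?case by (simp add: algebra_simps exp_minus divide_inverse)
qed

lemma flat_exp_tendsto_0: "((\<lambda>t. flat_exp p t / t) \<longlongrightarrow> 0) (at 0)"
proof (rule filterlim_split_at_real)
  have "((\<lambda>t. (1 / t) ^ 1 * poly p (1 / t) * exp (- (1 / t))) \<longlongrightarrow> (0::real)) (at_right 0)"
    using filterlim_compose[OF power_poly_exp_tendsto_0[of 1 p] filterlim_inverse_at_top_right]
    by (simp add: inverse_eq_divide)
  then show "((\<lambda>t. flat_exp p t / t) \<longlongrightarrow> 0) (at_right 0)"
    by (rule Lim_transform_eventually)
      (auto simp: flat_exp_def eventually_at_filter field_simps)
  show "((\<lambda>t. flat_exp p t / t) \<longlongrightarrow> 0) (at_left 0)"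
    by (rule tendsto_eventually) (auto simp: flat_exp_def eventually_at_filter)
qed

lemma flat_exp_has_derivative:
  "(flat_exp p has_real_derivative flat_exp (pCons 0 (pCons 0 (p - pderiv p))) t) (at t)"
proof (cases t "0::real" rule: linorder_cases)
  case less
  have "((\<lambda>t. 0) has_real_derivative 0) (at t)" by simp
  then have "(flat_exp p has_real_derivative 0) (at t)"
    by (rule has_field_derivative_transform_within_open[of _ _ _ "{..<0}"])
      (use less in \<open>auto simp: flat_exp_def\<close>)
  then show ?thesis using less by (simp add: flat_exp_def)
next
  case equal
  show ?thesis
    using flat_exp_tendsto_0[of p] unfolding equal DERIV_def by (simp add: flat_exp_def)
next
  case greater
  have "((\<lambda>t. poly p (1 / t) * exp (- (1 / t))) has_real_derivative
      flat_exp (pCons 0 (pCons 0 (p - pderiv p))) t) (at t)"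
    using greater
    by (auto intro!: derivative_eq_intros DERIV_chain2[OF poly_DERIV]
        simp: flat_exp_def field_simps power2_eq_square)
  then show ?thesis
    by (rule has_field_derivative_transform_within_open[of _ _ _ "{0<..}"])
      (use greater in \<open>auto simp: flat_exp_def\<close>)
qed

lemma Ck_on_flat_exp_coordinate:
  fixes a b :: real
  shows "Ck_on n (\<lambda>x::real^'n. flat_exp p (a * x $ i + b)) UNIV"
proof (induction n arbitrary: p)
  have deriv: "((\<lambda>x::real^'n. flat_exp p (a * x $ i + b)) has_derivative
      (\<lambda>v. (a * v $ i) * flat_exp (pCons 0 (pCons 0 (p - pderiv p))) (a * x $ i + b))) (at x)" for p x
  proof -
    have "((\<lambda>x::real^'n. a * x $ i + b) has_derivative (\<lambda>v. a * v $ i)) (at x)"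
      by (auto intro!: derivative_eq_intros bounded_linear_imp_has_derivative bounded_linear_vec_nth)
    from has_derivative_compose[OF this
        flat_exp_has_derivative[of p "a * x $ i + b", unfolded has_field_derivative_def]]
    show ?thesis by (simp add: mult.commute)
  qed
  {
    case 0
    show ?case using deriv[of p]
      by (auto intro!: continuous_at_imp_continuous_on has_derivative_continuous)
  next
    case (Suc n)
    have "frechet_derivative (\<lambda>x::real^'n. flat_exp p (a * x $ i + b)) (at x)
        = (\<lambda>v. (a * v $ i) * flat_exp (pCons 0 (pCons 0 (p - pderiv p))) (a * x $ i + b))" for x
      using deriv by (rule frechet_derivative_at[symmetric])
    moreover have "(\<lambda>x::real^'n. flat_exp p (a * x $ i + b)) differentiable (at x)" for x
      using deriv differentiable_def by blast
    ultimately show ?case using Suc.IH by (auto intro!: Ck_on_mult Ck_on_const)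
  }
qed

text \<open>For \<open>m \<rightarrow> \<infinity>\<close> these functions tend to the indicator function of the open box, because
  \<open>flat_exp 1 (m t)\<close> tends to 1 for \<open>t > 0\<close> and vanishes for \<open>t \<le> 0\<close>.\<close>

definition box_bump :: "real^'n \<Rightarrow> real^'n \<Rightarrow> nat \<Rightarrow> real^'n \<Rightarrow> real" where
  "box_bump a b m x = (\<Prod>i\<in>UNIV. flat_exp 1 (real m * (x $ i - a $ i)) * flat_exp 1 (real m * (b $ i - x $ i)))"

lemma smooth_on_box_bump: "smooth_on (box_bump a b m) UNIV"
  unfolding smooth_on_def
proof
  fix n
  have eq: "box_bump a b m = (\<lambda>x. \<Prod>i\<in>UNIV. flat_exp 1 (real m * x $ i + (- (real m * a $ i)))
      * flat_exp 1 ((- real m) * x $ i + real m * b $ i))"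
    by (simp add: box_bump_def fun_eq_iff right_diff_distrib)
  show "Ck_on n (box_bump a b m) UNIV"
    unfolding eq by (intro Ck_on_prod Ck_on_mult Ck_on_flat_exp_coordinate)
qed

lemma box_bump_outside:
  assumes "x \<notin> box a b"
  shows "box_bump a b m x = 0"
proof -
  obtain i where "x $ i \<le> a $ i \<or> b $ i \<le> x $ i"
    using assms by (auto simp: mem_box_cart not_less)
  then have "flat_exp 1 (real m * (x $ i - a $ i)) * flat_exp 1 (real m * (b $ i - x $ i)) = 0"
    by (auto simp: flat_exp_def zero_less_mult_iff)
  then show ?thesis unfolding box_bump_def by (meson UNIV_I finite prod_zero)
qed

lemma box_bump_bounds: "0 \<le> box_bump a b m x" "box_bump a b m x \<le> 1"
proof -
  have "0 \<le> flat_exp 1 t \<and> flat_exp 1 t \<le> 1" for t by (simp add: flat_exp_def)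
  then show "0 \<le> box_bump a b m x" "box_bump a b m x \<le> 1"
    unfolding box_bump_def by (auto intro!: prod_nonneg prod_le_1 mult_nonneg_nonneg mult_le_one)
qed

lemma box_bump_tendsto: "(\<lambda>m. box_bump a b m x) \<longlonglongrightarrow> indicator (box a b) x"
proof (cases "x \<in> box a b")
  case False
  then show ?thesis by (simp add: box_bump_outside)
next
  case True
  have lim: "(\<lambda>m. flat_exp 1 (real m * c)) \<longlonglongrightarrow> 1" if "0 < c" for c
  proof -
    have "(\<lambda>m. exp (- (1 / c * inverse (real m)))) \<longlonglongrightarrow> exp (- (1 / c * 0))"
      by (intro tendsto_intros lim_inverse_n)
    then have "(\<lambda>m. exp (- (1 / c * inverse (real m)))) \<longlonglongrightarrow> 1" by simp
    then show ?thesis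
    proof (rule Lim_transform_eventually)
      show "\<forall>\<^sub>F m in sequentially. exp (- (1 / c * inverse (real m))) = flat_exp 1 (real m * c)"
        using eventually_gt_at_top[of 0]
        by eventually_elim (use that in \<open>simp add: flat_exp_def field_simps\<close>)
    qed
  qed
  have "(\<lambda>m. box_bump a b m x) \<longlonglongrightarrow> (\<Prod>i\<in>(UNIV :: 'a set). 1 * 1)"
    unfolding box_bump_def using True
    by (intro tendsto_prod tendsto_mult lim) (auto simp: mem_box_cart)
  with True show ?thesis by simp
qed

lemma test_function_box_bump:
  assumes "cbox a b \<subseteq> \<Omega>"
  shows "test_function \<Omega> (box_bump a b m)"
  unfolding test_function_def
  using assms box_bump_outside[of _ a b m] box_subset_cbox[of a b] smooth_on_box_bump
  by (intro conjI exI[of _ "cbox a b"]) auto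

lemma test_function_differentiable:
  assumes "test_function \<Omega> \<phi>"
  shows "(\<phi> has_derivative frechet_derivative \<phi> (at x)) (at x)"
    and "continuous_on UNIV (\<lambda>x. frechet_derivative \<phi> (at x) v)"
    and "continuous_on UNIV \<phi>"
proof -
  have "Ck_on (Suc 0) \<phi> UNIV" using assms by (simp only: test_function_def smooth_on_def)
  then show "(\<phi> has_derivative frechet_derivative \<phi> (at x)) (at x)"
    and "continuous_on UNIV (\<lambda>x. frechet_derivative \<phi> (at x) v)"
    and "continuous_on UNIV \<phi>"
    using Ck_on_UNIV_SucD[of 0 \<phi>] by (auto simp: frechet_derivative_works[symmetric])
qed

section \<open>The fundamental lemma of the calculus of variations\<close>

lemma sigma_finite_lebesgue: "sigma_finite_measure (lebesgue :: 'a::euclidean_space measure)"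
proof
  have "(\<Union>n::nat. cball 0 (real n)) = (UNIV :: 'a set)"
    by (auto simp: real_arch_simple)
  then show "\<exists>A. countable A \<and> A \<subseteq> sets (lebesgue :: 'a measure) \<and> \<Union>A = space lebesgue \<and>
      (\<forall>a\<in>A. emeasure lebesgue a \<noteq> \<infinity>)"
    by (intro exI[of _ "range (\<lambda>n::nat. cball 0 (real n))"]) (auto simp: emeasure_cball)
qed

text \<open>The boxes are closed under intersection and generate the Borel sets, so the integral of \<open>f\<close>
  vanishes over every Borel set, and a Lebesgue set differs from a Borel set by a null set.\<close>

lemma AE_eq_0_if_box_integrals_0:
  fixes f :: "'a::euclidean_space \<Rightarrow> 'b::{banach, second_countable_topology}"
  assumes f: "integrable lebesgue f"
    and box: "\<And>a b. (LINT x:box a b|lebesgue. f x) = 0"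
  shows "AE x in lebesgue. f x = 0"
proof (rule sigma_finite_measure.density_zero[OF sigma_finite_lebesgue f])
  let ?E = "range (\<lambda>(a, b). box a b :: 'a set)"
  have set_int: "set_integrable lebesgue A f" if "A \<in> sets lebesgue" for A
    using f that unfolding set_integrable_def by (rule integrable_mult_indicator[rotated])
  have borel: "sets borel = sigma_sets UNIV ?E" by (simp add: borel_eq_box)
  have all: "(LINT x|lebesgue. f x) = 0"
  proof -
    let ?B = "\<lambda>n::nat. box (- (real n *\<^sub>R One)) (real n *\<^sub>R One) :: 'a set"
    have mono: "incseq ?B"
      by (rule incseq_SucI) (auto simp: box_def intro: less_trans)
    have "(\<lambda>n. LINT x:?B n|lebesgue. f x) \<longlonglongrightarrow> (LINT x:(\<Union>n. ?B n)|lebesgue. f x)"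
      using mono by (intro set_integral_cont_up set_int) (auto simp: UN_box_eq_UNIV)
    then show ?thesis
      unfolding box UN_box_eq_UNIV by (simp add: set_lebesgue_integral_def LIMSEQ_const_iff)
  qed
  have zero_borel: "(LINT x:A|lebesgue. f x) = 0" if "A \<in> sets borel" for A
  proof -
    have "Int_stable ?E" by (auto simp: Int_stable_def box_Int_box)
    moreover have "?E \<subseteq> Pow UNIV" by simp
    moreover have "A \<in> sigma_sets UNIV ?E" using that borel by simp
    ultimately show ?thesis
    proof (induction rule: sigma_sets_induct_disjoint)
      case (basic A)
      then show ?case using box by auto
    next
      case empty
      then show ?case by (simp add: set_lebesgue_integral_def)
    next
      case (compl A)
      then have A: "A \<in> sets lebesgue" using borel by auto
      have "(LINT x:UNIV - A|lebesgue. f x) + (LINT x:A|lebesgue. f x) = (LINT x:UNIV|lebesgue. f x)"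
        using A by (subst set_integral_Un[symmetric]) (auto intro!: set_int)
      then show ?case using compl all by (simp add: set_lebesgue_integral_def)
    next
      case (union A)
      then have "\<And>i. A i \<in> sets borel" using borel by blast
      then have A: "\<And>i. A i \<in> sets lebesgue" by simp
      have "(LINT x:(\<Union>i. A i)|lebesgue. f x) = (\<Sum>i. LINT x:A i|lebesgue. f x)"
        using A union.hyps by (intro lebesgue_integral_countable_add set_int) (auto simp: disjoint_family_on_def)
      then show ?case using union by simp
    qed
  qed
  fix A :: "'a set" assume "A \<in> sets lebesgue"
  then obtain S N N' where A: "A = S \<union> N" "N \<subseteq> N'" "N' \<in> null_sets lborel" "S \<in> sets lborel"
    by (rule sets_completionE)
  have "AE x in lborel. x \<notin> N'" using A(3) by (rule AE_not_in)
  then have "AE x in lebesgue. x \<notin> N'" by (rule AE_completion)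
  then have "(LINT x:A|lebesgue. f x) = (LINT x:S|lebesgue. f x)"
    using A \<open>A \<in> sets lebesgue\<close> f
    by (intro set_integral_cong_set) (auto simp: set_borel_measurable_def intro!: borel_measurable_scaleR borel_measurable_indicator)
  then show "(LINT x:A|lebesgue. f x) = 0" using zero_borel A(4) by simp
qed

text \<open>The open set is a countable union of closed boxes. The restriction of \<open>f\<close> to one of them satisfies
  the hypothesis of the previous lemma, because two boxes intersect in a box.\<close>

lemma AE_eq_0_on_open_if_box_integrals_0:
  fixes f :: "'a::euclidean_space \<Rightarrow> 'b::{banach, second_countable_topology}"
  assumes f: "integrable lebesgue f" and "open \<Omega>"
    and box: "\<And>a b. cbox a b \<subseteq> \<Omega> \<Longrightarrow> (LINT x:box a b|lebesgue. f x) = 0"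
  shows "AE x in lebesgue. x \<in> \<Omega> \<longrightarrow> f x = 0"
proof -
  obtain \<D> where \<D>: "countable \<D>" "\<D> \<subseteq> Pow \<Omega>" "\<And>X. X \<in> \<D> \<Longrightarrow> \<exists>a b. X = cbox a b" "\<Union>\<D> = \<Omega>"
    using open_countable_Union_open_cbox[OF \<open>open \<Omega>\<close>] by metis
  have "AE x in lebesgue. x \<in> X \<longrightarrow> f x = 0" if X: "X \<in> \<D>" for X
  proof -
    obtain a b where Xab: "X = cbox a b" using \<D>(3)[OF X] by blast
    then have sub: "cbox a b \<subseteq> \<Omega>" using X \<D>(2) by blast
    define g where "g = (\<lambda>x. indicat_real (box a b) x *\<^sub>R f x)"
    have "AE x in lebesgue. g x = 0"
    proof (rule AE_eq_0_if_box_integrals_0)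
      show "integrable lebesgue g"
        unfolding g_def using f by (intro integrable_mult_indicator) auto
      fix c d
      obtain p r where pr: "box c d \<inter> box a b = box p r" using box_Int_box by blast
      have "(LINT x:box c d|lebesgue. g x) = (LINT x:box p r|lebesgue. f x)"
        unfolding set_lebesgue_integral_def g_def
        by (simp add: pr[symmetric] indicator_inter_arith)
      also have "\<dots> = 0"
      proof (cases "box p r = {}")
        case True
        then show ?thesis by (simp add: set_lebesgue_integral_def)
      next
        case False
        then have "cbox p r = closure (box p r)" by simp
        also have "\<dots> \<subseteq> closure (box a b)" using pr by (intro closure_mono) auto
        also have "\<dots> \<subseteq> cbox a b" by (intro closure_minimal box_subset_cbox closed_cbox)
        finally show ?thesis using sub by (intro box) blast
      qed
      finally show "(LINT x:box c d|lebesgue. g x) = 0" .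
    qed
    moreover have "AE x in lebesgue. x \<notin> cbox a b - box a b"
    proof (rule AE_not_in)
      have "cbox a b - box a b \<in> null_sets lborel"
        by (rule null_setsI) (auto simp: emeasure_Diff emeasure_lborel_box_eq emeasure_lborel_cbox_eq box_subset_cbox)
      then show "cbox a b - box a b \<in> null_sets lebesgue" by (rule null_sets_completionI)
    qed
    ultimately show ?thesis
      by eventually_elim (auto simp: g_def Xab)
  qed
  then have "AE x in lebesgue. \<forall>X\<in>\<D>. x \<in> X \<longrightarrow> f x = 0"
    using \<D>(1) by (subst AE_ball_countable) blast+
  then show ?thesis by eventually_elim (use \<D>(4) in blast)
qed

lemma AE_eq_0_if_orthogonal_to_test_functions:
  fixes f :: "real^'n \<Rightarrow> complex"
  assumes f: "integrable (lebesgue_on \<Omega>) f" and "open \<Omega>"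
    and orth: "\<And>\<phi>. test_function \<Omega> \<phi> \<Longrightarrow> (\<integral>x. f x * complex_of_real (\<phi> x) \<partial>lebesgue_on \<Omega>) = 0"
  shows "AE x in lebesgue_on \<Omega>. f x = 0"
proof -
  have \<Omega>: "\<Omega> \<in> sets lebesgue" using \<open>open \<Omega>\<close> by auto
  define F where "F = (\<lambda>x. indicat_real \<Omega> x *\<^sub>R f x)"
  have F: "integrable lebesgue F"
    unfolding F_def using f \<Omega> by (simp add: integrable_restrict_space)
  have "AE x in lebesgue. x \<in> \<Omega> \<longrightarrow> F x = 0"
  proof (rule AE_eq_0_on_open_if_box_integrals_0[OF F \<open>open \<Omega>\<close>])
    fix a b :: "real^'n" assume ab: "cbox a b \<subseteq> \<Omega>"
    have 0: "(LINT x|lebesgue. box_bump a b m x *\<^sub>R F x) = 0" for m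
    proof -
      have "(LINT x|lebesgue. box_bump a b m x *\<^sub>R F x)
          = (LINT x|lebesgue. indicat_real \<Omega> x *\<^sub>R (f x * complex_of_real (box_bump a b m x)))"
        by (intro Bochner_Integration.integral_cong) (auto simp: F_def indicator_def scaleR_conv_of_real)
      also have "\<dots> = (\<integral>x. f x * complex_of_real (box_bump a b m x) \<partial>lebesgue_on \<Omega>)"
        using \<Omega> by (simp add: integral_restrict_space)
      finally show ?thesis using orth[OF test_function_box_bump[OF ab]] by simp
    qed
    have meas: "box_bump a b m \<in> borel_measurable lebesgue" for m
    proof (rule measurable_completion)
      show "box_bump a b m \<in> borel_measurable lborel"
        using test_function_differentiable(3)[OF test_function_box_bump[OF subset_refl]]
        by (auto intro: borel_measurable_continuous_onI)
    qed
    have "(\<lambda>m. LINT x|lebesgue. box_bump a b m x *\<^sub>R F x) \<longlonglongrightarrow> (LINT x|lebesgue. indicat_real (box a b) x *\<^sub>R F x)"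
    proof (rule integral_dominated_convergence)
      show "integrable lebesgue (\<lambda>x. norm (F x))" using F by simp
      show "AE x in lebesgue. (\<lambda>m. box_bump a b m x *\<^sub>R F x) \<longlonglongrightarrow> indicat_real (box a b) x *\<^sub>R F x"
        by (intro AE_I2 tendsto_scaleR box_bump_tendsto tendsto_const)
      show "AE x in lebesgue. norm (box_bump a b m x *\<^sub>R F x) \<le> norm (F x)" for m
        using box_bump_bounds[of a b m] by (auto intro!: AE_I2 mult_left_le_one_le)
    qed (use meas F in \<open>auto intro!: borel_measurable_scaleR borel_measurable_indicator\<close>)
    then show "(LINT x:box a b|lebesgue. F x) = 0"
      unfolding set_lebesgue_integral_def by (simp add: 0 LIMSEQ_const_iff)
  qed
  then show ?thesis using \<Omega> by (auto simp: AE_restrict_space_iff F_def)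
qed

section \<open>Integration by parts\<close>

lemma integrable_compactly_supported:
  fixes g :: "'a::euclidean_space \<Rightarrow> complex"
  assumes "continuous_on UNIV g" and "compact K" and "\<And>x. x \<notin> K \<Longrightarrow> g x = 0"
  shows "integrable lborel g"
proof -
  have "set_integrable lborel K g"
    unfolding set_integrable_def
    using assms by (intro borel_integrable_compact) (auto intro: continuous_on_subset)
  then show ?thesis
    unfolding set_integrable_def
    by (rule back_subst[of "integrable lborel"]) (use assms(3) in \<open>force simp: indicator_def\<close>)
qed

lemma integral_lborel_translate:
  fixes g :: "'a::euclidean_space \<Rightarrow> complex"
  assumes [measurable]: "g \<in> borel_measurable borel"
  shows "(LINT x|lborel. g (x + c)) = (LINT x|lborel. g x)"
  by (subst lborel_distr_plus[of c, symmetric], subst integral_distr) (auto simp: add.commute)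

text \<open>The integral of a directional derivative vanishes because the integral of \<open>g\<close> is
  translation invariant: it is the limit of the integrals of the difference quotients.\<close>

lemma integral_directional_derivative_eq_0:
  fixes g :: "'a::euclidean_space \<Rightarrow> complex"
  assumes deriv: "\<And>x. (g has_derivative g' x) (at x)"
    and cont: "continuous_on UNIV (\<lambda>x. g' x e)"
    and K: "compact K" "\<And>x. x \<notin> K \<Longrightarrow> g x = 0"
  shows "(LINT x|lborel. g' x e) = 0"
proof -
  have g_cont: "continuous_on UNIV g"
    using deriv has_derivative_continuous by (blast intro: continuous_at_imp_continuous_on)
  have [measurable]: "g \<in> borel_measurable borel" "(\<lambda>x. g' x e) \<in> borel_measurable borel"
    using g_cont cont by (auto intro: borel_measurable_continuous_onI)
  obtain r where r: "K \<subseteq> cball 0 r"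
    using bounded_subset_ballD[OF compact_imp_bounded[OF K(1)]] ball_subset_cball by blast
  define S where "S = cball (0::'a) (r + norm e)"
  have "bounded ((\<lambda>x. g' x e) ` cball 0 (r + 2 * norm e))"
    by (intro compact_imp_bounded compact_continuous_image continuous_on_subset[OF cont]) auto
  then obtain B where B: "\<And>x. x \<in> cball 0 (r + 2 * norm e) \<Longrightarrow> norm (g' x e) \<le> B"
    unfolding bounded_iff by blast
  define t where "t = (\<lambda>m::nat. inverse (real (Suc m)))"
  have t: "0 < t m" "t m \<le> 1" for m by (auto simp: t_def field_simps)
  have vderiv: "((\<lambda>s. g (x + s *\<^sub>R e)) has_vector_derivative g' (x + s *\<^sub>R e) e) (at s)" for x s
  proof -
    have "((\<lambda>s. x + s *\<^sub>R e) has_derivative (\<lambda>h. h *\<^sub>R e)) (at s)"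
      by (auto intro!: derivative_eq_intros)
    from has_derivative_compose[OF this deriv]
    show ?thesis
      unfolding has_vector_derivative_def
      using has_derivative_linear[OF deriv] by (simp add: linear_cmul)
  qed
  define d where "d = (\<lambda>m x. inverse (t m) *\<^sub>R (g (x + t m *\<^sub>R e) - g x))"
  have norm_t: "norm (t m *\<^sub>R e) \<le> norm e" for m
    using t[of m] by (simp add: mult_left_le_one_le)
  \<comment> \<open>The difference quotients vanish outside \<open>S\<close> because the shifts have at most the length of \<open>e\<close>; inside, the
    mean value inequality bounds them by \<open>B\<close>.\<close>
  have far: "g x = 0" if "r < norm x" for x
    using that r K(2) by (meson mem_cball_0 not_less subsetD)
  have bound: "norm (d m x) \<le> indicator S x *\<^sub>R B" for m x
  proof (cases "x \<in> S")
    case True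
    have "norm (g (x + t m *\<^sub>R e) - g (x + 0 *\<^sub>R e)) \<le> B * t m - B * 0"
    proof (rule differentiable_bound_general[where f' = "\<lambda>s. g' (x + s *\<^sub>R e) e" and \<phi>' = "\<lambda>_. B"])
      show "0 < t m" by (rule t)
      show "continuous_on {0..t m} (\<lambda>s. g (x + s *\<^sub>R e))"
        using vderiv by (intro continuous_at_imp_continuous_on ballI has_vector_derivative_continuous)
      show "continuous_on {0..t m} (\<lambda>s. B * s)" by (intro continuous_intros)
      fix s assume s: "0 < s" "s < t m"
      show "((\<lambda>s. g (x + s *\<^sub>R e)) has_vector_derivative g' (x + s *\<^sub>R e) e) (at s)" by (rule vderiv)
      show "((\<lambda>s. B * s) has_vector_derivative B) (at s)"
        by (auto intro!: derivative_eq_intros simp: has_real_derivative_iff_has_vector_derivative[symmetric])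
      have "norm (x + s *\<^sub>R e) \<le> norm x + norm (s *\<^sub>R e)" by (rule norm_triangle_ineq)
      also have "\<dots> \<le> (r + norm e) + norm e"
      proof (rule add_mono)
        show "norm x \<le> r + norm e" using True by (simp add: S_def)
        show "norm (s *\<^sub>R e) \<le> norm e" using s t[of m] by (simp add: mult_left_le_one_le)
      qed
      finally show "norm (g' (x + s *\<^sub>R e) e) \<le> B" by (intro B) simp
    qed
    then have "norm (g (x + t m *\<^sub>R e) - g x) \<le> B * t m" by simp
    moreover have "norm (d m x) = norm (g (x + t m *\<^sub>R e) - g x) / t m"
      using t[of m] by (simp only: d_def norm_scaleR) (simp add: divide_inverse)
    ultimately have "norm (d m x) \<le> B" using t[of m] by (simp add: divide_le_eq)
    then show ?thesis using True by simp
  next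
    case False
    then have x: "r + norm e < norm x" by (simp add: S_def)
    then have "r < norm x" using norm_ge_zero[of e] by linarith
    moreover have "r < norm (x + t m *\<^sub>R e)"
      using x norm_t[of m] norm_triangle_ineq2[of x "- (t m *\<^sub>R e)"] by simp
    ultimately show ?thesis using False by (simp add: d_def far)
  qed
  have int_g: "integrable lborel g" using g_cont K by (rule integrable_compactly_supported)
  have d0: "(LINT x|lborel. d m x) = 0" for m
  proof -
    have "integrable lborel (\<lambda>x. g (x + t m *\<^sub>R e))"
    proof (rule integrable_compactly_supported)
      show "continuous_on UNIV (\<lambda>x. g (x + t m *\<^sub>R e))"
        by (intro continuous_on_compose2[OF g_cont] continuous_intros) auto
      show "compact ((\<lambda>x. x - t m *\<^sub>R e) ` K)"
        by (intro compact_continuous_image continuous_intros K)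
      show "g (x + t m *\<^sub>R e) = 0" if "x \<notin> (\<lambda>x. x - t m *\<^sub>R e) ` K" for x
        using that by (intro K(2)) (metis add_diff_cancel_right' imageI)
    qed
    then show ?thesis using int_g integral_lborel_translate[of g "t m *\<^sub>R e"]
      by (simp add: d_def)
  qed
  have "(\<lambda>m. LINT x|lborel. d m x) \<longlonglongrightarrow> (LINT x|lborel. g' x e)"
  proof (rule integral_dominated_convergence)
    show "integrable lborel (\<lambda>x. indicator S x *\<^sub>R B)"
      using emeasure_bounded_finite[of S]
      by (intro integrable_scaleR_left integrable_real_indicator) (simp_all add: S_def)
    show "AE x in lborel. norm (d m x) \<le> indicator S x *\<^sub>R B" for m
      using bound by (intro AE_I2)
    show "AE x in lborel. (\<lambda>m. d m x) \<longlonglongrightarrow> g' x e"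
    proof (rule AE_I2)
      fix x
      have "((\<lambda>s. g (x + s *\<^sub>R e)) has_vector_derivative g' x e) (at 0)"
        using vderiv[of x 0] by simp
      then have "((\<lambda>s. norm (g (x + s *\<^sub>R e) - g x - s *\<^sub>R g' x e) / norm s) \<longlongrightarrow> 0) (at 0)"
        unfolding has_vector_derivative_def has_derivative_at by simp
      then have "((\<lambda>s. norm (inverse s *\<^sub>R (g (x + s *\<^sub>R e) - g x) - g' x e)) \<longlongrightarrow> 0) (at 0)"
      proof (rule Lim_transform_eventually)
        have "norm (g (x + s *\<^sub>R e) - g x - s *\<^sub>R g' x e) / norm s
            = norm (inverse s *\<^sub>R (g (x + s *\<^sub>R e) - g x) - g' x e)" if "s \<noteq> 0" for s
        proof -
          have "inverse s *\<^sub>R (g (x + s *\<^sub>R e) - g x) - g' x e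
              = inverse s *\<^sub>R (g (x + s *\<^sub>R e) - g x - s *\<^sub>R g' x e)"
            using that by (simp add: scaleR_diff_right)
          then show ?thesis using that by (simp add: divide_inverse mult.commute del: scaleR_diff_right)
        qed
        then show "\<forall>\<^sub>F s in at 0. norm (g (x + s *\<^sub>R e) - g x - s *\<^sub>R g' x e) / norm s
            = norm (inverse s *\<^sub>R (g (x + s *\<^sub>R e) - g x) - g' x e)"
          by (auto simp: eventually_at_filter)
      qed
      then have lim: "((\<lambda>s. inverse s *\<^sub>R (g (x + s *\<^sub>R e) - g x)) \<longlongrightarrow> g' x e) (at 0)"
        by (rule LIM_zero_cancel[OF tendsto_norm_zero_cancel])
      have "filterlim t (at 0) sequentially"
        unfolding t_def by (intro filterlim_atI LIMSEQ_inverse_real_of_nat) auto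
      from filterlim_compose[OF lim this] show "(\<lambda>m. d m x) \<longlonglongrightarrow> g' x e" by (simp add: d_def)
    qed
    show "d m \<in> borel_measurable lborel" for m unfolding d_def by measurable
  qed simp
  then show ?thesis by (simp add: d0 LIMSEQ_const_iff)
qed

section \<open>Plane waves\<close>

definition plane_wave :: "real^'n \<Rightarrow> real^'n \<Rightarrow> complex" where
  "plane_wave \<xi> x = cis (\<xi> \<bullet> x)"

lemma norm_plane_wave [simp]: "cmod (plane_wave \<xi> x) = 1"
  by (simp add: plane_wave_def)

lemma plane_wave_mult_cnj [simp]: "plane_wave \<xi> x * cnj (plane_wave \<xi> x) = 1"
  by (simp add: complex_norm_square[symmetric])

lemma continuous_on_plane_wave [continuous_intros]: "continuous_on S (plane_wave \<xi>)"
  unfolding plane_wave_def by (intro continuous_intros)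

lemma plane_wave_has_derivative:
  "(plane_wave \<xi> has_derivative (\<lambda>v. (\<i> * complex_of_real (\<xi> \<bullet> v)) * plane_wave \<xi> x)) (at x)"
proof -
  have "((\<lambda>x. \<i> * complex_of_real (\<xi> \<bullet> x)) has_derivative (\<lambda>v. \<i> * complex_of_real (\<xi> \<bullet> v))) (at x)"
    by (auto intro!: derivative_eq_intros)
  from has_derivative_compose[OF this DERIV_exp[unfolded has_field_derivative_def]]
  show ?thesis by (simp add: plane_wave_def[abs_def] cis_conv_exp mult.commute)
qed

text \<open>The product of the plane wave and \<open>\<phi>\<close> has compact support in \<open>\<Omega>\<close>, so its derivative along \<open>e\<close> has
  integral 0.\<close>

lemma plane_wave_integration_by_parts:
  assumes \<phi>: "test_function \<Omega> \<phi>" and "open \<Omega>"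
  shows "(\<integral>x. plane_wave \<xi> x * complex_of_real (frechet_derivative \<phi> (at x) e) \<partial>lebesgue_on \<Omega>)
    = - (\<integral>x. (\<i> * complex_of_real (\<xi> \<bullet> e) * plane_wave \<xi> x) * complex_of_real (\<phi> x) \<partial>lebesgue_on \<Omega>)"
proof -
  obtain K where K: "compact K" "K \<subseteq> \<Omega>" "\<And>x. x \<notin> K \<Longrightarrow> \<phi> x = 0"
    using \<phi> by (auto simp: test_function_def)
  note d\<phi> = test_function_differentiable[OF \<phi>]
  let ?u = "\<lambda>x. plane_wave \<xi> x * complex_of_real (frechet_derivative \<phi> (at x) e)"
  let ?v = "\<lambda>x. (\<i> * complex_of_real (\<xi> \<bullet> e) * plane_wave \<xi> x) * complex_of_real (\<phi> x)"
  have outside: "frechet_derivative \<phi> (at x) e = 0" if "x \<notin> K" for x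
  proof -
    have "(\<phi> has_derivative (\<lambda>_. 0)) (at x)"
      by (rule has_derivative_transform_within_open[of "\<lambda>_. 0" _ _ _ "- K"])
        (use that K compact_imp_closed in auto)
    from has_derivative_unique[OF d\<phi>(1) this] show ?thesis by (metis)
  qed
  have cont: "continuous_on UNIV ?u" "continuous_on UNIV ?v"
    by (intro continuous_intros d\<phi>)+
  have int: "integrable lborel ?u" "integrable lborel ?v"
    using cont K outside by (auto intro!: integrable_compactly_supported[OF _ K(1)])
  have restrict: "(\<integral>x. w x \<partial>lebesgue_on \<Omega>) = (LINT x|lborel. w x)"
    if "continuous_on UNIV w" "\<And>x. x \<notin> K \<Longrightarrow> w x = 0" for w :: "real^'a \<Rightarrow> complex"
  proof -
    have "(\<integral>x. w x \<partial>lebesgue_on \<Omega>) = (LINT x|lebesgue. indicat_real \<Omega> x *\<^sub>R w x)"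
      using \<open>open \<Omega>\<close> by (intro integral_restrict_space) auto
    also have "\<dots> = (LINT x|lebesgue. w x)"
      using that(2) K(2) by (intro Bochner_Integration.integral_cong) (auto simp: indicator_def)
    also have "\<dots> = (LINT x|lborel. w x)"
      using that(1) by (intro integral_completion) (auto intro: borel_measurable_continuous_onI)
    finally show ?thesis .
  qed
  have "(LINT x|lborel. ?u x + ?v x) = 0"
  proof (rule integral_directional_derivative_eq_0[of "\<lambda>x. plane_wave \<xi> x * complex_of_real (\<phi> x)"
        "\<lambda>x v. plane_wave \<xi> x * complex_of_real (frechet_derivative \<phi> (at x) v)
            + (\<i> * complex_of_real (\<xi> \<bullet> v) * plane_wave \<xi> x) * complex_of_real (\<phi> x)" e K])
    show "((\<lambda>x. plane_wave \<xi> x * complex_of_real (\<phi> x)) has_derivative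
        (\<lambda>v. plane_wave \<xi> x * complex_of_real (frechet_derivative \<phi> (at x) v)
            + (\<i> * complex_of_real (\<xi> \<bullet> v) * plane_wave \<xi> x) * complex_of_real (\<phi> x))) (at x)" for x
      by (intro has_derivative_mult plane_wave_has_derivative has_derivative_of_real d\<phi>)
  qed (use cont K in \<open>auto intro: continuous_on_add\<close>)
  then have "(LINT x|lborel. ?u x) = - (LINT x|lborel. ?v x)"
    using int by (simp add: add_eq_0_iff2)
  then show ?thesis
    using restrict[OF cont(1)] restrict[OF cont(2)] outside K(3) by simp
qed

section \<open>Boundary values of continuous functions\<close>

lemma mean_value_tendsto:
  fixes g :: "real^'n \<Rightarrow> real"
  assumes g: "continuous_on UNIV g" and "open \<Omega>" and x: "x \<in> closure \<Omega>"
  shows "((\<lambda>r. (\<integral>y. g y \<partial>lebesgue_on (ball x r \<inter> \<Omega>)) / measure lebesgue (ball x r \<inter> \<Omega>)) \<longlongrightarrow> g x) (at_right 0)"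
proof (rule tendstoI)
  fix e :: real assume "0 < e"
  define e2 where "e2 = e / 2"
  have e2: "0 < e2" "e2 < e" using \<open>0 < e\<close> by (auto simp: e2_def)
  have "isCont g x" using g by (simp add: continuous_on_eq_continuous_at)
  then obtain d where d: "0 < d" "\<And>y. dist y x < d \<Longrightarrow> dist (g y) (g x) < e2"
    using e2 unfolding continuous_at_eps_delta by (auto simp: dist_commute)
  have "dist ((\<integral>y. g y \<partial>lebesgue_on (ball x r \<inter> \<Omega>)) / measure lebesgue (ball x r \<inter> \<Omega>)) (g x) < e"
    if r: "0 < r" "r < d" for r
  proof -
    define B where "B = ball x r \<inter> \<Omega>"
    have "open B" using \<open>open \<Omega>\<close> by (auto simp: B_def)
    obtain y where "y \<in> \<Omega>" "dist y x < r" using x r(1) by (auto simp: closure_approachable)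
    then have "B \<noteq> {}" by (auto simp: B_def dist_commute)
    have Bm: "B \<in> lmeasurable"
      using \<open>open B\<close> by (intro lmeasurable_open) (auto simp: B_def)
    have pos: "0 < measure lebesgue B"
    proof -
      have "\<not> negligible B" using open_not_negligible[OF \<open>open B\<close> \<open>B \<noteq> {}\<close>] .
      then show ?thesis using Bm by (simp add: negligible_iff_measure zero_less_measure_iff)
    qed
    have meas: "g \<in> borel_measurable (lebesgue_on B)"
      using g by (intro measurable_restrict_space1 measurable_completion) (auto intro: borel_measurable_continuous_onI)
    have near: "\<bar>g y - g x\<bar> \<le> e2" if "y \<in> B" for y
      using d(2)[of y] that r by (auto simp: B_def dist_real_def dist_commute less_imp_le)
    interpret finite_measure "lebesgue_on B"
      using Bm by (intro finite_measure_lebesgue_on)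
    have int: "integrable (lebesgue_on B) (\<lambda>y. g y - g x)"
      using meas near by (intro integrable_const_bound[of _ e2]) auto
    then have int_g: "integrable (lebesgue_on B) g"
      using Bochner_Integration.integrable_add[OF int, of "\<lambda>_. g x"] by simp
    have space: "measure (lebesgue_on B) (space (lebesgue_on B)) = measure lebesgue B"
      using Bm by (simp add: measure_restrict_space)
    have "\<bar>(\<integral>y. g y - g x \<partial>lebesgue_on B)\<bar> \<le> (\<integral>y. \<bar>g y - g x\<bar> \<partial>lebesgue_on B)"
      by (rule integral_abs_bound)
    also have "\<dots> \<le> (\<integral>y. e2 \<partial>lebesgue_on B)"
      using int near by (intro integral_mono) auto
    also have "\<dots> = e2 * measure lebesgue B" using space by simp
    also have "(\<integral>y. g y - g x \<partial>lebesgue_on B) = (\<integral>y. g y \<partial>lebesgue_on B) - g x * measure lebesgue B"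
      using int_g space by simp
    finally have "\<bar>(\<integral>y. g y \<partial>lebesgue_on B) / measure lebesgue B - g x\<bar> \<le> e2"
      using pos by (simp add: abs_le_iff field_simps)
    then show ?thesis using e2 by (simp add: B_def dist_real_def)
  qed
  then show "\<forall>\<^sub>F r in at_right 0. dist ((\<integral>y. g y \<partial>lebesgue_on (ball x r \<inter> \<Omega>))
      / measure lebesgue (ball x r \<inter> \<Omega>)) (g x) < e"
    using d(1) by (auto simp: eventually_at_right_field)
qed

text \<open>The mean values of \<open>\<bar>w - z\<bar>\<close> tend to \<open>\<bar>w x - z\<bar>\<close>, which gives existence and uniqueness at once.\<close>

lemma has_boundary_value_continuous_iff:
  assumes "continuous_on UNIV w" and "open \<Omega>" and "x \<in> frontier \<Omega>"
  shows "has_boundary_value \<Omega> w x z \<longleftrightarrow> z = w x"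
proof -
  have "((\<lambda>r. (\<integral>y. cmod (w y - z) \<partial>lebesgue_on (ball x r \<inter> \<Omega>)) / measure lebesgue (ball x r \<inter> \<Omega>))
      \<longlongrightarrow> cmod (w x - z)) (at_right 0)"
    using assms by (intro mean_value_tendsto continuous_intros) (auto simp: frontier_def)
  then have "has_boundary_value \<Omega> w x z \<longleftrightarrow> cmod (w x - z) = 0"
    unfolding has_boundary_value_def
    by (auto dest: tendsto_unique[OF trivial_limit_at_right_real])
  then show ?thesis by auto
qed

lemma boundary_value_continuous:
  assumes "continuous_on UNIV w" and "open \<Omega>" and "x \<in> frontier \<Omega>"
  shows "boundary_value \<Omega> w x = w x"
  unfolding boundary_value_def
  by (rule the_equality) (simp_all add: has_boundary_value_continuous_iff[OF assms])

lemma space_surface_measure [simp]: "space (surface_measure \<Omega>) = frontier \<Omega>"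
  by (simp add: surface_measure_def space_restrict_space space_measure_of_conv)

lemma continuous_measurable_surface_measure:
  assumes "continuous_on UNIV (w :: real^'n \<Rightarrow> complex)"
  shows "w \<in> borel_measurable (surface_measure \<Omega>)"
proof -
  have "sets (measure_of (UNIV :: (real^'n) set) (sets borel) hausdorff_codim1) = sets borel"
    by (simp add: sets_measure_of_conv sets.sigma_sets_eq[of borel, simplified])
  from measurable_cong_sets[OF this refl] show ?thesis
    unfolding surface_measure_def
    using assms by (intro measurable_restrict_space1) (auto intro: borel_measurable_continuous_onI)
qed

section \<open>The Robin form\<close>

text \<open>A function that is not integrable has integral 0 by convention.\<close>

lemma Re_integral_nonneg:
  fixes f :: "'a \<Rightarrow> complex"
  assumes "AE x in M. 0 \<le> Re (f x)"
  shows "0 \<le> Re (\<integral>x. f x \<partial>M)"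
proof (cases "integrable M f")
  case True
  then have "Re (\<integral>x. f x \<partial>M) = (\<integral>x. Re (f x) \<partial>M)" by simp
  then show ?thesis using assms by (simp add: integral_nonneg_AE)
qed (simp add: not_integrable_integral_eq)

lemma Re_integral_diff_nonneg:
  fixes f g h :: "'a \<Rightarrow> complex"
  assumes "integrable M f" "integrable M g" "integrable M h"
    and "AE x in M. 0 \<le> Re (f x) - 2 * Re (g x) + Re (h x)"
  shows "0 \<le> Re (\<integral>x. f x \<partial>M) - 2 * Re (\<integral>x. g x \<partial>M) + Re (\<integral>x. h x \<partial>M)"
proof -
  have "0 \<le> (\<integral>x. Re (f x) - 2 * Re (g x) + Re (h x) \<partial>M)"
    using assms(4) by (rule integral_nonneg_AE)
  then show ?thesis using assms(1-3) by simp
qed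

lemma Re_mult_cnj_diff: "Re (a * cnj a) - 2 * Re (a * cnj b) + Re (b * cnj b) = (cmod (a - b))\<^sup>2"
  by (simp only: cmod_power2) (simp add: power2_eq_square algebra_simps)

text \<open>This is the case in which the right-hand side of the main inequality is finite: \<open>A\<close> is
  square-integrable, \<open>V\<close> is integrable and the surface area is finite. Then every plane wave lies in
  the form domain, and boundary traces are taken with the phase factor 1.\<close>

locale robin_form_data =
  fixes \<Omega> :: "(real^'n) set" and A :: "real^'n \<Rightarrow> real^'n" and V \<sigma> :: "real^'n \<Rightarrow> real"
  assumes open_\<Omega>: "open \<Omega>" and bounded_\<Omega>: "bounded \<Omega>"
    and A_meas: "A \<in> borel_measurable (lebesgue_on \<Omega>)"
    and A_sq: "integrable (lebesgue_on \<Omega>) (\<lambda>x. (norm (A x))\<^sup>2)"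
    and V_nonneg: "AE x in lebesgue_on \<Omega>. 0 \<le> V x"
    and V_int: "integrable (lebesgue_on \<Omega>) V"
    and \<sigma>_meas: "\<sigma> \<in> borel_measurable (surface_measure \<Omega>)"
    and \<sigma>_bounded: "Linf_norm (surface_measure \<Omega>) \<sigma> < \<infinity>"
    and \<sigma>_pos: "AE x in surface_measure \<Omega>. 0 < \<sigma> x"
    and Ar_finite: "Ar \<Omega> < \<infinity>"
begin

abbreviation "L \<equiv> lebesgue_on \<Omega>"
abbreviation "S \<equiv> surface_measure \<Omega>"
abbreviation "D \<equiv> robin_form_domain \<Omega> A V"
abbreviation "q \<equiv> robin_form \<Omega> A V \<sigma>"

lemma \<Omega>_lmeasurable: "\<Omega> \<in> lmeasurable"
  using lmeasurable_open bounded_\<Omega> open_\<Omega> by blast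

sublocale finite_measure L
  by (rule finite_measure_lebesgue_on[OF \<Omega>_lmeasurable])

lemma continuous_imp_measurable_L:
  fixes w :: "real^'n \<Rightarrow> 'b::{second_countable_topology, t2_space}"
  shows "continuous_on UNIV w \<Longrightarrow> w \<in> borel_measurable L"
  by (intro measurable_restrict_space1 measurable_completion) (auto intro: borel_measurable_continuous_onI)

lemma phase [simp]: "boundary_phase \<Omega> A = (\<lambda>_. 1)"
  using A_sq by (simp add: boundary_phase_def)

lemma L2_const: "(\<lambda>x. c) \<in> L2 L"
  by (simp add: L2_def)

lemma L2_imp_integrable: "u \<in> L2 L \<Longrightarrow> integrable L u"
  using L2_integrable_mult[OF _ L2_const[of 1]] by simp

lemma plane_wave_L2: "plane_wave \<xi> \<in> L2 L"
  by (simp add: L2_def continuous_imp_measurable_L continuous_on_plane_wave)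

lemma A_component_L2: "(\<lambda>x. complex_of_real (A x $ i)) \<in> L2 L"
proof -
  have [measurable]: "(\<lambda>x. A x $ i) \<in> borel_measurable L"
    using A_meas by (rule measurable_compose) (simp add: borel_measurable_continuous_onI continuous_on_component)
  have "integrable L (\<lambda>x. (A x $ i)\<^sup>2)"
  proof (rule Bochner_Integration.integrable_bound[OF A_sq])
    show "AE x in L. norm ((A x $ i)\<^sup>2) \<le> norm ((norm (A x))\<^sup>2)"
      using component_le_norm_cart[of "A _" i] by (intro AE_I2) (simp add: power_mono abs_le_square_iff[symmetric])
  qed measurable
  then show ?thesis by (simp add: L2_def)
qed

lemma A_integrable: "integrable L A"
proof (rule Bochner_Integration.integrable_bound[of _ "\<lambda>x. 1 + (norm (A x))\<^sup>2"])
  show "integrable L (\<lambda>x. 1 + (norm (A x))\<^sup>2)" using A_sq by simp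
  have "t \<le> 1 + t\<^sup>2" for t :: real
  proof -
    have "2 * t \<le> 1 + t\<^sup>2" using sum_squares_bound[of 1 t] by simp
    moreover have "0 \<le> 1 + t\<^sup>2" by simp
    ultimately show ?thesis by linarith
  qed
  then show "AE x in L. norm (A x) \<le> norm (1 + (norm (A x))\<^sup>2)"
    by (intro AE_I2) (simp add: abs_of_nonneg)
qed (rule A_meas)

lemma magnetic_gradient_component_L2:
  "is_magnetic_gradient \<Omega> A u G \<Longrightarrow> (\<lambda>x. G x $ i) \<in> L2 L"
  by (simp add: is_magnetic_gradient_def)

lemma integrable_mult_test_function:
  assumes w: "integrable L w" and \<phi>: "test_function \<Omega> \<phi>"
  shows "integrable L (\<lambda>x. w x * complex_of_real (\<phi> x))"
proof -
  note cont = test_function_differentiable(3)[OF \<phi>]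
  obtain K where K: "compact K" "\<And>x. x \<notin> K \<Longrightarrow> \<phi> x = 0" using \<phi> by (auto simp: test_function_def)
  have "bounded (\<phi> ` K)"
    by (intro compact_imp_bounded compact_continuous_image continuous_on_subset[OF cont] K) auto
  then obtain B where "\<forall>y\<in>\<phi> ` K. \<bar>y\<bar> \<le> B" unfolding bounded_iff real_norm_def by blast
  then have B: "\<bar>\<phi> x\<bar> \<le> \<bar>B\<bar>" for x using K(2) by (cases "x \<in> K") force+
  show ?thesis
  proof (rule Bochner_Integration.integrable_bound[of _ "\<lambda>x. \<bar>B\<bar> * norm (w x)"])
    show "integrable L (\<lambda>x. \<bar>B\<bar> * norm (w x))" using w by simp
    show "AE x in L. norm (w x * complex_of_real (\<phi> x)) \<le> norm (\<bar>B\<bar> * norm (w x))"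
      using B by (intro AE_I2) (simp add: norm_mult mult.commute mult_right_mono)
    show "(\<lambda>x. w x * complex_of_real (\<phi> x)) \<in> borel_measurable L"
      using borel_measurable_integrable[OF w] continuous_imp_measurable_L[OF cont] by measurable
  qed
qed

text \<open>Both gradients satisfy the same distributional identity, so the components of their difference
  are orthogonal to all test functions.\<close>

lemma magnetic_gradient_unique:
  assumes u: "u \<in> L2 L" and G: "is_magnetic_gradient \<Omega> A u G" and G': "is_magnetic_gradient \<Omega> A u G'"
  shows "AE x in L. G x = G' x"
proof -
  have "AE x in L. G x $ i - G' x $ i = 0" for i
  proof (rule AE_eq_0_if_orthogonal_to_test_functions[OF _ open_\<Omega>])
    note L2 = magnetic_gradient_component_L2[OF G] magnetic_gradient_component_L2[OF G']
    show "integrable L (\<lambda>x. G x $ i - G' x $ i)"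
      using L2 by (intro Bochner_Integration.integrable_diff L2_imp_integrable)
    fix \<phi> assume \<phi>: "test_function \<Omega> \<phi>"
    have Au: "integrable L (\<lambda>x. \<i> * complex_of_real (A x $ i) * u x)"
      using L2_integrable_mult[OF A_component_L2 u] by (simp add: mult.assoc)
    have int: "integrable L (\<lambda>x. (F x $ i + \<i> * complex_of_real (A x $ i) * u x) * complex_of_real (\<phi> x))"
      if "(\<lambda>x. F x $ i) \<in> L2 L" for F :: "real^'n \<Rightarrow> complex^'n"
      by (intro integrable_mult_test_function[OF _ \<phi>] Bochner_Integration.integrable_add Au
          L2_imp_integrable[OF that])
    have parts: "(\<integral>x. u x * complex_of_real (frechet_derivative \<phi> (at x) (axis i 1)) \<partial>L)
        = - (\<integral>x. (F x $ i + \<i> * complex_of_real (A x $ i) * u x) * complex_of_real (\<phi> x) \<partial>L)"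
      if "is_magnetic_gradient \<Omega> A u F" for F
      using that \<phi> unfolding is_magnetic_gradient_def by blast
    have "(\<integral>x. (G x $ i + \<i> * complex_of_real (A x $ i) * u x) * complex_of_real (\<phi> x) \<partial>L)
        = (\<integral>x. (G' x $ i + \<i> * complex_of_real (A x $ i) * u x) * complex_of_real (\<phi> x) \<partial>L)"
      using trans[OF sym[OF parts[OF G]] parts[OF G']] by (simp only: neg_equal_iff_equal)
    then have "(\<integral>x. (G x $ i + \<i> * complex_of_real (A x $ i) * u x) * complex_of_real (\<phi> x)
        - (G' x $ i + \<i> * complex_of_real (A x $ i) * u x) * complex_of_real (\<phi> x) \<partial>L) = 0"
      using int[OF L2(1)] int[OF L2(2)] by (subst Bochner_Integration.integral_diff) auto
    then show "(\<integral>x. (G x $ i - G' x $ i) * complex_of_real (\<phi> x) \<partial>L) = 0"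
      by (simp add: algebra_simps)
  qed
  then have "AE x in L. \<forall>i\<in>UNIV. G x $ i - G' x $ i = 0" by (intro AE_finite_allI) auto
  then show ?thesis by eventually_elim (simp add: vec_eq_iff)
qed

lemma magnetic_gradient_AE_eq:
  assumes u: "u \<in> L2 L" and G: "is_magnetic_gradient \<Omega> A u G"
  shows "AE x in L. magnetic_gradient \<Omega> A u x = G x"
  using magnetic_gradient_unique[OF u _ G] someI[of "is_magnetic_gradient \<Omega> A u", OF G]
  by (simp add: magnetic_gradient_def)

lemma magnetic_gradient_D_L2:
  assumes "u \<in> D"
  shows "(\<lambda>x. magnetic_gradient \<Omega> A u x $ i) \<in> L2 L"
proof -
  obtain G where "is_magnetic_gradient \<Omega> A u G" using assms by (auto simp: robin_form_domain_def)
  from someI[of "is_magnetic_gradient \<Omega> A u", OF this]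
  show ?thesis unfolding magnetic_gradient_def by (rule magnetic_gradient_component_L2)
qed

lemma boundary_trace_D_L2: "u \<in> D \<Longrightarrow> boundary_trace \<Omega> A u \<in> L2 S"
  by (simp add: robin_form_domain_def has_L2_trace_def boundary_trace_def[abs_def])

lemma \<sigma>_le: "AE x in S. \<bar>\<sigma> x\<bar> \<le> enn2real (Linf_norm S \<sigma>)"
proof -
  have "AE x in S. ennreal (norm (\<sigma> x)) \<le> Linf_norm S \<sigma>"
    unfolding Linf_norm_def by (rule esssup_AE)
  then show ?thesis
  proof eventually_elim
    case (elim x)
    then have "enn2real (ennreal (norm (\<sigma> x))) \<le> enn2real (Linf_norm S \<sigma>)"
      using \<sigma>_bounded by (intro enn2real_mono) auto
    then show ?case by simp
  qed
qed

lemma boundary_integrable: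
  assumes f: "f \<in> L2 S" and g: "g \<in> L2 S"
  shows "integrable S (\<lambda>x. complex_of_real (\<sigma> x) * f x * cnj (g x))"
proof (rule Bochner_Integration.integrable_bound)
  show "integrable S (\<lambda>x. complex_of_real (enn2real (Linf_norm S \<sigma>)) * (f x * cnj (g x)))"
    using L2_integrable_inner[OF f g] by simp
  show "(\<lambda>x. complex_of_real (\<sigma> x) * f x * cnj (g x)) \<in> borel_measurable S"
    using f g \<sigma>_meas by measurable
  show "AE x in S. norm (complex_of_real (\<sigma> x) * f x * cnj (g x))
      \<le> norm (complex_of_real (enn2real (Linf_norm S \<sigma>)) * (f x * cnj (g x)))"
    using \<sigma>_le by eventually_elim (simp add: norm_mult mult.assoc mult_right_mono)
qed

lemma V_meas: "V \<in> borel_measurable L"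
  using V_int by (rule borel_measurable_integrable)

lemma potential_integrable:
  assumes u: "(\<lambda>x. complex_of_real (sqrt (V x)) * u x) \<in> L2 L" and v: "(\<lambda>x. complex_of_real (sqrt (V x)) * v x) \<in> L2 L"
    and "u \<in> L2 L" "v \<in> L2 L"
  shows "integrable L (\<lambda>x. complex_of_real (V x) * u x * cnj (v x))"
proof (rule Bochner_Integration.integrable_bound[OF L2_integrable_inner[OF u v]])
  show "(\<lambda>x. complex_of_real (V x) * u x * cnj (v x)) \<in> borel_measurable L"
    using assms V_meas by measurable
  show "AE x in L. norm (complex_of_real (V x) * u x * cnj (v x))
      \<le> norm (complex_of_real (sqrt (V x)) * u x * cnj (complex_of_real (sqrt (V x)) * v x))"
    using V_nonneg
  proof eventually_elim
    case (elim x)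
    have "sqrt (V x) * (a * (sqrt (V x) * b)) = V x * (a * b)" for a b
    proof -
      have "sqrt (V x) * (a * (sqrt (V x) * b)) = (sqrt (V x) * sqrt (V x)) * (a * b)"
        by (simp only: mult_ac)
      then show ?thesis using elim by (simp only: real_sqrt_mult_self abs_of_nonneg)
    qed
    moreover have "norm (complex_of_real (V x) * u x * cnj (v x)) = V x * (cmod (u x) * cmod (v x))"
      using elim by (simp add: norm_mult mult.assoc)
    moreover have "norm (complex_of_real (sqrt (V x)) * u x * cnj (complex_of_real (sqrt (V x)) * v x))
        = sqrt (V x) * (cmod (u x) * (sqrt (V x) * cmod (v x)))"
      using elim by (simp add: norm_mult mult.assoc)
    ultimately show ?case by (simp only: order_refl)
  qed
qed

lemma D_L2: "D \<subseteq> L2 L"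
  by (auto simp: robin_form_domain_def)

lemma q_hermitian: "q v u = cnj (q u v)"
  unfolding robin_form_def
  by (simp add: Bochner_Integration.integral_cnj[symmetric] mult_ac del: Bochner_Integration.integral_cnj)

lemma q_nonneg: "0 \<le> Re (q u u)"
proof -
  have sq: "Re (complex_of_real r * z * cnj z) = r * (cmod z)\<^sup>2" for r z
    by (simp add: mult.assoc complex_norm_square[symmetric] del: of_real_power)
  have sq1: "Re (z * cnj z) = (cmod z)\<^sup>2" for z using sq[of 1 z] by simp
  have "0 \<le> Re (\<integral>x. (\<Sum>i\<in>UNIV. magnetic_gradient \<Omega> A u x $ i * cnj (magnetic_gradient \<Omega> A u x $ i)) \<partial>L)"
    by (intro Re_integral_nonneg AE_I2) (simp only: Re_sum sq1 sum_nonneg zero_le_power2)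
  moreover have "0 \<le> Re (\<integral>x. complex_of_real (V x) * u x * cnj (u x) \<partial>L)"
    by (rule Re_integral_nonneg) (use V_nonneg in \<open>eventually_elim, simp only: sq, simp\<close>)
  moreover have "0 \<le> Re (\<integral>x. complex_of_real (\<sigma> x) * boundary_trace \<Omega> A u x * cnj (boundary_trace \<Omega> A u x) \<partial>S)"
    by (rule Re_integral_nonneg) (use \<sigma>_pos in \<open>eventually_elim, simp only: sq, simp\<close>)
  ultimately show ?thesis by (simp add: robin_form_def)
qed

text \<open>With \<open>G\<close> and \<open>t\<close> for magnetic gradient and trace, the expression is the integral of
  \<open>\<bar>G u - G v\<bar>\<^sup>2 + V \<bar>u - v\<bar>\<^sup>2\<close> over \<open>\<Omega>\<close> plus that of \<open>\<sigma> \<bar>t u - t v\<bar>\<^sup>2\<close> over the boundary.\<close>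

lemma q_diff_nonneg:
  assumes u: "u \<in> D" and v: "v \<in> D"
  shows "0 \<le> Re (q u u) - 2 * Re (q u v) + Re (q v v)"
proof -
  let ?G = "magnetic_gradient \<Omega> A" and ?t = "boundary_trace \<Omega> A"
  have int_G: "integrable L (\<lambda>x. \<Sum>i\<in>UNIV. ?G u x $ i * cnj (?G v x $ i))" if "u \<in> D" "v \<in> D" for u v
    using that by (intro Bochner_Integration.integrable_sum L2_integrable_inner magnetic_gradient_D_L2)
  have int_V: "integrable L (\<lambda>x. complex_of_real (V x) * u x * cnj (v x))" if "u \<in> D" "v \<in> D" for u v
    using that by (intro potential_integrable) (auto simp: robin_form_domain_def)
  have int_t: "integrable S (\<lambda>x. complex_of_real (\<sigma> x) * ?t u x * cnj (?t v x))" if "u \<in> D" "v \<in> D" for u v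
    using that by (intro boundary_integrable boundary_trace_D_L2)
  have weighted: "Re (complex_of_real r * a * cnj a) - 2 * Re (complex_of_real r * a * cnj b)
      + Re (complex_of_real r * b * cnj b) = r * (cmod (a - b))\<^sup>2" for r a b
  proof -
    have "r * (Re (a * cnj a) - 2 * Re (a * cnj b) + Re (b * cnj b)) = r * (cmod (a - b))\<^sup>2"
      by (simp only: Re_mult_cnj_diff)
    then show ?thesis by (simp add: algebra_simps)
  qed
  have "0 \<le> Re (\<integral>x. (\<Sum>i\<in>UNIV. ?G u x $ i * cnj (?G u x $ i)) \<partial>L)
      - 2 * Re (\<integral>x. (\<Sum>i\<in>UNIV. ?G u x $ i * cnj (?G v x $ i)) \<partial>L)
      + Re (\<integral>x. (\<Sum>i\<in>UNIV. ?G v x $ i * cnj (?G v x $ i)) \<partial>L)"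
  proof (intro Re_integral_diff_nonneg int_G u v AE_I2)
    fix x
    have "Re (\<Sum>i\<in>UNIV. ?G u x $ i * cnj (?G u x $ i)) - 2 * Re (\<Sum>i\<in>UNIV. ?G u x $ i * cnj (?G v x $ i))
        + Re (\<Sum>i\<in>UNIV. ?G v x $ i * cnj (?G v x $ i)) = (\<Sum>i\<in>UNIV. (cmod (?G u x $ i - ?G v x $ i))\<^sup>2)"
      by (simp only: Re_sum sum_distrib_left sum_subtractf[symmetric] sum.distrib[symmetric] Re_mult_cnj_diff)
    then show "0 \<le> Re (\<Sum>i\<in>UNIV. ?G u x $ i * cnj (?G u x $ i))
        - 2 * Re (\<Sum>i\<in>UNIV. ?G u x $ i * cnj (?G v x $ i)) + Re (\<Sum>i\<in>UNIV. ?G v x $ i * cnj (?G v x $ i))"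
      by (simp only: sum_nonneg zero_le_power2)
  qed
  moreover have "0 \<le> Re (\<integral>x. complex_of_real (V x) * u x * cnj (u x) \<partial>L)
      - 2 * Re (\<integral>x. complex_of_real (V x) * u x * cnj (v x) \<partial>L) + Re (\<integral>x. complex_of_real (V x) * v x * cnj (v x) \<partial>L)"
    by (intro Re_integral_diff_nonneg int_V u v) (use V_nonneg in \<open>eventually_elim, simp only: weighted, simp\<close>)
  moreover have "0 \<le> Re (\<integral>x. complex_of_real (\<sigma> x) * ?t u x * cnj (?t u x) \<partial>S)
      - 2 * Re (\<integral>x. complex_of_real (\<sigma> x) * ?t u x * cnj (?t v x) \<partial>S)
      + Re (\<integral>x. complex_of_real (\<sigma> x) * ?t v x * cnj (?t v x) \<partial>S)"
    by (intro Re_integral_diff_nonneg int_t u v) (use \<sigma>_pos in \<open>eventually_elim, simp only: weighted, simp\<close>)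
  ultimately show ?thesis unfolding robin_form_def plus_complex.sel distrib_left by linarith
qed

lemma boundary_trace_continuous:
  assumes "continuous_on UNIV w" and "x \<in> frontier \<Omega>"
  shows "boundary_trace \<Omega> A w x = w x"
  using boundary_value_continuous[OF assms(1) open_\<Omega> assms(2)] by (simp add: boundary_trace_def)

lemma q_zero: "q (\<lambda>x. 0) (\<lambda>x. 0) = 0"
proof -
  have "is_magnetic_gradient \<Omega> A (\<lambda>x. 0) (\<lambda>x. 0)" by (simp add: is_magnetic_gradient_def)
  from magnetic_gradient_AE_eq[OF L2_zero this]
  have "AE x in L. (\<Sum>i\<in>UNIV. magnetic_gradient \<Omega> A (\<lambda>x. 0) x $ i
      * cnj (magnetic_gradient \<Omega> A (\<lambda>x. 0) x $ i)) = 0"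
    by eventually_elim simp
  then have "(\<integral>x. (\<Sum>i\<in>UNIV. magnetic_gradient \<Omega> A (\<lambda>x. 0) x $ i * cnj (magnetic_gradient \<Omega> A (\<lambda>x. 0) x $ i)) \<partial>L) = 0"
    by (rule integral_eq_zero_AE)
  moreover have "(\<integral>x. complex_of_real (\<sigma> x) * boundary_trace \<Omega> A (\<lambda>x. 0) x * cnj (boundary_trace \<Omega> A (\<lambda>x. 0) x) \<partial>S) = 0"
    by (intro integral_eq_zero_AE AE_I2) (simp add: boundary_trace_continuous)
  ultimately show ?thesis by (simp add: robin_form_def)
qed

lemma plane_wave_magnetic_gradient:
  "is_magnetic_gradient \<Omega> A (plane_wave \<xi>)
     (\<lambda>x. \<chi> i. \<i> * complex_of_real (\<xi> $ i - A x $ i) * plane_wave \<xi> x)"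
  unfolding is_magnetic_gradient_def
proof (intro conjI allI impI)
  fix i
  have c: "(\<lambda>x. complex_of_real (\<xi> $ i) - complex_of_real (A x $ i)) \<in> L2 L"
    by (intro L2_diff L2_const A_component_L2)
  have [measurable]: "plane_wave \<xi> \<in> borel_measurable L" using plane_wave_L2 by (rule L2_measurable)
  have "(\<lambda>x. \<i> * complex_of_real (\<xi> $ i - A x $ i) * plane_wave \<xi> x) \<in> borel_measurable L"
    using L2_measurable[OF c] by (simp add: mult.assoc)
  then show "(\<lambda>x. (\<chi> i. \<i> * complex_of_real (\<xi> $ i - A x $ i) * plane_wave \<xi> x) $ i) \<in> L2 L"
    using L2_integrable_sq[OF c] by (simp add: L2_def norm_mult)
next
  fix \<phi> i assume \<phi>: "test_function \<Omega> \<phi>"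
  show "(\<integral>x. plane_wave \<xi> x * complex_of_real (frechet_derivative \<phi> (at x) (axis i 1)) \<partial>L) =
    - (\<integral>x. ((\<chi> i. \<i> * complex_of_real (\<xi> $ i - A x $ i) * plane_wave \<xi> x) $ i
          + \<i> * complex_of_real (A x $ i) * plane_wave \<xi> x) * complex_of_real (\<phi> x) \<partial>L)"
    unfolding plane_wave_integration_by_parts[OF \<phi> open_\<Omega>] by (simp add: inner_axis algebra_simps)
qed

lemma L2_plane_wave_S: "plane_wave \<xi> \<in> L2 S"
proof -
  have "finite_measure S"
    using Ar_finite by (intro finite_measureI) (simp add: Ar_def)
  then show ?thesis
    by (simp add: L2_def continuous_measurable_surface_measure continuous_on_plane_wave finite_measure.integrable_const)
qed

lemma plane_wave_D: "plane_wave \<xi> \<in> D"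
proof -
  have "(\<lambda>x. complex_of_real (sqrt (V x)) * plane_wave \<xi> x) \<in> L2 L"
  proof -
    have sq: "(sqrt t)\<^sup>2 = \<bar>t\<bar>" for t by (simp only: power2_eq_square real_sqrt_mult_self)
    have "integrable L (\<lambda>x. \<bar>V x\<bar>)" using V_int by simp
    then have "integrable L (\<lambda>x. (cmod (complex_of_real (sqrt (V x)) * plane_wave \<xi> x))\<^sup>2)"
      by (simp add: norm_mult power_mult_distrib sq)
    then show ?thesis using V_meas L2_measurable[OF plane_wave_L2] by (simp add: L2_def)
  qed
  moreover have "has_L2_trace \<Omega> (plane_wave \<xi>)"
  proof -
    have "boundary_value \<Omega> (plane_wave \<xi>) x = plane_wave \<xi> x" if "x \<in> space S" for x
      using that by (intro boundary_value_continuous continuous_on_plane_wave open_\<Omega>) simp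
    then have "boundary_value \<Omega> (plane_wave \<xi>) \<in> borel_measurable S \<longleftrightarrow> plane_wave \<xi> \<in> borel_measurable S"
      and "integrable S (\<lambda>x. (cmod (boundary_value \<Omega> (plane_wave \<xi>) x))\<^sup>2)
        \<longleftrightarrow> integrable S (\<lambda>x. (cmod (plane_wave \<xi> x))\<^sup>2)"
      by (auto intro!: measurable_cong Bochner_Integration.integrable_cong simp del: space_surface_measure norm_plane_wave)
    then have "boundary_value \<Omega> (plane_wave \<xi>) \<in> L2 S \<longleftrightarrow> plane_wave \<xi> \<in> L2 S"
      by (simp add: L2_def)
    moreover have "\<exists>z. has_boundary_value \<Omega> (plane_wave \<xi>) x z" if "x \<in> space S" for x
      using that has_boundary_value_continuous_iff[OF continuous_on_plane_wave open_\<Omega>, of x \<xi> "plane_wave \<xi> x"]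
      by (intro exI[of _ "plane_wave \<xi> x"]) simp
    ultimately show ?thesis
      unfolding has_L2_trace_def using L2_plane_wave_S by (intro conjI AE_I2) blast+
  qed
  ultimately show ?thesis
    using plane_wave_L2 plane_wave_magnetic_gradient by (auto simp: robin_form_domain_def)
qed

text \<open>A plane wave has modulus 1, so its magnetic gradient has modulus \<open>\<bar>\<xi> - A\<bar>\<close>, and the potential and
  boundary terms do not depend on \<open>\<xi>\<close>.\<close>

lemma q_plane_wave:
  "Re (q (plane_wave \<xi>) (plane_wave \<xi>)) = (norm \<xi>)\<^sup>2 * Vol \<Omega> - 2 * (\<xi> \<bullet> (\<integral>x. A x \<partial>L))
     + (\<integral>x. (norm (A x))\<^sup>2 \<partial>L) + (\<integral>x. V x \<partial>L) + (\<integral>x. \<sigma> x \<partial>S)"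
proof -
  let ?G = "magnetic_gradient \<Omega> A (plane_wave \<xi>)"
  have "(\<integral>x. (\<Sum>i\<in>UNIV. ?G x $ i * cnj (?G x $ i)) \<partial>L) = (\<integral>x. complex_of_real ((norm (\<xi> - A x))\<^sup>2) \<partial>L)"
  proof (rule integral_cong_AE)
    show "(\<lambda>x. \<Sum>i\<in>UNIV. ?G x $ i * cnj (?G x $ i)) \<in> borel_measurable L"
      using L2_integrable_inner[OF magnetic_gradient_D_L2[OF plane_wave_D] magnetic_gradient_D_L2[OF plane_wave_D]]
      by (intro borel_measurable_sum) auto
    show "(\<lambda>x. complex_of_real ((norm (\<xi> - A x))\<^sup>2)) \<in> borel_measurable L"
      using A_meas by measurable
    show "AE x in L. (\<Sum>i\<in>UNIV. ?G x $ i * cnj (?G x $ i)) = complex_of_real ((norm (\<xi> - A x))\<^sup>2)"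
      using magnetic_gradient_AE_eq[OF plane_wave_L2 plane_wave_magnetic_gradient[of \<xi>]]
    proof eventually_elim
      case (elim x)
      have "(\<i> * complex_of_real r * plane_wave \<xi> x) * cnj (\<i> * complex_of_real r * plane_wave \<xi> x)
          = complex_of_real (r\<^sup>2)" for r
        by (simp add: complex_norm_square[symmetric] norm_mult del: complex_cnj_mult of_real_power)
      then have "(\<Sum>i\<in>UNIV. ?G x $ i * cnj (?G x $ i)) = (\<Sum>i\<in>UNIV. complex_of_real ((\<xi> $ i - A x $ i)\<^sup>2))"
        unfolding elim by (simp only: vec_lambda_beta)
      also have "\<dots> = complex_of_real ((\<xi> - A x) \<bullet> (\<xi> - A x))"
        by (simp add: inner_vec_def power2_eq_square)
      finally show ?case by (simp only: power2_norm_eq_inner)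
    qed
  qed
  then have "Re (\<integral>x. (\<Sum>i\<in>UNIV. ?G x $ i * cnj (?G x $ i)) \<partial>L) = (\<integral>x. (norm (\<xi> - A x))\<^sup>2 \<partial>L)"
    by (simp only: integral_complex_of_real Re_complex_of_real)
  also have "\<dots> = (\<integral>x. (norm \<xi>)\<^sup>2 - 2 * (\<xi> \<bullet> A x) + (norm (A x))\<^sup>2 \<partial>L)"
    by (simp add: power2_norm_eq_inner inner_diff_left inner_diff_right inner_commute algebra_simps)
  also have "\<dots> = (norm \<xi>)\<^sup>2 * Vol \<Omega> - 2 * (\<xi> \<bullet> (\<integral>x. A x \<partial>L)) + (\<integral>x. (norm (A x))\<^sup>2 \<partial>L)"
    using A_integrable A_sq \<Omega>_lmeasurable
    by (simp add: Vol_def measure_restrict_space mult.commute)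
  finally have 1: "Re (\<integral>x. (\<Sum>i\<in>UNIV. ?G x $ i * cnj (?G x $ i)) \<partial>L)
      = (norm \<xi>)\<^sup>2 * Vol \<Omega> - 2 * (\<xi> \<bullet> (\<integral>x. A x \<partial>L)) + (\<integral>x. (norm (A x))\<^sup>2 \<partial>L)" .
  have 2: "(\<integral>x. complex_of_real (V x) * plane_wave \<xi> x * cnj (plane_wave \<xi> x) \<partial>L) = complex_of_real (\<integral>x. V x \<partial>L)"
    by (simp add: mult.assoc)
  have "(\<integral>x. complex_of_real (\<sigma> x) * boundary_trace \<Omega> A (plane_wave \<xi>) x
      * cnj (boundary_trace \<Omega> A (plane_wave \<xi>) x) \<partial>S) = (\<integral>x. complex_of_real (\<sigma> x) \<partial>S)"
    by (intro Bochner_Integration.integral_cong)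
      (auto simp: boundary_trace_continuous continuous_on_plane_wave mult.assoc)
  then have 3: "(\<integral>x. complex_of_real (\<sigma> x) * boundary_trace \<Omega> A (plane_wave \<xi>) x
      * cnj (boundary_trace \<Omega> A (plane_wave \<xi>) x) \<partial>S) = complex_of_real (\<integral>x. \<sigma> x \<partial>S)"
    by simp
  show ?thesis unfolding robin_form_def plus_complex.sel 1 2 3 by simp
qed

lemma \<sigma>_integral_le: "(\<integral>x. \<sigma> x \<partial>S) \<le> enn2real (Ar \<Omega>) * enn2real (Linf_norm S \<sigma>)"
proof -
  interpret S: finite_measure S
    using Ar_finite by (intro finite_measureI) (simp add: Ar_def)
  have "integrable S \<sigma>"
    using \<sigma>_le \<sigma>_meas by (intro S.integrable_const_bound[of _ "enn2real (Linf_norm S \<sigma>)"]) auto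
  then have "(\<integral>x. \<sigma> x \<partial>S) \<le> (\<integral>x. enn2real (Linf_norm S \<sigma>) \<partial>S)"
    by (rule integral_mono_AE) (use \<sigma>_le in \<open>auto elim: AE_mp\<close>)
  then show ?thesis by (simp add: Ar_def measure_def)
qed

end

section \<open>A bound for the Fourier transform\<close>

lemma lborel_integral_prod_Basis:
  fixes f :: "'a::euclidean_space \<Rightarrow> real \<Rightarrow> complex"
  assumes int: "\<And>b. b \<in> Basis \<Longrightarrow> integrable lborel (f b)"
  shows "(LINT x|lborel. (\<Prod>b\<in>Basis. f b (x \<bullet> b))) = (\<Prod>b\<in>Basis. LINT t|lborel. f b t)"
proof -
  interpret product_sigma_finite "\<lambda>_::'a. lborel :: real measure"
    by standard
  have [measurable]: "f b \<in> borel_measurable borel" if "b \<in> Basis" for b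
    using int[OF that] by (auto dest: borel_measurable_integrable)
  have "(LINT x|lborel. (\<Prod>b\<in>Basis. f b (x \<bullet> b)))
      = (LINT y|(\<Pi>\<^sub>M b\<in>Basis. lborel). (\<Prod>b\<in>Basis. f b ((\<Sum>c\<in>Basis. y c *\<^sub>R c) \<bullet> b)))"
    by (subst lborel_eq, subst integral_distr) auto
  also have "\<dots> = (LINT y|(\<Pi>\<^sub>M b\<in>Basis. lborel). (\<Prod>b\<in>Basis. f b (y b)))"
    by (intro Bochner_Integration.integral_cong prod.cong refl) simp
  also have "\<dots> = (\<Prod>b\<in>Basis. LINT t|lborel. f b t)"
    using int by (intro product_integral_prod) auto
  finally show ?thesis .
qed

lemma cis_sum: "cis (\<Sum>i\<in>I. f i) = (\<Prod>i\<in>I. cis (f i))"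
  by (induction I rule: infinite_finite_induct) (auto simp: cis_mult[symmetric])

lemma integrable_cis_interval: "integrable lborel (\<lambda>t. indicat_real {a..b} t *\<^sub>R cis (c * t))"
  by (rule borel_integrable_compact) (auto intro!: continuous_intros)

lemma integral_cis_period:
  fixes k :: int and r :: real
  assumes "0 < r" and "k \<noteq> 0"
  shows "(LINT t|lborel. indicat_real {-r..r} t *\<^sub>R cis (pi / r * of_int k * t)) = 0"
proof -
  define c where "c = pi / r * of_int k"
  have c: "c \<noteq> 0" using assms by (simp add: c_def)
  define F where "F = (\<lambda>t. cis (c * t) / (\<i> * complex_of_real c))"
  have "(LINT t|lborel. indicat_real {-r..r} t *\<^sub>R cis (c * t)) = F r - F (- r)"
  proof (rule integral_FTC_Icc)
    show "- r \<le> r" using assms by simp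
    show "continuous_on {-r..r} (\<lambda>t. cis (c * t))" by (intro continuous_intros)
    fix t
    have "((\<lambda>t. \<i> * complex_of_real (c * t)) has_vector_derivative \<i> * complex_of_real c) (at t within {-r..r})"
      by (auto intro!: derivative_eq_intros simp: has_vector_derivative_def scaleR_conv_of_real algebra_simps)
    from field_vector_diff_chain_within[OF this DERIV_exp[THEN has_field_derivative_at_within]]
    have "((\<lambda>t. exp (\<i> * complex_of_real (c * t))) has_vector_derivative
        \<i> * complex_of_real c * exp (\<i> * complex_of_real (c * t))) (at t within {-r..r})"
      by (simp add: o_def)
    from has_vector_derivative_divide[OF this, of "\<i> * complex_of_real c"]
    show "(F has_vector_derivative cis (c * t)) (at t within {-r..r})"
      using c by (simp add: F_def cis_conv_exp)
  qed
  also have "F r = F (- r)"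
  proof -
    have "c * r = pi * of_int k" using assms by (simp add: c_def)
    moreover have "cis (pi * of_int k) = cis (- (pi * of_int k))"
      by (simp add: complex_eq_iff sin_zero_iff_int2 mult.commute)
    ultimately show ?thesis by (simp add: F_def)
  qed
  finally show ?thesis by (simp add: c_def)
qed

text \<open>The frequencies of the plane waves that have period \<open>2 r\<close> in every coordinate.\<close>

definition lattice_point :: "real \<Rightarrow> ('n \<Rightarrow> int) \<Rightarrow> real^'n" where
  "lattice_point r n = (\<chi> i. pi / r * of_int (n i))"

abbreviation cube :: "real \<Rightarrow> (real^'n) set" where
  "cube r \<equiv> cbox (\<chi> i. - r) (\<chi> i. r)"

text \<open>The integral is a product over the coordinates, and a coordinate in which \<open>n\<close> and \<open>m\<close> differ
  contributes the integral of a nonconstant character over its period.\<close>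

lemma integral_plane_wave_cube:
  assumes r: "0 < r" and "n \<noteq> m"
  shows "(\<integral>x. plane_wave (lattice_point r n - lattice_point r m) x \<partial>lebesgue_on (cube r)) = 0"
proof -
  define \<xi> where "\<xi> = lattice_point r n - lattice_point r m"
  obtain j where j: "n j \<noteq> m j" using \<open>n \<noteq> m\<close> by blast
  have meas: "(\<lambda>x. indicat_real (cube r) x *\<^sub>R plane_wave \<xi> x) \<in> borel_measurable lborel"
    using borel_measurable_continuous_onI[OF continuous_on_plane_wave]
    by (intro borel_measurable_scaleR borel_measurable_indicator) auto
  have "(\<integral>x. plane_wave \<xi> x \<partial>lebesgue_on (cube r)) = (LINT x|lebesgue. indicat_real (cube r) x *\<^sub>R plane_wave \<xi> x)"
    by (intro integral_restrict_space) auto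
  also have "\<dots> = (LINT x|lborel. indicat_real (cube r) x *\<^sub>R plane_wave \<xi> x)"
    using meas by (rule integral_completion)
  also have "\<dots> = (LINT x|lborel. (\<Prod>b\<in>Basis. indicat_real {-r..r} (x \<bullet> b) *\<^sub>R cis ((\<xi> \<bullet> b) * (x \<bullet> b))))"
  proof (rule Bochner_Integration.integral_cong)
    fix x :: "real^'a"
    have "indicat_real (cube r) x = (\<Prod>b\<in>Basis. indicat_real {-r..r} (x \<bullet> b))"
    proof (cases "x \<in> cube r")
      case True
      then have "indicat_real {-r..r} (x \<bullet> b) = 1" if "b \<in> Basis" for b
        using that by (auto simp: mem_box_cart Basis_vec_def inner_axis)
      with True show ?thesis by simp
    next
      case False
      then obtain i where "x $ i \<notin> {-r..r}" by (auto simp: mem_box_cart)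
      then have "indicat_real {-r..r} (x \<bullet> axis i 1) = 0" by (simp add: inner_axis)
      moreover have "axis i 1 \<in> (Basis :: (real^'a) set)" by (simp add: axis_in_Basis_iff)
      ultimately have "(\<Prod>b\<in>Basis. indicat_real {-r..r} (x \<bullet> b)) = 0"
        by (intro prod_zero) auto
      with False show ?thesis by simp
    qed
    moreover have "plane_wave \<xi> x = (\<Prod>b\<in>Basis. cis ((\<xi> \<bullet> b) * (x \<bullet> b)))"
      by (simp add: plane_wave_def cis_sum[symmetric] euclidean_inner[of \<xi> x])
    ultimately show "indicat_real (cube r) x *\<^sub>R plane_wave \<xi> x
        = (\<Prod>b\<in>Basis. indicat_real {-r..r} (x \<bullet> b) *\<^sub>R cis ((\<xi> \<bullet> b) * (x \<bullet> b)))"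
      by (simp add: scaleR_conv_of_real prod.distrib)
  qed simp
  also have "\<dots> = (\<Prod>b\<in>Basis. LINT t|lborel. indicat_real {-r..r} t *\<^sub>R cis ((\<xi> \<bullet> b) * t))"
    by (intro lborel_integral_prod_Basis integrable_cis_interval)
  also have "\<dots> = 0"
  proof (rule prod_zero)
    have "\<xi> \<bullet> axis j 1 = pi / r * of_int (n j - m j)"
      by (simp add: \<xi>_def lattice_point_def inner_axis right_diff_distrib)
    then show "\<exists>b\<in>Basis. (LINT t|lborel. indicat_real {-r..r} t *\<^sub>R cis ((\<xi> \<bullet> b) * t)) = 0"
      using integral_cis_period[OF r, of "n j - m j"] j
      by (intro bexI[of _ "axis j 1"]) (auto simp: axis_in_Basis_iff)
  qed simp
  finally show ?thesis by (simp add: \<xi>_def)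
qed

lemma plane_wave_add: "plane_wave (\<xi> + \<eta>) x = plane_wave \<xi> x * plane_wave \<eta> x"
  by (simp add: plane_wave_def inner_add_left cis_mult)

lemma cnj_plane_wave: "cnj (plane_wave \<xi> x) = plane_wave (- \<xi>) x"
  by (simp add: plane_wave_def cis_cnj)

lemma plane_wave_measurable: "plane_wave \<xi> \<in> borel_measurable (lebesgue_on \<Omega>)"
  by (intro measurable_restrict_space1 measurable_completion)
    (auto intro: borel_measurable_continuous_onI continuous_on_plane_wave)

lemma measure_cube: "0 < r \<Longrightarrow> measure lebesgue (cube r :: (real^'n) set) = (2 * r) ^ CARD('n)"
  by (simp add: content_cbox_cart interval_ne_empty_cart)

text \<open>Extended by 0 to the cube and multiplied by the plane wave of frequency \<open>- \<tau>\<close>, the function \<open>u\<close> has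
  the inner products in question, up to conjugation, as its Fourier coefficients on the cube. The
  claim is Bessel's inequality there.\<close>

lemma plane_wave_lattice_bessel:
  fixes \<Omega> :: "(real^'n) set"
  assumes \<Omega>: "\<Omega> \<in> sets lebesgue" "\<Omega> \<subseteq> cube r" and r: "0 < r" and fin: "finite F"
    and u: "u \<in> L2 (lebesgue_on \<Omega>)"
  shows "(\<Sum>n\<in>F. (cmod (L2_inner (lebesgue_on \<Omega>) (plane_wave (\<tau> + lattice_point r n)) u))\<^sup>2)
    \<le> (2 * r) ^ CARD('n) * L2_sqnorm (lebesgue_on \<Omega>) u"
proof -
  let ?Q = "lebesgue_on (cube r :: (real^'n) set)" and ?L = "lebesgue_on \<Omega>"
  define h where "h = (\<lambda>x. indicat_real \<Omega> x *\<^sub>R (u x * plane_wave (- \<tau>) x))"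
  have u_meas: "(\<lambda>x. indicat_real \<Omega> x *\<^sub>R u x) \<in> borel_measurable lebesgue"
    using L2_measurable[OF u] \<Omega>(1) by (simp add: borel_measurable_restrict_space_iff)
  have sq_int: "integrable lebesgue (\<lambda>x. indicat_real \<Omega> x *\<^sub>R (cmod (u x))\<^sup>2)"
    using L2_integrable_sq[OF u] \<Omega>(1) by (simp add: integrable_restrict_space)
  have cube_ind: "indicat_real (cube r) x * indicat_real \<Omega> x = indicat_real \<Omega> x" for x
    using \<Omega>(2) by (auto simp: indicator_def)
  have h_sq: "(cmod (h x))\<^sup>2 = indicat_real \<Omega> x *\<^sub>R (cmod (u x))\<^sup>2" for x
    by (simp add: h_def norm_mult indicator_def)
  have h: "h \<in> L2 ?Q"
    unfolding L2_def
  proof (intro CollectI conjI)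
    have "(\<lambda>x. (indicat_real \<Omega> x *\<^sub>R u x) * plane_wave (- \<tau>) x) \<in> borel_measurable ?Q"
      using measurable_restrict_space1[OF u_meas] plane_wave_measurable by (rule borel_measurable_times)
    then show "h \<in> borel_measurable ?Q" by (simp add: h_def)
    show "integrable ?Q (\<lambda>x. (cmod (h x))\<^sup>2)"
      unfolding h_sq using sq_int by (simp add: integrable_restrict_space cube_ind mult.assoc[symmetric])
  qed
  have h_sqnorm: "L2_sqnorm ?Q h = L2_sqnorm ?L u"
    unfolding L2_sqnorm_def h_sq using \<Omega>(1)
    by (simp add: integral_restrict_space cube_ind mult.assoc[symmetric])
  have e: "plane_wave (lattice_point r n) \<in> L2 ?Q" for n :: "'n \<Rightarrow> int"
  proof -
    interpret finite_measure ?Q by (rule finite_measure_lebesgue_on) simp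
    show ?thesis by (simp add: L2_def plane_wave_measurable)
  qed
  have inner: "cmod (L2_inner ?Q h (plane_wave (lattice_point r n)))
      = cmod (L2_inner ?L (plane_wave (\<tau> + lattice_point r n)) u)" for n :: "'n \<Rightarrow> int"
  proof -
    have "L2_inner ?Q h (plane_wave (lattice_point r n))
        = (LINT x|lebesgue. indicat_real \<Omega> x *\<^sub>R (u x * cnj (plane_wave (\<tau> + lattice_point r n) x)))"
      unfolding L2_inner_def h_def
      by (subst integral_restrict_space)
        (auto intro!: Bochner_Integration.integral_cong
          simp: cube_ind plane_wave_add cnj_plane_wave mult.assoc[symmetric])
    also have "\<dots> = L2_inner ?L u (plane_wave (\<tau> + lattice_point r n))"
      unfolding L2_inner_def using \<Omega>(1) by (intro integral_restrict_space[symmetric]) simp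
    also have "\<dots> = cnj (L2_inner ?L (plane_wave (\<tau> + lattice_point r n)) u)" by (rule L2_inner_cnj)
    finally show ?thesis by simp
  qed
  have "(\<Sum>n\<in>F. (cmod (L2_inner ?Q h (plane_wave (lattice_point r n))))\<^sup>2) \<le> (2 * r) ^ CARD('n) * L2_sqnorm ?Q h"
  proof (rule L2_bessel[OF fin e _ _ _ h])
    fix n m :: "'n \<Rightarrow> int" assume "n \<noteq> m"
    then show "L2_inner ?Q (plane_wave (lattice_point r n)) (plane_wave (lattice_point r m)) = 0"
      using integral_plane_wave_cube[OF r] unfolding L2_inner_def cnj_plane_wave plane_wave_add[symmetric]
      by simp
  next
    show "L2_sqnorm ?Q (plane_wave (lattice_point r n)) = (2 * r) ^ CARD('n)" for n :: "'n \<Rightarrow> int"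
      using measure_cube[OF r, where 'n='n] by (simp add: L2_sqnorm_def measure_restrict_space)
  qed (use r in simp)
  then show ?thesis by (simp add: inner h_sqnorm)
qed

lemma continuous_on_inner_plane_wave:
  assumes "u \<in> L2 (lebesgue_on \<Omega>)" and "\<Omega> \<in> lmeasurable"
  shows "continuous_on UNIV (\<lambda>\<xi>. L2_inner (lebesgue_on \<Omega>) (plane_wave \<xi>) u)"
proof -
  interpret finite_measure "lebesgue_on \<Omega>" using assms(2) by (rule finite_measure_lebesgue_on)
  have "(\<lambda>x. 1) \<in> L2 (lebesgue_on \<Omega>)" by (simp add: L2_def)
  then have int: "integrable (lebesgue_on \<Omega>) (\<lambda>x. cmod (u x))"
    using L2_integrable_mult[OF assms(1)] by fastforce
  have meas: "u \<in> borel_measurable (lebesgue_on \<Omega>)" using assms(1) by (rule L2_measurable)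
  show ?thesis
    unfolding continuous_on_sequentially L2_inner_def o_def
  proof (intro allI ballI impI, elim conjE)
    fix s :: "nat \<Rightarrow> real^'a" and \<xi> assume s: "s \<longlonglongrightarrow> \<xi>"
    show "(\<lambda>n. \<integral>x. plane_wave (s n) x * cnj (u x) \<partial>lebesgue_on \<Omega>)
        \<longlonglongrightarrow> (\<integral>x. plane_wave \<xi> x * cnj (u x) \<partial>lebesgue_on \<Omega>)"
    proof (rule integral_dominated_convergence[OF _ _ int])
      show "AE x in lebesgue_on \<Omega>. (\<lambda>n. plane_wave (s n) x * cnj (u x)) \<longlonglongrightarrow> plane_wave \<xi> x * cnj (u x)"
        unfolding plane_wave_def cis_conv_exp by (intro AE_I2 tendsto_intros s)
    qed (use meas plane_wave_measurable in \<open>auto simp: norm_mult intro!: borel_measurable_times borel_measurable_cnj\<close>)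
  qed
qed

lemma nn_integral_lborel_translate:
  fixes f :: "'a::euclidean_space \<Rightarrow> ennreal"
  assumes [measurable]: "f \<in> borel_measurable borel"
  shows "(\<integral>\<^sup>+x. f (x + c) \<partial>lborel) = (\<integral>\<^sup>+x. f x \<partial>lborel)"
  by (subst (2) lborel_distr_plus[of c, symmetric], subst nn_integral_distr) (auto simp: add.commute)

text \<open>One half of Plancherel's theorem. The cubes of side \<open>\<pi> / r\<close> at the lattice points cover the space, so
  the integral over \<open>B\<close> is at most the integral over one such cube of the sums over the shifted
  lattice. By Bessel's inequality these sums are at most \<open>(2 r)\<^sup>d \<parallel>u\<parallel>\<^sup>2\<close>, and multiplication by the
  volume \<open>(\<pi> / r)\<^sup>d\<close> of the cube gives a bound in which \<open>r\<close> has cancelled.\<close>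

lemma nn_integral_inner_plane_wave_le:
  fixes \<Omega> B :: "(real^'n) set"
  assumes \<Omega>: "\<Omega> \<in> lmeasurable" "bounded \<Omega>" and u: "u \<in> L2 (lebesgue_on \<Omega>)" and B: "bounded B"
  shows "(\<integral>\<^sup>+\<xi>. ennreal ((cmod (L2_inner (lebesgue_on \<Omega>) (plane_wave \<xi>) u))\<^sup>2) * indicator B \<xi> \<partial>lborel)
    \<le> ennreal ((2 * pi) ^ CARD('n) * L2_sqnorm (lebesgue_on \<Omega>) u)"
proof -
  define f where "f = (\<lambda>\<xi>. ennreal ((cmod (L2_inner (lebesgue_on \<Omega>) (plane_wave \<xi>) u))\<^sup>2))"
  have f_meas [measurable]: "f \<in> borel_measurable borel"
    unfolding f_def using continuous_on_inner_plane_wave[OF u \<Omega>(1)]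
    by (intro measurable_compose[OF _ measurable_ennreal] borel_measurable_continuous_onI continuous_intros)
  obtain r where r: "0 < r" and norm_le: "\<And>x. x \<in> \<Omega> \<Longrightarrow> norm x \<le> r"
    using \<Omega>(2) unfolding bounded_pos by blast
  have sub: "\<Omega> \<subseteq> cube r"
  proof
    fix x assume "x \<in> \<Omega>"
    then have "\<bar>x $ i\<bar> \<le> r" for i
      using norm_le component_le_norm_cart[of x i] order_trans by blast
    then show "x \<in> cube r" by (auto simp: mem_box_cart abs_le_iff minus_le_iff)
  qed
  obtain R where R: "0 < R" "\<And>x. x \<in> B \<Longrightarrow> norm x \<le> R" using B unfolding bounded_pos by blast
  \<comment> \<open>Every point of \<open>B\<close> lies in the cube at its coordinatewise floor in the lattice, and \<open>N\<close> bounds the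
    coordinates that occur.\<close>
  define N where "N = \<lceil>R * r / pi\<rceil> + 1"
  define F :: "('n \<Rightarrow> int) set" where "F = PiE UNIV (\<lambda>_. {-N..N})"
  have fin: "finite F" unfolding F_def by (intro finite_PiE) auto
  define C :: "(real^'n) set" where "C = cbox 0 (\<chi> i. pi / r)"
  have cover: "f \<xi> * indicator B \<xi> \<le> (\<Sum>n\<in>F. f \<xi> * indicator C (\<xi> - lattice_point r n))" for \<xi>
  proof (cases "\<xi> \<in> B")
    case True
    define n where "n = (\<lambda>i. \<lfloor>\<xi> $ i * r / pi\<rfloor>)"
    have bnd: "\<bar>\<xi> $ i * r / pi\<bar> \<le> R * r / pi" for i
    proof -
      have "\<bar>\<xi> $ i\<bar> \<le> R" using R(2)[OF True] component_le_norm_cart[of \<xi> i] by linarith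
      then show ?thesis using r by (simp add: abs_mult divide_right_mono mult_right_mono)
    qed
    have "n i \<in> {-N..N}" for i
      using bnd[of i] unfolding n_def N_def atLeastAtMost_iff abs_le_iff by linarith
    then have nF: "n \<in> F" by (auto simp: F_def)
    have "pi / r * of_int (n i) \<le> \<xi> $ i \<and> \<xi> $ i \<le> pi / r * of_int (n i) + pi / r" for i
    proof -
      have "of_int (n i) \<le> \<xi> $ i * r / pi" "\<xi> $ i * r / pi \<le> of_int (n i) + 1"
        unfolding n_def by linarith+
      then have "pi / r * of_int (n i) \<le> pi / r * (\<xi> $ i * r / pi)"
          "pi / r * (\<xi> $ i * r / pi) \<le> pi / r * (of_int (n i) + 1)"
        using r by (auto intro!: mult_left_mono simp del: times_divide_eq_right times_divide_eq_left)
      then show ?thesis using r by (simp add: distrib_left)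
    qed
    then have "\<xi> - lattice_point r n \<in> C"
      by (auto simp: C_def lattice_point_def mem_box_cart algebra_simps)
    then have "f \<xi> * indicator B \<xi> = f \<xi> * indicator C (\<xi> - lattice_point r n)" using True by simp
    also have "\<dots> \<le> (\<Sum>n\<in>F. f \<xi> * indicator C (\<xi> - lattice_point r n))"
      using fin nF by (intro member_le_sum) auto
    finally show ?thesis .
  qed simp
  have C_meas [measurable]: "C \<in> sets borel" by (simp add: C_def)
  have "(\<integral>\<^sup>+\<xi>. f \<xi> * indicator B \<xi> \<partial>lborel) \<le> (\<integral>\<^sup>+\<xi>. (\<Sum>n\<in>F. f \<xi> * indicator C (\<xi> - lattice_point r n)) \<partial>lborel)"
    by (intro nn_integral_mono cover)
  also have "\<dots> = (\<Sum>n\<in>F. \<integral>\<^sup>+\<xi>. f \<xi> * indicator C (\<xi> - lattice_point r n) \<partial>lborel)"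
    by (intro nn_integral_sum) measurable
  also have "\<dots> = (\<Sum>n\<in>F. \<integral>\<^sup>+\<tau>. f (\<tau> + lattice_point r n) * indicator C \<tau> \<partial>lborel)"
  proof (rule sum.cong)
    fix n :: "'n \<Rightarrow> int"
    show "(\<integral>\<^sup>+\<xi>. f \<xi> * indicator C (\<xi> - lattice_point r n) \<partial>lborel)
        = (\<integral>\<^sup>+\<tau>. f (\<tau> + lattice_point r n) * indicator C \<tau> \<partial>lborel)"
      by (subst nn_integral_lborel_translate[of _ "lattice_point r n", symmetric]) auto
  qed simp
  also have "\<dots> = (\<integral>\<^sup>+\<tau>. (\<Sum>n\<in>F. f (\<tau> + lattice_point r n) * indicator C \<tau>) \<partial>lborel)"
    by (intro nn_integral_sum[symmetric]) measurable
  also have "\<dots> \<le> (\<integral>\<^sup>+\<tau>. ennreal ((2 * r) ^ CARD('n) * L2_sqnorm (lebesgue_on \<Omega>) u) * indicator C \<tau> \<partial>lborel)"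
  proof (rule nn_integral_mono)
    fix \<tau> :: "real^'n"
    have "(\<Sum>n\<in>F. f (\<tau> + lattice_point r n)) \<le> ennreal ((2 * r) ^ CARD('n) * L2_sqnorm (lebesgue_on \<Omega>) u)"
      unfolding f_def using plane_wave_lattice_bessel[OF _ sub r fin u] \<Omega>(1)
      by (subst sum_ennreal) (auto intro!: ennreal_leI)
    then show "(\<Sum>n\<in>F. f (\<tau> + lattice_point r n) * indicator C \<tau>)
        \<le> ennreal ((2 * r) ^ CARD('n) * L2_sqnorm (lebesgue_on \<Omega>) u) * indicator C \<tau>"
      by (simp add: sum_distrib_right[symmetric] mult_right_mono)
  qed
  also have "\<dots> = ennreal ((2 * r) ^ CARD('n) * L2_sqnorm (lebesgue_on \<Omega>) u) * emeasure lborel C"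
    by (intro nn_integral_cmult_indicator) simp
  also have "emeasure lborel C = ennreal ((pi / r) ^ CARD('n))"
  proof -
    have "measure lborel C = (pi / r) ^ CARD('n)"
      unfolding C_def using r by (subst content_cbox_cart) (auto simp: interval_ne_empty_cart)
    then show ?thesis using emeasure_eq_ennreal_measure[of lborel C] by (simp add: C_def emeasure_lborel_cbox_eq)
  qed
  also have "ennreal ((2 * r) ^ CARD('n) * L2_sqnorm (lebesgue_on \<Omega>) u) * ennreal ((pi / r) ^ CARD('n))
      = ennreal ((2 * pi) ^ CARD('n) * L2_sqnorm (lebesgue_on \<Omega>) u)"
  proof -
    have "(2 * r) ^ CARD('n) * (pi / r) ^ CARD('n) = (2 * r * (pi / r)) ^ CARD('n)"
      by (rule power_mult_distrib[symmetric])
    also have "2 * r * (pi / r) = 2 * pi" using r by simp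
    finally show ?thesis using r by (simp add: ennreal_mult[symmetric] mult_ac)
  qed
  finally show ?thesis by (simp add: f_def)
qed

lemma set_integrable_continuous_cball:
  fixes g :: "'a::euclidean_space \<Rightarrow> real"
  assumes "continuous_on UNIV g"
  shows "set_integrable lborel (cball 0 R) g"
  unfolding set_integrable_def
  using assms by (intro borel_integrable_compact) (auto intro: continuous_on_subset)

lemma integral_inner_plane_wave_le:
  fixes \<Omega> :: "(real^'n) set"
  assumes \<Omega>: "\<Omega> \<in> lmeasurable" "bounded \<Omega>" and u: "u \<in> L2 (lebesgue_on \<Omega>)"
  shows "(LINT \<xi>:cball 0 R|lborel. (cmod (L2_inner (lebesgue_on \<Omega>) (plane_wave \<xi>) u))\<^sup>2)
    \<le> (2 * pi) ^ CARD('n) * L2_sqnorm (lebesgue_on \<Omega>) u"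
proof -
  let ?g = "\<lambda>\<xi>. (cmod (L2_inner (lebesgue_on \<Omega>) (plane_wave \<xi>) u))\<^sup>2"
  have "continuous_on UNIV ?g"
    using continuous_on_inner_plane_wave[OF u \<Omega>(1)] by (intro continuous_intros)
  then have int: "integrable lborel (\<lambda>\<xi>. indicat_real (cball 0 R) \<xi> *\<^sub>R ?g \<xi>)"
    using set_integrable_continuous_cball unfolding set_integrable_def by blast
  have "ennreal (LINT \<xi>|lborel. indicat_real (cball 0 R) \<xi> *\<^sub>R ?g \<xi>)
      = (\<integral>\<^sup>+\<xi>. ennreal (indicat_real (cball 0 R) \<xi> *\<^sub>R ?g \<xi>) \<partial>lborel)"
    using int by (intro nn_integral_eq_integral[symmetric]) auto
  also have "\<dots> = (\<integral>\<^sup>+\<xi>. ennreal (?g \<xi>) * indicator (cball 0 R) \<xi> \<partial>lborel)"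
    by (intro nn_integral_cong) (auto simp: indicator_def)
  also have "\<dots> \<le> ennreal ((2 * pi) ^ CARD('n) * L2_sqnorm (lebesgue_on \<Omega>) u)"
    by (rule nn_integral_inner_plane_wave_le[OF \<Omega> u]) simp
  finally show ?thesis
    by (simp add: set_lebesgue_integral_def ennreal_le_iff)
qed

section \<open>Moments of a ball\<close>

lemma integral_cball_inner_eq_0:
  fixes a :: "'a::euclidean_space"
  shows "(LINT \<xi>:cball 0 R|lborel. \<xi> \<bullet> a) = 0"
proof -
  let ?g = "\<lambda>\<xi>. indicat_real (cball 0 R) \<xi> *\<^sub>R (\<xi> \<bullet> a)"
  have "lborel = distr lborel borel (\<lambda>x::'a. - x)"
    using lborel_affine[of "-1" "0::'a"] by (simp add: density_1)
  then have "(LINT \<xi>|lborel. ?g \<xi>) = (LINT \<xi>|distr lborel borel (\<lambda>x::'a. - x). ?g \<xi>)" by simp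
  also have "\<dots> = (LINT \<xi>|lborel. ?g (- \<xi>))"
    by (intro integral_distr borel_measurable_scaleR borel_measurable_inner borel_measurable_indicator) auto
  also have "\<dots> = (LINT \<xi>|lborel. - ?g \<xi>)"
    by (intro Bochner_Integration.integral_cong) (auto simp: indicator_def)
  finally show ?thesis by (simp add: set_lebesgue_integral_def)
qed

lemma integral_cball_norm_squared:
  assumes R: "0 < R"
  shows "(LINT \<xi>:cball (0 :: 'a::euclidean_space) R|lborel. (norm \<xi>)\<^sup>2)
    = real DIM('a) / (real DIM('a) + 2) * R\<^sup>2 * (unit_ball_vol (real DIM('a)) * R ^ DIM('a))"
proof -
  let ?d = "DIM('a)" and ?w = "unit_ball_vol (real DIM('a))" and ?B = "cball (0 :: 'a) R"
  define J where "J = (LINT \<xi>:?B|lborel. R\<^sup>2 - (norm \<xi>)\<^sup>2)"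
  have int: "set_integrable lborel ?B (\<lambda>\<xi>. R\<^sup>2 - (norm \<xi>)\<^sup>2)" "set_integrable lborel ?B (\<lambda>\<xi>. (norm \<xi>)\<^sup>2)"
    "set_integrable lborel ?B (\<lambda>\<xi>. R\<^sup>2)"
    by (intro set_integrable_continuous_cball continuous_intros)+
  have vol: "(LINT \<xi>:?B|lborel. R\<^sup>2) = R\<^sup>2 * (?w * R ^ ?d)"
    using R by (simp add: set_lebesgue_integral_def content_cball)
  have nonneg: "0 \<le> indicat_real ?B \<xi> *\<^sub>R (R\<^sup>2 - (norm \<xi>)\<^sup>2)" for \<xi>
    by (auto simp: indicator_def intro!: power_mono)
  \<comment> \<open>\<open>R\<^sup>2 - \<bar>\<xi>\<bar>\<^sup>2\<close> is the integral of \<open>2 s\<close> over \<open>\<bar>\<xi>\<bar> \<le> s \<le> R\<close>; exchanging the integrations leaves the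
    volumes of the balls of radius \<open>s\<close>.\<close>
  have "ennreal J = (\<integral>\<^sup>+\<xi>. ennreal (indicat_real ?B \<xi> *\<^sub>R (R\<^sup>2 - (norm \<xi>)\<^sup>2)) \<partial>lborel)"
    unfolding J_def set_lebesgue_integral_def using int(1) nonneg
    by (intro nn_integral_eq_integral[symmetric]) (auto simp: set_integrable_def)
  also have "\<dots> = (\<integral>\<^sup>+\<xi>. \<integral>\<^sup>+s. ennreal (2 * s) * indicator {norm (\<xi> :: 'a)..R} s \<partial>lborel \<partial>lborel)"
  proof (rule nn_integral_cong)
    fix \<xi> :: 'a
    show "ennreal (indicat_real ?B \<xi> *\<^sub>R (R\<^sup>2 - (norm \<xi>)\<^sup>2)) = (\<integral>\<^sup>+s. ennreal (2 * s) * indicator {norm \<xi>..R} s \<partial>lborel)"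
    proof (cases "\<xi> \<in> ?B")
      case True
      then have le: "norm \<xi> \<le> R" by simp
      have "(\<integral>\<^sup>+s. ennreal (2 * s) * indicator {norm \<xi>..R} s \<partial>lborel) = ennreal (R\<^sup>2 - (norm \<xi>)\<^sup>2)"
      proof (rule nn_integral_FTC_Icc)
        show "((\<lambda>s. s\<^sup>2) has_real_derivative 2 * s) (at s)" for s :: real
          by (auto intro!: derivative_eq_intros)
        show "0 \<le> 2 * s" if "s \<in> {norm \<xi>..R}" for s
          using that order_trans[OF norm_ge_zero[of \<xi>]] by simp
      qed (use le in auto)
      then show ?thesis using True by simp
    next
      case False
      then show ?thesis by simp
    qed
  qed
  also have "\<dots> = (\<integral>\<^sup>+s. \<integral>\<^sup>+\<xi>. ennreal (2 * s) * indicator {norm (\<xi> :: 'a)..R} s \<partial>lborel \<partial>lborel)"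
  proof (rule lborel_pair.Fubini'[symmetric])
    have "(\<lambda>p. ennreal (2 * snd p) * indicator {p. norm (fst p) \<le> snd p \<and> snd p \<le> R} p)
        \<in> borel_measurable (lborel \<Otimes>\<^sub>M (lborel :: real measure))" by measurable
    also have "(\<lambda>p. ennreal (2 * snd p) * indicator {p. norm (fst p) \<le> snd p \<and> snd p \<le> R} p)
        = (\<lambda>(\<xi>, s). ennreal (2 * s) * indicator {norm (\<xi> :: 'a)..R} s)"
      by (auto simp: fun_eq_iff indicator_def)
    finally show "(\<lambda>(\<xi>, s). ennreal (2 * s) * indicator {norm (\<xi> :: 'a)..R} s)
        \<in> borel_measurable (lborel \<Otimes>\<^sub>M lborel)" .
  qed
  also have "\<dots> = (\<integral>\<^sup>+s. ennreal (2 * ?w * s ^ (?d + 1)) * indicator {0..R} s \<partial>lborel)"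
  proof (rule nn_integral_cong)
    fix s :: real
    show "(\<integral>\<^sup>+\<xi>. ennreal (2 * s) * indicator {norm (\<xi> :: 'a)..R} s \<partial>lborel)
        = ennreal (2 * ?w * s ^ (?d + 1)) * indicator {0..R} s"
    proof (cases "s \<in> {0..R}")
      case True
      have "(\<integral>\<^sup>+\<xi>. ennreal (2 * s) * indicator {norm (\<xi> :: 'a)..R} s \<partial>lborel)
          = (\<integral>\<^sup>+\<xi>. ennreal (2 * s) * indicator (cball (0 :: 'a) s) \<xi> \<partial>lborel)"
        using True by (intro nn_integral_cong) (auto simp: indicator_def)
      also have "\<dots> = ennreal (2 * s) * ennreal (?w * s ^ ?d)"
        using True by (subst nn_integral_cmult_indicator) (auto simp: emeasure_cball)
      also have "\<dots> = ennreal (2 * ?w * s ^ (?d + 1))"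
        using True by (simp add: ennreal_mult[symmetric] mult_ac)
      finally show ?thesis using True by simp
    next
      case False
      have "indicator {norm \<xi>..R} s = (0 :: ennreal)" for \<xi> :: 'a
        using False norm_ge_zero[of \<xi>] by (auto simp: indicator_def simp del: norm_ge_zero)
      then show ?thesis using False by simp
    qed
  qed
  also have "\<dots> = ennreal (2 * ?w / (?d + 2) * R ^ (?d + 2) - 2 * ?w / (?d + 2) * 0 ^ (?d + 2))"
  proof (rule nn_integral_FTC_Icc)
    fix s :: real
    have "((\<lambda>s. 2 * ?w / (?d + 2) * s ^ (?d + 2)) has_real_derivative
        2 * ?w / (?d + 2) * (real (?d + 2) * s ^ (?d + 2 - 1))) (at s)"
      by (intro DERIV_cmult DERIV_pow[THEN DERIV_cong]) simp
    then show "((\<lambda>s. 2 * ?w / (?d + 2) * s ^ (?d + 2)) has_real_derivative 2 * ?w * s ^ (?d + 1)) (at s)"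
      by (rule DERIV_cong) (simp add: field_simps)
  qed (use R in auto)
  finally have "ennreal J = ennreal (2 * ?w / (?d + 2) * R ^ (?d + 2))" by simp
  moreover have "0 \<le> J" unfolding J_def set_lebesgue_integral_def using nonneg by (intro integral_nonneg_AE AE_I2)
  ultimately have J: "J = 2 * ?w / (?d + 2) * R ^ (?d + 2)" using R by (subst (asm) ennreal_inj) auto
  have "J = R\<^sup>2 * (?w * R ^ ?d) - (LINT \<xi>:?B|lborel. (norm \<xi>)\<^sup>2)"
    unfolding J_def vol[symmetric] using int by (intro set_integral_diff)
  then have "(LINT \<xi>:?B|lborel. (norm \<xi>)\<^sup>2) = R\<^sup>2 * (?w * R ^ ?d) - 2 * ?w / (?d + 2) * R ^ (?d + 2)"
    using J by simp
  also have "\<dots> = real ?d / (real ?d + 2) * R\<^sup>2 * (?w * R ^ ?d)"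
    by (simp add: power_add power2_eq_square field_simps)
  finally show ?thesis .
qed

section \<open>Averaging over a ball of frequencies\<close>

lemma nn_integral_eq_top_if_not_integrable:
  fixes f :: "'a \<Rightarrow> real"
  assumes "f \<in> borel_measurable M" and "\<not> integrable M f"
  shows "(\<integral>\<^sup>+x. ennreal (norm (f x)) \<partial>M) = \<infinity>"
  using assms by (auto simp: integrable_iff_bounded less_top[symmetric])

text \<open>The radius of the ball of frequencies for which the phase space volume \<open>v w R\<^sup>d\<close> is \<open>(2 \<pi>)\<^sup>d k\<close>. In the
  application \<open>v\<close> is the volume of the region and \<open>w\<close> that of the unit ball.\<close>

lemma weyl_radius:
  fixes d :: nat and v w k :: real
  assumes "0 < d" "0 < v" "0 < w" "0 < k"
  defines "R \<equiv> 2 * pi * (k / (w * v)) powr (1 / d)"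
  shows "0 < R" and "v * (w * R ^ d) = (2 * pi) ^ d * k"
    and "R\<^sup>2 * k = (2 * pi)\<^sup>2 * (w * v) powr (- 2 / d) * k powr (1 + 2 / d)"
proof -
  show "0 < R" using assms by simp
  have "((k / (w * v)) powr (1 / d)) ^ d = k / (w * v)"
    using assms by (simp add: powr_realpow[symmetric] powr_powr)
  then show "v * (w * R ^ d) = (2 * pi) ^ d * k"
    using assms by (simp add: power_mult_distrib)
  have "((k / (w * v)) powr (1 / d))\<^sup>2 = (k / (w * v)) powr (2 / d)"
    using assms by (simp add: powr_power)
  also have "\<dots> = k powr (2 / d) * (w * v) powr (- 2 / d)"
  proof -
    have "(w * v) powr (- 2 / d) = 1 / (w * v) powr (2 / d)"
      using powr_minus_divide[of "w * v" "2 / d"] by simp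
    then show ?thesis using assms by (simp add: powr_divide)
  qed
  finally show "R\<^sup>2 * k = (2 * pi)\<^sup>2 * (w * v) powr (- 2 / d) * k powr (1 + 2 / d)"
    using assms by (simp add: power_mult_distrib powr_add mult_ac)
qed

context robin_form_data
begin

text \<open>The lower bound for the form is integrated over the ball of radius \<open>R\<close> in frequency space. With
  \<open>I j\<close> for the integral of \<open>\<bar>\<langle>plane_wave \<xi>, u j\<rangle>\<bar>\<^sup>2\<close> and \<open>m\<close> for the volume of the ball, the left-hand side
  becomes \<open>\<Sum>j. (lam j - \<Lambda>) I j + \<Lambda> Vol(\<Omega>) m\<close> with \<open>\<Lambda> = lam (k + 1)\<close>. Here \<open>lam j - \<Lambda> \<le> 0\<close> and
  \<open>I j \<le> (2 \<pi>)\<^sup>d\<close>, so replacing \<open>I j\<close> by \<open>(2 \<pi>)\<^sup>d\<close> only makes it smaller; as \<open>Vol(\<Omega>) m = (2 \<pi>)\<^sup>d k\<close>, the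
  terms with \<open>\<Lambda>\<close> then cancel.\<close>

lemma eigenvalue_sum_le:
  assumes ne: "\<Omega> \<noteq> {}" and compact: "compact_resolvent L (robin_operator \<Omega> A V \<sigma>)"
    and lam: "eigenvalue_enumeration L (robin_operator \<Omega> A V \<sigma>) lam" and k: "1 \<le> k"
  defines "C \<equiv> (\<integral>x. (norm (A x))\<^sup>2 \<partial>L) + (\<integral>x. V x \<partial>L) + (\<integral>x. \<sigma> x \<partial>S)"
  shows "(\<Sum>j=1..k. lam j) \<le> weyl_term \<Omega> k + real k * (C / Vol \<Omega>)"
proof -
  interpret nonneg_form_compact_resolvent L D q
  proof
    show "q v u = cnj (q u v)" for u v by (rule q_hermitian)
    show "compact_resolvent L (form_operator L D q)" using compact by (simp add: robin_operator_def)
  qed (use D_L2 q_diff_nonneg q_nonneg q_zero in auto)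
  have lam': "eigenvalue_enumeration L (form_operator L D q) lam"
    using lam by (simp add: robin_operator_def)
  obtain u where u: "L2_orthonormal L {1..k} u" and
    u_le: "\<And>h. h \<in> D \<Longrightarrow> (\<Sum>j=1..k. lam j * (cmod (L2_inner L h (u j)))\<^sup>2)
        + lam (Suc k) * (L2_sqnorm L h - (\<Sum>j=1..k. (cmod (L2_inner L h (u j)))\<^sup>2)) \<le> Re (q h h)"
    using form_bounds_eigenvalue_means[OF lam', of k] by blast
  have uL2: "u j \<in> L2 L" and u1: "L2_sqnorm L (u j) = 1" if "j \<in> {1..k}" for j
  proof -
    show "u j \<in> L2 L" using u that by (simp add: L2_orthonormal_def)
    have "L2_inner L (u j) (u j) = 1" using u that by (simp add: L2_orthonormal_def)
    then show "L2_sqnorm L (u j) = 1" unfolding L2_inner_self by simp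
  qed
  define d where "d = CARD('n)"
  define w where "w = unit_ball_vol (real d)"
  define \<Lambda> where "\<Lambda> = lam (Suc k)"
  define a where "a = (\<integral>x. A x \<partial>L)"
  define g where "g = (\<lambda>j \<xi>. (cmod (L2_inner L (plane_wave \<xi>) (u j)))\<^sup>2)"
  have d: "0 < d" by (simp add: d_def)
  have w: "0 < w" by (simp add: w_def)
  have v: "0 < Vol \<Omega>"
    using open_not_negligible[OF open_\<Omega> ne] \<Omega>_lmeasurable
    by (simp add: Vol_def negligible_iff_measure zero_less_measure_iff)
  define R where "R = 2 * pi * (real k / (w * Vol \<Omega>)) powr (1 / d)"
  note R = weyl_radius[OF d v w, of "real k", folded R_def]
  have R_pos: "0 < R" and R_vol: "Vol \<Omega> * (w * R ^ d) = (2 * pi) ^ d * real k"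
    and R_weyl: "d / (d + 2) * (R\<^sup>2 * real k) = weyl_term \<Omega> k"
    using R k by (simp_all add: weyl_term_def w_def d_def Let_def mult.assoc)
  let ?B = "cball (0 :: real^'n) R"
  define m where "m = measure lborel ?B"
  have m: "m = w * R ^ d" using R_pos by (simp add: m_def content_cball w_def d_def)
  have lam_le: "lam j \<le> \<Lambda>" if "j \<in> {1..k}" for j
    using lam that unfolding \<Lambda>_def eigenvalue_enumeration_def by (auto intro: mono_onD)
  have pointwise: "(\<Sum>j=1..k. (lam j - \<Lambda>) * g j \<xi>) + \<Lambda> * Vol \<Omega> \<le> Vol \<Omega> * (norm \<xi>)\<^sup>2 + (C - 2 * (\<xi> \<bullet> a))" for \<xi>
  proof -
    have "L2_sqnorm L (plane_wave \<xi>) = Vol \<Omega>"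
      using \<Omega>_lmeasurable by (simp add: L2_sqnorm_def Vol_def measure_restrict_space)
    then have "(\<Sum>j=1..k. lam j * g j \<xi>) + \<Lambda> * (Vol \<Omega> - (\<Sum>j=1..k. g j \<xi>))
        \<le> Vol \<Omega> * (norm \<xi>)\<^sup>2 + (C - 2 * (\<xi> \<bullet> a))"
      using u_le[OF plane_wave_D[of \<xi>]] unfolding q_plane_wave a_def[symmetric] \<Lambda>_def[symmetric] g_def C_def
      by (simp add: algebra_simps)
    also have "(\<Sum>j=1..k. lam j * g j \<xi>) + \<Lambda> * (Vol \<Omega> - (\<Sum>j=1..k. g j \<xi>))
        = (\<Sum>j=1..k. (lam j - \<Lambda>) * g j \<xi>) + \<Lambda> * Vol \<Omega>"
      by (simp add: left_diff_distrib right_diff_distrib sum_subtractf sum_distrib_left)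
    finally show ?thesis .
  qed
  have g_cont: "continuous_on UNIV (g j)" if "j \<in> {1..k}" for j
    unfolding g_def using continuous_on_inner_plane_wave[OF uL2[OF that] \<Omega>_lmeasurable]
    by (intro continuous_intros)
  define I where "I = (\<lambda>j. LINT \<xi>:?B|lborel. g j \<xi>)"
  have I_le: "I j \<le> (2 * pi) ^ d" if "j \<in> {1..k}" for j
    using integral_inner_plane_wave_le[OF \<Omega>_lmeasurable bounded_\<Omega> uL2[OF that], of R] u1[OF that]
    by (simp add: I_def g_def d_def)
  have const: "(LINT \<xi>:?B|lborel. c) = c * m" for c :: real
    by (simp add: set_lebesgue_integral_def m_def)
  have int: "set_integrable lborel ?B f" if "continuous_on UNIV f" for f :: "real^'n \<Rightarrow> real"
    using that by (rule set_integrable_continuous_cball)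
  have sum_cont: "continuous_on UNIV (\<lambda>\<xi>. \<Sum>j=1..k. (lam j - \<Lambda>) * g j \<xi>)"
    using g_cont by (intro continuous_intros) auto
  have "(LINT \<xi>:?B|lborel. \<Sum>j=1..k. (lam j - \<Lambda>) * g j \<xi>) = (\<Sum>j=1..k. (lam j - \<Lambda>) * I j)"
  proof -
    have "(LINT \<xi>:?B|lborel. \<Sum>j=1..k. (lam j - \<Lambda>) * g j \<xi>)
        = (\<Sum>j=1..k. LINT \<xi>:?B|lborel. (lam j - \<Lambda>) * g j \<xi>)"
      using int g_cont unfolding set_lebesgue_integral_def scaleR_sum_right set_integrable_def
      by (intro Bochner_Integration.integral_sum) (auto intro!: int[unfolded set_integrable_def] continuous_intros simp del: real_scaleR_def)
    then show ?thesis by (simp add: I_def)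
  qed
  then have "(\<Sum>j=1..k. (lam j - \<Lambda>) * I j) + \<Lambda> * Vol \<Omega> * m
      = (LINT \<xi>:?B|lborel. (\<Sum>j=1..k. (lam j - \<Lambda>) * g j \<xi>) + \<Lambda> * Vol \<Omega>)"
    using sum_cont by (subst set_integral_add) (auto intro!: int simp: const)
  also have "\<dots> \<le> (LINT \<xi>:?B|lborel. Vol \<Omega> * (norm \<xi>)\<^sup>2 + (C - 2 * (\<xi> \<bullet> a)))"
    using pointwise by (intro set_integral_mono int continuous_on_add sum_cont continuous_intros)
  also have "\<dots> = Vol \<Omega> * (LINT \<xi>:?B|lborel. (norm \<xi>)\<^sup>2) + (C * m - 2 * (LINT \<xi>:?B|lborel. \<xi> \<bullet> a))"
  proof -
    have "(LINT \<xi>:?B|lborel. Vol \<Omega> * (norm \<xi>)\<^sup>2 + (C - 2 * (\<xi> \<bullet> a)))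
        = (LINT \<xi>:?B|lborel. Vol \<Omega> * (norm \<xi>)\<^sup>2) + (LINT \<xi>:?B|lborel. C - 2 * (\<xi> \<bullet> a))"
      by (intro set_integral_add int continuous_intros)
    also have "(LINT \<xi>:?B|lborel. C - 2 * (\<xi> \<bullet> a)) = (LINT \<xi>:?B|lborel. C) - (LINT \<xi>:?B|lborel. 2 * (\<xi> \<bullet> a))"
      by (intro set_integral_diff int continuous_intros)
    finally show ?thesis by (simp add: const)
  qed
  also have "\<dots> = d / (d + 2) * R\<^sup>2 * (Vol \<Omega> * m) + C * m"
    unfolding integral_cball_inner_eq_0 integral_cball_norm_squared[OF R_pos] m
    by (simp add: w_def d_def mult_ac add.commute)
  finally have bound: "(\<Sum>j=1..k. (lam j - \<Lambda>) * I j) + \<Lambda> * (Vol \<Omega> * m) \<le> d / (d + 2) * R\<^sup>2 * (Vol \<Omega> * m) + C * m"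
    by (simp add: mult.assoc)
  define P where "P = (2 * pi) ^ d"
  have P: "0 < P" by (simp add: P_def)
  have Vm: "Vol \<Omega> * m = P * real k" using R_vol by (simp add: m P_def)
  then have mP: "m = P * (real k / Vol \<Omega>)" using v by (simp add: field_simps)
  have "(\<Sum>j=1..k. lam j) * P = (\<Sum>j=1..k. (lam j - \<Lambda>) * P) + \<Lambda> * (P * real k)"
    by (simp add: sum_distrib_right left_diff_distrib sum_subtractf)
  also have "\<dots> \<le> (\<Sum>j=1..k. (lam j - \<Lambda>) * I j) + \<Lambda> * (Vol \<Omega> * m)"
    unfolding Vm using I_le lam_le by (intro add_mono sum_mono mult_left_mono_neg order_refl) (auto simp: P_def)
  also have "\<dots> \<le> d / (d + 2) * R\<^sup>2 * (P * real k) + C * (P * (real k / Vol \<Omega>))"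
    using bound unfolding Vm[symmetric] mP[symmetric] .
  also have "\<dots> = (d / (d + 2) * (R\<^sup>2 * real k) + real k * (C / Vol \<Omega>)) * P"
    by (simp add: algebra_simps)
  finally show ?thesis using P unfolding R_weyl by simp
qed

end

text \<open>If one of the three terms with norms is infinite, there is nothing to prove. Otherwise \<open>A\<close>, \<open>V\<close> and the
  surface area satisfy the conditions under which the sum of eigenvalues has been estimated, with
  the factor \<open>k\<close> in front of each of these terms, and \<open>k \<le> k\<^sup>2\<close>.\<close>

theorem theorem3p4:
  fixes \<Omega> :: "(real^'n) set"
    and A :: "real^'n \<Rightarrow> real^'n"
    and V \<sigma> :: "real^'n \<Rightarrow> real"
    and lam :: "nat \<Rightarrow> real"
    and k :: nat
  assumes "2 \<le> CARD('n)"
    and "bounded_smooth_region \<Omega>"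
    and "standing_assumptions \<Omega> A V \<sigma>"
    and "AE x in surface_measure \<Omega>. 0 < \<sigma> x"
    and "eigenvalue_enumeration (lebesgue_on \<Omega>) (robin_operator \<Omega> A V \<sigma>) lam"
    and "1 \<le> k"
  shows "ereal (\<Sum>j=1..k. lam j) \<le>
           enn2ereal (ennreal (weyl_term \<Omega> k)
             + of_nat (k\<^sup>2) * (Ar \<Omega> / ennreal (Vol \<Omega>)) * Linf_norm (surface_measure \<Omega>) \<sigma>
             + of_nat (k\<^sup>2) * (L2_norm_squared (lebesgue_on \<Omega>) A / ennreal (Vol \<Omega>))
             + of_nat k * (L1_norm (lebesgue_on \<Omega>) V / ennreal (Vol \<Omega>)))"
    (is "_ \<le> enn2ereal (_ + ?s + ?a + ?v)")
proof (cases "?s = \<infinity> \<or> ?a = \<infinity> \<or> ?v = \<infinity>")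
  case True
  then show ?thesis by auto
next
  case False
  let ?L = "lebesgue_on \<Omega>" and ?S = "surface_measure \<Omega>"
  have \<Omega>: "\<Omega> \<noteq> {}" "open \<Omega>" "bounded \<Omega>" using assms(2) by (auto simp: bounded_smooth_region_def)
  have A_meas: "A \<in> borel_measurable ?L" and V_meas: "V \<in> borel_measurable ?L"
    and V_nonneg: "AE x in ?L. 0 \<le> V x" and \<sigma>_meas: "\<sigma> \<in> borel_measurable ?S"
    and \<sigma>_fin: "Linf_norm ?S \<sigma> < \<infinity>" and compact: "compact_resolvent ?L (robin_operator \<Omega> A V \<sigma>)"
    using assms(3) by (auto simp: standing_assumptions_def)
  have top_divide: "top / ennreal (Vol \<Omega>) = top" by (simp add: ennreal_top_divide)
  have k: "k \<noteq> 0" using assms(6) by simp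
  have A_sq: "integrable ?L (\<lambda>x. (norm (A x))\<^sup>2)"
  proof (rule ccontr)
    assume "\<not> ?thesis"
    with A_meas have "L2_norm_squared ?L A = \<infinity>"
      using nn_integral_eq_top_if_not_integrable[of "\<lambda>x. (norm (A x))\<^sup>2" ?L]
      by (simp add: L2_norm_squared_def)
    with False k show False by (simp add: top_divide ennreal_mult_eq_top_iff)
  qed
  have V_int: "integrable ?L V"
  proof (rule ccontr)
    assume "\<not> ?thesis"
    with V_meas have "L1_norm ?L V = \<infinity>"
      using nn_integral_eq_top_if_not_integrable[of V ?L] by (simp add: L1_norm_def)
    with False k show False by (simp add: top_divide ennreal_mult_eq_top_iff)
  qed
  \<comment> \<open>If the area is infinite and the boundary term finite, then \<open>\<sigma>\<close> vanishes almost everywhere; being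
    positive almost everywhere, it then lives on a null boundary, whose area is 0.\<close>
  have Ar_fin: "Ar \<Omega> < \<infinity>"
  proof (rule ccontr)
    assume "\<not> ?thesis"
    then have Ar: "Ar \<Omega> = top" by (simp add: less_top[symmetric])
    then have "Linf_norm ?S \<sigma> = 0"
      using False k by (simp add: top_divide ennreal_mult_eq_top_iff ennreal_top_mult split: if_splits)
    then have "AE x in ?S. ennreal (norm (\<sigma> x)) \<le> 0"
      using esssup_AE[of "\<lambda>x. ennreal (norm (\<sigma> x))" ?S] by (simp add: Linf_norm_def)
    with assms(4) have "AE x in ?S. False" by eventually_elim (simp add: ennreal_eq_0_iff)
    then have "emeasure ?S (space ?S) = 0" by (simp only: eventually_False ae_filter_eq_bot_iff)
    with Ar show False by (simp add: Ar_def)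
  qed
  interpret robin_form_data \<Omega> A V \<sigma>
    by standard (use \<Omega> A_meas A_sq V_nonneg V_int \<sigma>_meas \<sigma>_fin assms(4) Ar_fin in auto)
  define a where "a = (\<integral>x. (norm (A x))\<^sup>2 \<partial>?L)"
  define v where "v = (\<integral>x. V x \<partial>?L)"
  define s where "s = enn2real (Linf_norm ?S \<sigma>)"
  define r where "r = enn2real (Ar \<Omega>)"
  have Vol: "0 < Vol \<Omega>"
    using open_not_negligible[OF \<Omega>(2,1)] \<Omega>_lmeasurable
    by (simp add: Vol_def negligible_iff_measure zero_less_measure_iff)
  have nonneg: "0 \<le> a" "0 \<le> v" "0 \<le> s" "0 \<le> r" "0 \<le> weyl_term \<Omega> k"
    using V_nonneg by (auto simp: a_def v_def s_def r_def weyl_term_def Let_def integral_nonneg_AE)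
  have a: "L2_norm_squared ?L A = ennreal a"
    unfolding L2_norm_squared_def a_def by (rule nn_integral_eq_integral[OF A_sq]) simp
  have v: "L1_norm ?L V = ennreal v"
  proof -
    have "L1_norm ?L V = (\<integral>\<^sup>+x. ennreal (V x) \<partial>?L)"
      unfolding L1_norm_def by (rule nn_integral_cong_AE) (use V_nonneg in \<open>eventually_elim, simp\<close>)
    then show ?thesis unfolding v_def using nn_integral_eq_integral[OF V_int V_nonneg] by simp
  qed
  have s: "Linf_norm ?S \<sigma> = ennreal s" using \<sigma>_fin by (simp add: s_def less_top)
  have r: "Ar \<Omega> = ennreal r" using Ar_fin by (simp add: r_def less_top)
  define X where "X = weyl_term \<Omega> k + real (k\<^sup>2) * (r / Vol \<Omega>) * s + real (k\<^sup>2) * (a / Vol \<Omega>) + real k * (v / Vol \<Omega>)"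
  have rhs: "ennreal (weyl_term \<Omega> k) + ?s + ?a + ?v = ennreal X"
    unfolding a v s r X_def using nonneg Vol
    by (simp add: divide_ennreal ennreal_of_nat_eq_real_of_nat ennreal_mult[symmetric] ennreal_plus[symmetric]
        del: ennreal_plus of_nat_power)
  have X: "0 \<le> X" using nonneg Vol by (simp add: X_def)
  have kk: "real k * t \<le> real (k\<^sup>2) * t" if "0 \<le> t" for t
    using that assms(6) by (intro mult_right_mono of_nat_mono self_le_power) auto
  have "(\<Sum>j=1..k. lam j) \<le> weyl_term \<Omega> k + real k * ((a + v + (\<integral>x. \<sigma> x \<partial>?S)) / Vol \<Omega>)"
    unfolding a_def v_def by (rule eigenvalue_sum_le[OF \<Omega>(1) compact assms(5,6)])
  also have "\<dots> \<le> weyl_term \<Omega> k + real k * ((a + v + r * s) / Vol \<Omega>)"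
    using \<sigma>_integral_le Vol unfolding r_def s_def
    by (intro add_left_mono mult_left_mono divide_right_mono) auto
  also have "\<dots> = weyl_term \<Omega> k + real k * (r / Vol \<Omega> * s) + real k * (a / Vol \<Omega>) + real k * (v / Vol \<Omega>)"
    by (simp add: add_divide_distrib distrib_left)
  also have "\<dots> \<le> X"
    unfolding X_def mult.assoc using nonneg Vol by (intro add_mono kk order_refl) auto
  finally have "ereal (\<Sum>j=1..k. lam j) \<le> ereal X" by simp
  also have "\<dots> = enn2ereal (ennreal X)" using X by (simp add: enn2ereal_ennreal)
  finally show ?thesis unfolding rhs .
qed

end
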